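(* Let ${\cal E}$ be a higher order anisotropic space of dimension $n_E=n+m_1+\dots+m_z$ with N-connection, d-metric $G$ and compatible d-connection with coefficients $\Gamma^{\alpha}_{\ \beta\gamma}$, and let $E_{\alpha\beta}$ be a given energy-momentum d-tensor. Then the Einstein equations $$R_{\alpha\beta}-\tfrac12\overleftarrow{R}\,G_{\alpha\beta}+\lambda G_{\alpha\beta}=\kappa E_{\alpha\beta}$$ are equivalent to the Yang-Mills equations $$\Delta\overline{{\cal R}}=\overline{{\cal J}}$$ for the induced Cartan connection $\overline{\Omega}$ in the bundle of local adapted affine frames ${\cal A}a({\cal E})$, where the source $\overline{{\cal J}}$ is constructed locally by the same formulas as $\Delta\overline{{\cal R}}$ but with the Ricci d-tensor $R_{\alpha\beta}$ changed into $\tilde E_{\alpha\beta}-\frac12 G_{\alpha\beta}\tilde E$; that is, on each local region ${\cal U}$, $$\overline{{\cal J}}_{\cal U}=\left[(\Delta{\cal R}^{(\Gamma)})_{\cal U},\ (R\tau)_{\cal U}+e_{\hat\alpha}\otimes(-1)^{n_E+1}\left(\tilde E_{\lambda\mu}-\tfrac12 G_{\lambda\mu}\tilde E\right)G^{\hat\alpha\lambda}\,\delta u^{\mu}\right],$$ with $\tilde E_{\alpha\beta}=\kappa E_{\alpha\beta}-\lambda G_{\alpha\beta}$ and $\tilde E=G^{\alpha\beta}\tilde E_{\alpha\beta}$.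
   Context: Space. ${\cal E}$ is the total space of a distinguished vector bundle over an $n$-dimensional manifold $M$, with typical fibre $\mathbb{R}^{m_1}\oplus\dots\oplus\mathbb{R}^{m_z}$, with local coordinates $u^{\alpha}=(x^i,y^{a_1},\dots,y^{a_z})$, $i=1,\dots,n$, $a_p=1,\dots,m_p$. A nonlinear connection (N-connection) is a splitting $T{\cal E}=H{\cal E}\oplus V_1{\cal E}\oplus\dots\oplus V_z{\cal E}$; it has coefficients $N^{a_p}_{a_f}$ $(0\le f<p\le z$, $a_0=i)$ and adapted frames $\delta_\alpha=(\delta_i,\delta_{a_1},\dots,\delta_{a_z})$, $\delta_{a_f}=\partial_{a_f}-\sum_{p>f}N^{a_p}_{a_f}\partial_{a_p}$, with dual coframe $\delta u^{\alpha}$. A d-metric is a nondegenerate symmetric tensor $G=G_{\alpha\beta}\,\delta u^\alpha\otimes\delta u^\beta=g_{ij}\,\delta u^i\otimes\delta u^j+\sum_p h_{a_pb_p}\,\delta u^{a_p}\otimes\delta u^{b_p}$. A d-connection $D$ is a linear connection preserving the splitting under parallelism, with $D_\alpha\delta_\beta=\Gamma^\gamma_{\ \alpha\beta}\delta_\gamma$; it is compatible if $DG=0$. Its torsion and curvature are $T(X,Y)=D_XY-D_YX-[X,Y]$ and $R(X,Y)Z=D_XD_YZ-D_YD_XZ-D_{[X,Y]}Z$, with components $R_{\beta\ \gamma\delta}^{\ \alpha}=\delta u^{\alpha}(R(\delta_\delta,\delta_\gamma)\delta_\beta)$; the Ricci d-tensor (in general nonsymmetric) is $R_{\alpha\beta}=R_{\alpha\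 \beta\tau}^{\ \tau}$ and the scalar curvature is $\overleftarrow{R}=G^{\alpha\beta}R_{\alpha\beta}$. $\lambda$ and $\kappa$ are the cosmological and gravitational constants. Frame bundles. ${\cal L}a({\cal E})$ is the principal bundle of frames adapted to the splitting, with group $GL_{n_E}(\mathbb{R})=GL(n,\mathbb{R})\oplus GL(m_1,\mathbb{R})\oplus\dots\oplus GL(m_z,\mathbb{R})$. ${\cal A}a({\cal E})$ is the bundle of adapted affine frames, with group the extension of $GL_{n_E}(\mathbb{R})$ by the translations $\mathbb{R}^{n_E}$; as a vector space its Lie algebra is $gl_{n_E}(\mathbb{R})\oplus\mathbb{R}^{n_E}$, and forms with values in it are written as pairs. The d-connection defines on ${\cal L}a({\cal E})$ the connection $\Omega$ whose local $gl_{n_E}$-valued 1-form $\Omega_{\cal U}$ has components $\Gamma^{\alpha}_{\ \beta\gamma}$, with curvature ${\cal R}^{(\Gamma)}_{\cal U}=d\Omega_{\cal U}+\frac12[\Omega_{\cal U},\Omega_{\cal U}]$. The induced Cartan connection $\overline\Omega$ on ${\cal A}a({\cal E})$ is locally $\overline\Omega_{\cal U}=(\Omega_{\cal U},\chi_{\cal U})$, where $\chi_{\cal U}=e_{\hat\alpha}\otimes\chi^{\hat\alpha}_{\ \mu}\delta u^\mu$ is the shifting form, $e_{\hat\alpha}$ is the standard basis of $\mathbb{R}^{n_E}$, and $G_{\alpha\beta}=\chi^{\hat\alpha}_{\ \alpha}\chi^{\hat\beta}_{\ \beta}\eta_{\hat\alpha\hat\beta}$ with $\eta$ diagonal with entries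 $\pm1$; $G^{\hat\alpha\lambda}=\chi^{\hat\alpha}_{\ \alpha}G^{\alpha\lambda}$. Its curvature is $\overline{\cal R}_{\cal U}=({\cal R}^{(\Gamma)}_{\cal U},T_{\cal U})$ with $T_{\cal U}=d\chi_{\cal U}+\Omega_{\cal U}\wedge\chi_{\cal U}+\chi_{\cal U}\wedge\Omega_{\cal U}$, identified with the torsion of the d-connection. Yang-Mills operator. $*_G$ is the Hodge operator of $G$, and on $r$-forms $\hat\delta_G=(-1)^r *_G^{-1}\circ d\circ *_G$, extended to Lie-algebra-valued forms. The equation $\Delta\overline{\cal R}=\overline{\cal J}$ is understood through its projection on the base: for a connection with local form $\omega_{\cal U}$ and curvature ${\cal K}_{\cal U}$, $(\Delta{\cal K})_{\cal U}=\hat\delta_G{\cal K}_{\cal U}+*_G^{-1}[\omega_{\cal U},*_G{\cal K}_{\cal U}]$. For the Cartan connection this has the form $$(\Delta\overline{\cal R})_{\cal U}=\left[(\Delta{\cal R}^{(\Gamma)})_{\cal U},\ (R\tau)_{\cal U}+(Ri)_{\cal U}\right],$$ $$(R\tau)_{\cal U}=\hat\delta_GT_{\cal U}+*_G^{-1}[\Omega_{\cal U},*_GT_{\cal U}],\qquad (Ri)_{\cal U}=*_G^{-1}[\chi_{\cal U},*_G{\cal R}^{(\Gamma)}_{\cal U}]=e_{\hat\alpha}\otimes(-1)^{n_E+1}R_{\lambda\mu}G^{\hat\alpha\lambda}\delta u^\mu .$$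
   Formalization: The equivalence fails for general n_E (e.g. the hyperbolic plane times a line, n_E = 3), so it is stated under the added hypothesis that n_E = 4, or that n_E ≠ 2 and the trace Ẽ = G^{αβ}Ẽ_{αβ} vanishes everywhere. *)

theory Defs
  imports "HOL-Analysis.Analysis"
begin

section \<open>Calculus on open subsets of coordinate space\<close>

abbreviation deriv_at :: "(real^'n \<Rightarrow> 'b::real_normed_vector) \<Rightarrow> real^'n \<Rightarrow> real^'n \<Rightarrow> 'b"
  where "deriv_at f u \<equiv> frechet_derivative f (at u)"

primrec Ck_on :: "nat \<Rightarrow> (real^'n) set \<Rightarrow> (real^'n \<Rightarrow> 'b::real_normed_vector) \<Rightarrow> bool" where
  "Ck_on 0 W f \<longleftrightarrow> continuous_on W f"
| "Ck_on (Suc k) W f \<longleftrightarrow> f differentiable_on W \<and> (\<forall>v. Ck_on k W (\<lambda>u. deriv_at f u v))"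

definition smooth_on :: "(real^'n) set \<Rightarrow> (real^'n \<Rightarrow> 'b::real_normed_vector) \<Rightarrow> bool" where
  "smooth_on W f \<longleftrightarrow> (\<forall>k. Ck_on k W f)"

definition lie_bracket :: "(real^'n \<Rightarrow> real^'n) \<Rightarrow> (real^'n \<Rightarrow> real^'n) \<Rightarrow> real^'n \<Rightarrow> real^'n" where
  "lie_bracket X Y u = deriv_at Y u (X u) - deriv_at X u (Y u)"

section \<open>Distinguished vector bundles\<close>

text \<open>
  The index type \<open>'n\<close> labels all coordinates \<open>(x, y_1, ..., y_z)\<close> of the total space, so
  \<open>CARD('n) = n + m_1 + ... + m_z\<close>. The function \<open>sh\<close> sends an index to its shell: \<open>0\<close> for the
  base coordinates \<open>x\<close> and \<open>p\<close> for the \<open>m_p\<close> coordinates \<open>y_p\<close>.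
\<close>

definition block_diag :: "('n \<Rightarrow> nat) \<Rightarrow> real^'n^'n \<Rightarrow> bool" where
  "block_diag sh A \<longleftrightarrow> (\<forall>a b. sh a \<noteq> sh b \<longrightarrow> A $ a $ b = 0)"

definition base_part :: "('n \<Rightarrow> nat) \<Rightarrow> real^'n \<Rightarrow> real^'n" where
  "base_part sh u = (\<chi> i. if sh i = 0 then u $ i else 0)"

definition chart_image :: "('e \<Rightarrow> 'm) \<Rightarrow> ('c \<Rightarrow> 'm set) \<Rightarrow> ('c \<Rightarrow> 'e \<Rightarrow> real^'n) \<Rightarrow> 'c \<Rightarrow> (real^'n) set"
  where "chart_image pr V \<phi> c = \<phi> c ` (pr -` V c)"

definition overlap :: "('e \<Rightarrow> 'm) \<Rightarrow> ('c \<Rightarrow> 'm set) \<Rightarrow> ('c \<Rightarrow> 'e \<Rightarrow> real^'n) \<Rightarrow> 'c \<Rightarrow> 'c \<Rightarrow> (real^'n) set"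
  where "overlap pr V \<phi> c d = \<phi> c ` (pr -` (V c \<inter> V d))"

definition transition ::
  "('e \<Rightarrow> 'm) \<Rightarrow> ('c \<Rightarrow> 'm set) \<Rightarrow> ('c \<Rightarrow> 'e \<Rightarrow> real^'n) \<Rightarrow> 'c \<Rightarrow> 'c \<Rightarrow> real^'n \<Rightarrow> real^'n"
  where "transition pr V \<phi> c d u = \<phi> d (the_inv_into (pr -` V c) (\<phi> c) u)"

locale distinguished_bundle =
  fixes sh :: "'n::finite \<Rightarrow> nat" and z :: nat
    and pr :: "'e::{t2_space,second_countable_topology} \<Rightarrow> 'm::{t2_space,second_countable_topology}"
    and C :: "'c set" and V :: "'c \<Rightarrow> 'm set" and \<phi> :: "'c \<Rightarrow> 'e \<Rightarrow> real^'n"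
  assumes shells: "range sh = {0..z}"
    and pr_surj: "surj pr" and pr_cont: "continuous_on UNIV pr"
    and pr_open: "open A \<Longrightarrow> open (pr ` A)"
    and V_cover: "(\<Union>c\<in>C. V c) = UNIV"
    and V_open: "c \<in> C \<Longrightarrow> open (V c)"
    and image_open: "c \<in> C \<Longrightarrow> open (chart_image pr V \<phi> c)"
    and chart_homeo: "c \<in> C \<Longrightarrow> \<exists>\<psi>. homeomorphism (pr -` V c) (chart_image pr V \<phi> c) (\<phi> c) \<psi>"
    and chart_base: "\<lbrakk>c \<in> C; pr e \<in> V c; pr e' \<in> V c\<rbrakk> \<Longrightarrow>
        pr e = pr e' \<longleftrightarrow> base_part sh (\<phi> c e) = base_part sh (\<phi> c e')"
    and chart_fibre: "\<lbrakk>c \<in> C; u \<in> chart_image pr V \<phi> c; base_part sh u' = base_part sh u\<rbrakk> \<Longrightarrow>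
        u' \<in> chart_image pr V \<phi> c"
    and transition_smooth: "\<lbrakk>c \<in> C; d \<in> C\<rbrakk> \<Longrightarrow>
        smooth_on (overlap pr V \<phi> c d) (transition pr V \<phi> c d)"
    and transition_linear: "\<lbrakk>c \<in> C; d \<in> C\<rbrakk> \<Longrightarrow>
        \<exists>K :: real^'n \<Rightarrow> real^'n^'n. \<forall>u \<in> overlap pr V \<phi> c d. \<forall>a. sh a > 0 \<longrightarrow>
          transition pr V \<phi> c d u $ a = (\<Sum>b | sh b = sh a. K (base_part sh u) $ a $ b * u $ b)"

section \<open>N-connections, d-tensors and d-connections in local coordinates\<close>

text \<open>
  \<open>N u $ a $ b\<close> is \<open>N^a_b\<close> and matters only for \<open>sh b < sh a\<close>. Column \<open>\<alpha>\<close> of \<open>nframe sh N u\<close>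
  holds the coordinate components of \<open>\<delta>_\<alpha>\<close>, so multiplication by \<open>ncoframe sh N u\<close> evaluates the
  dual coframe \<open>\<delta>u^\<alpha>\<close>.
\<close>

definition nframe :: "('n::finite \<Rightarrow> nat) \<Rightarrow> (real^'n \<Rightarrow> real^'n^'n) \<Rightarrow> real^'n \<Rightarrow> real^'n^'n" where
  "nframe sh N u =
    (\<chi> a b. if a = b then 1 else if sh b < sh a then - (N u $ a $ b) else 0)"

definition ncoframe :: "('n::finite \<Rightarrow> nat) \<Rightarrow> (real^'n \<Rightarrow> real^'n^'n) \<Rightarrow> real^'n \<Rightarrow> real^'n^'n" where
  "ncoframe sh N u = matrix_inv (nframe sh N u)"

definition delta :: "('n::finite \<Rightarrow> nat) \<Rightarrow> (real^'n \<Rightarrow> real^'n^'n) \<Rightarrow> 'n \<Rightarrow> real^'n \<Rightarrow> real^'n" where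
  "delta sh N \<alpha> u = column \<alpha> (nframe sh N u)"

definition splitting :: "('n::finite \<Rightarrow> nat) \<Rightarrow> (real^'n \<Rightarrow> real^'n^'n) \<Rightarrow> nat \<Rightarrow> real^'n \<Rightarrow> (real^'n) set"
  where "splitting sh N p u = span {delta sh N \<alpha> u |\<alpha>. sh \<alpha> = p}"

text \<open>\<open>\<Gamma> u \<gamma> \<alpha> \<beta>\<close> is \<open>\<Gamma>^\<gamma>_{\<alpha>\<beta>}\<close>; \<open>nabla sh N \<Gamma> Y u v\<close> is \<open>D_v Y\<close> at \<open>u\<close>.\<close>

definition nabla ::
  "('n::finite \<Rightarrow> nat) \<Rightarrow> (real^'n \<Rightarrow> real^'n^'n) \<Rightarrow> (real^'n \<Rightarrow> 'n \<Rightarrow> 'n \<Rightarrow> 'n \<Rightarrow> real) \<Rightarrow>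
   (real^'n \<Rightarrow> real^'n) \<Rightarrow> real^'n \<Rightarrow> real^'n \<Rightarrow> real^'n" where
  "nabla sh N \<Gamma> Y u v = nframe sh N u *v
    (\<chi> \<gamma>. deriv_at (\<lambda>w. (ncoframe sh N w *v Y w) $ \<gamma>) u v
       + (\<Sum>\<alpha>\<in>UNIV. \<Sum>\<beta>\<in>UNIV. \<Gamma> u \<gamma> \<alpha> \<beta> * (ncoframe sh N u *v v) $ \<alpha> * (ncoframe sh N u *v Y u) $ \<beta>))"

definition metric_form ::
  "('n::finite \<Rightarrow> nat) \<Rightarrow> (real^'n \<Rightarrow> real^'n^'n) \<Rightarrow> (real^'n \<Rightarrow> real^'n^'n) \<Rightarrow> real^'n \<Rightarrow> real^'n \<Rightarrow> real^'n \<Rightarrow> real"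
  where "metric_form sh N G u v w = (ncoframe sh N u *v v) \<bullet> (G u *v (ncoframe sh N u *v w))"

definition curvature ::
  "('n::finite \<Rightarrow> nat) \<Rightarrow> (real^'n \<Rightarrow> real^'n^'n) \<Rightarrow> (real^'n \<Rightarrow> 'n \<Rightarrow> 'n \<Rightarrow> 'n \<Rightarrow> real) \<Rightarrow>
   (real^'n \<Rightarrow> real^'n) \<Rightarrow> (real^'n \<Rightarrow> real^'n) \<Rightarrow> (real^'n \<Rightarrow> real^'n) \<Rightarrow> real^'n \<Rightarrow> real^'n" where
  "curvature sh N \<Gamma> X Y Z u =
     nabla sh N \<Gamma> (\<lambda>w. nabla sh N \<Gamma> Z w (Y w)) u (X u)
   - nabla sh N \<Gamma> (\<lambda>w. nabla sh N \<Gamma> Z w (X w)) u (Y u)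
   - nabla sh N \<Gamma> Z u (lie_bracket X Y u)"

text \<open>\<open>curv_comp sh N \<Gamma> u \<beta> \<alpha> \<gamma> \<delta>\<close> is \<open>R_\<beta>^\<alpha>_{\<gamma>\<delta>} = \<delta>u^\<alpha>(R(\<delta>_\<delta>, \<delta>_\<gamma>) \<delta>_\<beta>)\<close>.\<close>

definition curv_comp ::
  "('n::finite \<Rightarrow> nat) \<Rightarrow> (real^'n \<Rightarrow> real^'n^'n) \<Rightarrow> (real^'n \<Rightarrow> 'n \<Rightarrow> 'n \<Rightarrow> 'n \<Rightarrow> real) \<Rightarrow>
   real^'n \<Rightarrow> 'n \<Rightarrow> 'n \<Rightarrow> 'n \<Rightarrow> 'n \<Rightarrow> real" where
  "curv_comp sh N \<Gamma> u \<beta> \<alpha> \<gamma> \<delta> =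
    (ncoframe sh N u *v curvature sh N \<Gamma> (delta sh N \<delta>) (delta sh N \<gamma>) (delta sh N \<beta>) u) $ \<alpha>"

definition ricci ::
  "('n::finite \<Rightarrow> nat) \<Rightarrow> (real^'n \<Rightarrow> real^'n^'n) \<Rightarrow> (real^'n \<Rightarrow> 'n \<Rightarrow> 'n \<Rightarrow> 'n \<Rightarrow> real) \<Rightarrow> real^'n \<Rightarrow> real^'n^'n"
  where "ricci sh N \<Gamma> u = (\<chi> \<alpha> \<beta>. \<Sum>\<tau>\<in>UNIV. curv_comp sh N \<Gamma> u \<alpha> \<tau> \<beta> \<tau>)"

definition g_trace :: "real^'n^'n \<Rightarrow> real^'n^'n \<Rightarrow> real" where
  "g_trace G A = (\<Sum>\<alpha>\<in>UNIV. \<Sum>\<beta>\<in>UNIV. matrix_inv G $ \<alpha> $ \<beta> * A $ \<alpha> $ \<beta>)"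

definition scalar_curvature ::
  "('n::finite \<Rightarrow> nat) \<Rightarrow> (real^'n \<Rightarrow> real^'n^'n) \<Rightarrow> (real^'n \<Rightarrow> real^'n^'n) \<Rightarrow>
   (real^'n \<Rightarrow> 'n \<Rightarrow> 'n \<Rightarrow> 'n \<Rightarrow> real) \<Rightarrow> real^'n \<Rightarrow> real" where
  "scalar_curvature sh N G \<Gamma> u = g_trace (G u) (ricci sh N \<Gamma> u)"

section \<open>Higher order anisotropic spaces\<close>

text \<open>
  Matrix, in adapted frames, of the differential of a coordinate change. The two local N-connections
  define the same splitting of the tangent bundle iff it is block diagonal.
\<close>

definition adapted_jacobian ::
  "('n::finite \<Rightarrow> nat) \<Rightarrow> ('e \<Rightarrow> 'm) \<Rightarrow> ('c \<Rightarrow> 'm set) \<Rightarrow> ('c \<Rightarrow> 'e \<Rightarrow> real^'n) \<Rightarrow>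
   ('c \<Rightarrow> real^'n \<Rightarrow> real^'n^'n) \<Rightarrow> 'c \<Rightarrow> 'c \<Rightarrow> real^'n \<Rightarrow> real^'n^'n" where
  "adapted_jacobian sh pr V \<phi> N c d u =
     ncoframe sh (N d) (transition pr V \<phi> c d u)
     ** matrix (deriv_at (transition pr V \<phi> c d) u) ** nframe sh (N c) u"

text \<open>Second-rank covariant tensor fields, given by their components in the adapted frames.\<close>

definition d_tensor ::
  "('n::finite \<Rightarrow> nat) \<Rightarrow> ('e \<Rightarrow> 'm) \<Rightarrow> 'c set \<Rightarrow> ('c \<Rightarrow> 'm set) \<Rightarrow> ('c \<Rightarrow> 'e \<Rightarrow> real^'n) \<Rightarrow>
   ('c \<Rightarrow> real^'n \<Rightarrow> real^'n^'n) \<Rightarrow> ('c \<Rightarrow> real^'n \<Rightarrow> real^'n^'n) \<Rightarrow> bool" where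
  "d_tensor sh pr C V \<phi> N B \<longleftrightarrow>
     (\<forall>c\<in>C. smooth_on (chart_image pr V \<phi> c) (B c)) \<and>
     (\<forall>c\<in>C. \<forall>d\<in>C. \<forall>u\<in>overlap pr V \<phi> c d.
        B c u = transpose (adapted_jacobian sh pr V \<phi> N c d u) ** B d (transition pr V \<phi> c d u)
                ** adapted_jacobian sh pr V \<phi> N c d u)"

locale anisotropic_space = distinguished_bundle sh z pr C V \<phi>
  for sh :: "'n::finite \<Rightarrow> nat" and z :: nat
    and pr :: "'e::{t2_space,second_countable_topology} \<Rightarrow> 'm::{t2_space,second_countable_topology}"
    and C :: "'c set" and V :: "'c \<Rightarrow> 'm set" and \<phi> :: "'c \<Rightarrow> 'e \<Rightarrow> real^'n" +
  fixes N :: "'c \<Rightarrow> real^'n \<Rightarrow> real^'n^'n"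
    and G :: "'c \<Rightarrow> real^'n \<Rightarrow> real^'n^'n"
    and \<Gamma> :: "'c \<Rightarrow> real^'n \<Rightarrow> 'n \<Rightarrow> 'n \<Rightarrow> 'n \<Rightarrow> real"
  assumes N_smooth: "c \<in> C \<Longrightarrow> smooth_on (chart_image pr V \<phi> c) (nframe sh (N c))"
    and N_global: "\<lbrakk>c \<in> C; d \<in> C; u \<in> overlap pr V \<phi> c d\<rbrakk> \<Longrightarrow>
        block_diag sh (adapted_jacobian sh pr V \<phi> N c d u)"
    and G_tensor: "d_tensor sh pr C V \<phi> N G"
    and G_metric: "\<lbrakk>c \<in> C; u \<in> chart_image pr V \<phi> c\<rbrakk> \<Longrightarrow>
        transpose (G c u) = G c u \<and> invertible (G c u) \<and> block_diag sh (G c u)"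
    and \<Gamma>_smooth: "c \<in> C \<Longrightarrow> smooth_on (chart_image pr V \<phi> c) (\<lambda>u. \<Gamma> c u \<gamma> \<alpha> \<beta>)"
    and \<Gamma>_global: "\<lbrakk>c \<in> C; d \<in> C; smooth_on (overlap pr V \<phi> c d) Y; smooth_on (overlap pr V \<phi> d c) Y';
        \<forall>w \<in> overlap pr V \<phi> c d.
          Y' (transition pr V \<phi> c d w) = deriv_at (transition pr V \<phi> c d) w (Y w);
        u \<in> overlap pr V \<phi> c d\<rbrakk> \<Longrightarrow>
        nabla sh (N d) (\<Gamma> d) Y' (transition pr V \<phi> c d u) (deriv_at (transition pr V \<phi> c d) u v)
        = deriv_at (transition pr V \<phi> c d) u (nabla sh (N c) (\<Gamma> c) Y u v)"
    and \<Gamma>_splitting: "\<lbrakk>c \<in> C; smooth_on (chart_image pr V \<phi> c) Y;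
        \<forall>w \<in> chart_image pr V \<phi> c. Y w \<in> splitting sh (N c) p w; u \<in> chart_image pr V \<phi> c\<rbrakk> \<Longrightarrow>
        nabla sh (N c) (\<Gamma> c) Y u v \<in> splitting sh (N c) p u"
    and \<Gamma>_compatible: "\<lbrakk>c \<in> C; smooth_on (chart_image pr V \<phi> c) Y; smooth_on (chart_image pr V \<phi> c) Z;
        u \<in> chart_image pr V \<phi> c\<rbrakk> \<Longrightarrow>
        deriv_at (\<lambda>w. metric_form sh (N c) (G c) w (Y w) (Z w)) u v
        = metric_form sh (N c) (G c) u (nabla sh (N c) (\<Gamma> c) Y u v) (Z u)
        + metric_form sh (N c) (G c) u (Y u) (nabla sh (N c) (\<Gamma> c) Z u v)"

section \<open>Vector-valued differential forms\<close>

text \<open>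
  A form of degree \<open>r\<close> at a point is an alternating multilinear function of the lists of \<open>r\<close>
  vectors, extended by zero to lists of any other length.
\<close>

type_synonym ('n, 'g) form = "(real^'n) list \<Rightarrow> 'g"
type_synonym ('n, 'g) form_field = "real^'n \<Rightarrow> ('n, 'g) form"

definition alt_form :: "nat \<Rightarrow> ('n::finite, 'g::real_vector) form \<Rightarrow> bool" where
  "alt_form r f \<longleftrightarrow>
     (\<forall>vs. length vs \<noteq> r \<longrightarrow> f vs = 0) \<and>
     (\<forall>vs k. length vs = r \<and> k < r \<longrightarrow> linear (\<lambda>v. f (vs[k := v]))) \<and>
     (\<forall>vs j k. length vs = r \<and> j < k \<and> k < r \<and> vs ! j = vs ! k \<longrightarrow> f vs = 0)"

definition one_form :: "(real^'n \<Rightarrow> real^'n \<Rightarrow> 'g::zero) \<Rightarrow> ('n, 'g) form_field" where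
  "one_form A u vs = (if length vs = 1 then A u (hd vs) else 0)"

definition omit :: "nat \<Rightarrow> 'a list \<Rightarrow> 'a list" where
  "omit k vs = take k vs @ drop (Suc k) vs"

definition ext_d :: "('n::finite, 'g::real_normed_vector) form_field \<Rightarrow> ('n, 'g) form_field" where
  "ext_d K u vs = (\<Sum>k<length vs. (-1) ^ k *\<^sub>R deriv_at (\<lambda>w. K w (omit k vs)) u (vs ! k))"

text \<open>
  \<open>[\<omega>, K]\<close> for a 1-form \<open>\<omega>\<close> and a form \<open>K\<close> of any degree, whose values are multiplied by a
  bilinear map \<open>br\<close>.
\<close>

definition form_bracket ::
  "('a \<Rightarrow> 'b \<Rightarrow> 'g::real_normed_vector) \<Rightarrow> ('n, 'a) form_field \<Rightarrow> ('n, 'b) form_field \<Rightarrow> ('n, 'g) form_field"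
  where "form_bracket br \<omega> K u vs =
    (\<Sum>k<length vs. (-1) ^ k *\<^sub>R br (\<omega> u [vs ! k]) (K u (omit k vs)))"

definition curvature_form ::
  "('g \<Rightarrow> 'g \<Rightarrow> 'g) \<Rightarrow> ('n::finite, 'g::real_normed_vector) form_field \<Rightarrow> ('n, 'g) form_field" where
  "curvature_form br \<omega> u vs = ext_d \<omega> u vs + (1/2) *\<^sub>R form_bracket br \<omega> \<omega> u vs"

text \<open>
  Volume form and Hodge operator of the metric with coordinate matrix \<open>g\<close>:
  \<open>(*\<omega>)_{\<mu>_1...\<mu>_{n-r}} = (1/r!) \<omega>^{\<nu>_1...\<nu>_r} \<epsilon>_{\<mu>_1...\<mu>_{n-r} \<nu>_r...\<nu>_1}\<close>.
  Sources differ in the order of the indices of \<open>\<epsilon>\<close>, which affects signs depending on \<open>n\<close> and \<open>r\<close>.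
  The order used here is one for which
  \<open>*\<^sup>-\<^sup>1[\<chi>, *R] = e_\<alpha> \<otimes> (-1)^{n+1} R_{\<lambda>\<mu>} G^{\<alpha>\<lambda>} \<delta>u^\<mu>\<close>
  holds in every dimension \<open>n\<close>. Orientation drops out of the Yang-Mills operator, so the
  enumeration \<open>to_nat_on UNIV\<close> of the coordinates may orient each chart arbitrarily.
\<close>

definition volume :: "real^'n^'n \<Rightarrow> (real^'n::finite) list \<Rightarrow> real" where
  "volume g vs = sqrt \<bar>det g\<bar> * det (\<chi> i. vs ! to_nat_on (UNIV :: 'n set) i)"

definition hodge :: "real^'n^'n \<Rightarrow> nat \<Rightarrow> ('n::finite, 'g::real_vector) form \<Rightarrow> ('n, 'g) form" where
  "hodge g r f vs =
    (if length vs + r = CARD('n)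
     then (1 / fact r) *\<^sub>R (\<Sum>is | length is = r.
            volume g (vs @ rev (map (\<lambda>i. matrix_inv g *v axis i 1) is)) *\<^sub>R f (map (\<lambda>i. axis i 1) is))
     else 0)"

definition hodge_inv :: "real^'n^'n \<Rightarrow> nat \<Rightarrow> ('n::finite, 'g::real_vector) form \<Rightarrow> ('n, 'g) form" where
  "hodge_inv g r = inv_into {f. alt_form r f} (hodge g r)"

definition codiff ::
  "(real^'n \<Rightarrow> real^'n^'n) \<Rightarrow> nat \<Rightarrow> ('n::finite, 'g::real_normed_vector) form_field \<Rightarrow> ('n, 'g) form_field" where
  "codiff g r K u =
     (\<lambda>vs. (-1) ^ r *\<^sub>R hodge_inv (g u) (r - 1) (ext_d (\<lambda>w. hodge (g w) r (K w)) u) vs)"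

definition yang_mills ::
  "('a \<Rightarrow> 'g \<Rightarrow> 'g) \<Rightarrow> (real^'n \<Rightarrow> real^'n^'n) \<Rightarrow> ('n, 'a) form_field \<Rightarrow>
   ('n::finite, 'g::real_normed_vector) form_field \<Rightarrow> ('n, 'g) form_field" where
  "yang_mills br g \<omega> K u vs =
     codiff g 2 K u vs + hodge_inv (g u) 1 (form_bracket br \<omega> (\<lambda>w. hodge (g w) 2 (K w)) u) vs"

section \<open>The Cartan connection on the bundle of adapted affine frames\<close>

text \<open>
  Brackets of the linear and of the affine Lie algebra; the latter is written as pairs. The algebra of
  the adapted frame bundle is the subalgebra of block diagonal matrices.
\<close>

definition gl_bracket :: "real^'n^'n \<Rightarrow> real^'n^'n \<Rightarrow> real^'n^'n" where
  "gl_bracket A B = A ** B - B ** A"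

definition aff_bracket ::
  "(real^'n^'n) \<times> (real^'n) \<Rightarrow> (real^'n^'n) \<times> (real^'n) \<Rightarrow> (real^'n^'n) \<times> (real^'n)" where
  "aff_bracket S T = (gl_bracket (fst S) (fst T), fst S *v snd T - fst T *v snd S)"

text \<open>
  A gauge over a coordinate region \<open>W\<close>: \<open>vb u $ a $ \<alpha>\<close> is \<open>\<chi>^a_\<alpha>\<close>, with \<open>a\<close> the hatted index, and the
  rows of \<open>vb\<close> are the coframe dual to a section of the bundle of adapted frames.
\<close>

definition local_gauge ::
  "('n::finite \<Rightarrow> nat) \<Rightarrow> (real^'n \<Rightarrow> real^'n^'n) \<Rightarrow> (real^'n) set \<Rightarrow> ('n \<Rightarrow> real) \<Rightarrow> (real^'n \<Rightarrow> real^'n^'n) \<Rightarrow> bool"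
  where "local_gauge sh G W \<eta> vb \<longleftrightarrow>
     open W \<and> smooth_on W vb \<and> (\<forall>a. \<eta> a = 1 \<or> \<eta> a = -1) \<and>
     (\<forall>u\<in>W. block_diag sh (vb u) \<and>
        (\<forall>\<alpha> \<beta>. G u $ \<alpha> $ \<beta> = (\<Sum>a\<in>UNIV. vb u $ a $ \<alpha> * vb u $ a $ \<beta> * \<eta> a)))"

definition coord_metric ::
  "('n::finite \<Rightarrow> nat) \<Rightarrow> (real^'n \<Rightarrow> real^'n^'n) \<Rightarrow> (real^'n \<Rightarrow> real^'n^'n) \<Rightarrow> real^'n \<Rightarrow> real^'n^'n" where
  "coord_metric sh N G u = transpose (ncoframe sh N u) ** G u ** ncoframe sh N u"

text \<open>\<open>\<chi>_U = e_a \<otimes> \<chi>^a_\<mu> \<delta>u^\<mu>\<close>\<close>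

definition shift_form ::
  "('n::finite \<Rightarrow> nat) \<Rightarrow> (real^'n \<Rightarrow> real^'n^'n) \<Rightarrow> (real^'n \<Rightarrow> real^'n^'n) \<Rightarrow> ('n, real^'n) form_field" where
  "shift_form sh N vb = one_form (\<lambda>u v. vb u *v (ncoframe sh N u *v v))"

definition gauge_frame ::
  "('n::finite \<Rightarrow> nat) \<Rightarrow> (real^'n \<Rightarrow> real^'n^'n) \<Rightarrow> (real^'n \<Rightarrow> real^'n^'n) \<Rightarrow> 'n \<Rightarrow> real^'n \<Rightarrow> real^'n" where
  "gauge_frame sh N vb b u = column b (nframe sh N u ** matrix_inv (vb u))"

text \<open>
  The connection form on the region is taken with respect to the same section as the shifting form:
  its entries \<open>\<Omega>^a_b(v) = \<chi>^a(D_v e_b)\<close> are the connection coefficients in the frame dual to \<open>\<chi>\<close>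
  (for \<open>\<chi> = 1\<close> they are \<open>\<Gamma>^a_{\<gamma>b} \<delta>u^\<gamma>(v)\<close>). This is what makes \<open>d\<chi> + \<Omega> \<and> \<chi>\<close> the torsion.
\<close>

definition connection_form ::
  "('n::finite \<Rightarrow> nat) \<Rightarrow> (real^'n \<Rightarrow> real^'n^'n) \<Rightarrow> (real^'n \<Rightarrow> 'n \<Rightarrow> 'n \<Rightarrow> 'n \<Rightarrow> real) \<Rightarrow>
   (real^'n \<Rightarrow> real^'n^'n) \<Rightarrow> ('n, real^'n^'n) form_field" where
  "connection_form sh N \<Gamma> vb = one_form (\<lambda>u v. \<chi> a b.
     (vb u *v (ncoframe sh N u *v nabla sh N \<Gamma> (gauge_frame sh N vb b) u v)) $ a)"

definition cartan_form ::
  "('n::finite \<Rightarrow> nat) \<Rightarrow> (real^'n \<Rightarrow> real^'n^'n) \<Rightarrow> (real^'n \<Rightarrow> 'n \<Rightarrow> 'n \<Rightarrow> 'n \<Rightarrow> real) \<Rightarrow>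
   (real^'n \<Rightarrow> real^'n^'n) \<Rightarrow> ('n, (real^'n^'n) \<times> (real^'n)) form_field" where
  "cartan_form sh N \<Gamma> vb u vs = (connection_form sh N \<Gamma> vb u vs, shift_form sh N vb u vs)"

text \<open>The term \<open>\<chi> \<and> \<Omega>\<close> of \<open>T = d\<chi> + \<Omega> \<and> \<chi> + \<chi> \<and> \<Omega>\<close> vanishes, as translations act trivially on vectors.\<close>

definition torsion_form ::
  "('n::finite \<Rightarrow> nat) \<Rightarrow> (real^'n \<Rightarrow> real^'n^'n) \<Rightarrow> (real^'n \<Rightarrow> 'n \<Rightarrow> 'n \<Rightarrow> 'n \<Rightarrow> real) \<Rightarrow>
   (real^'n \<Rightarrow> real^'n^'n) \<Rightarrow> ('n, real^'n) form_field" where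
  "torsion_form sh N \<Gamma> vb u vs = ext_d (shift_form sh N vb) u vs
     + form_bracket (*v) (connection_form sh N \<Gamma> vb) (shift_form sh N vb) u vs"

definition ym_cartan ::
  "('n::finite \<Rightarrow> nat) \<Rightarrow> (real^'n \<Rightarrow> real^'n^'n) \<Rightarrow> (real^'n \<Rightarrow> real^'n^'n) \<Rightarrow>
   (real^'n \<Rightarrow> 'n \<Rightarrow> 'n \<Rightarrow> 'n \<Rightarrow> real) \<Rightarrow> (real^'n \<Rightarrow> real^'n^'n) \<Rightarrow>
   ('n, (real^'n^'n) \<times> (real^'n)) form_field" where
  "ym_cartan sh N G \<Gamma> vb =
     yang_mills aff_bracket (coord_metric sh N G) (cartan_form sh N \<Gamma> vb)
       (curvature_form aff_bracket (cartan_form sh N \<Gamma> vb))"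

definition ym_linear ::
  "('n::finite \<Rightarrow> nat) \<Rightarrow> (real^'n \<Rightarrow> real^'n^'n) \<Rightarrow> (real^'n \<Rightarrow> real^'n^'n) \<Rightarrow>
   (real^'n \<Rightarrow> 'n \<Rightarrow> 'n \<Rightarrow> 'n \<Rightarrow> real) \<Rightarrow> (real^'n \<Rightarrow> real^'n^'n) \<Rightarrow> ('n, real^'n^'n) form_field" where
  "ym_linear sh N G \<Gamma> vb =
     yang_mills gl_bracket (coord_metric sh N G) (connection_form sh N \<Gamma> vb)
       (curvature_form gl_bracket (connection_form sh N \<Gamma> vb))"

text \<open>\<open>(R\<tau>)_U\<close>\<close>

definition ym_torsion ::
  "('n::finite \<Rightarrow> nat) \<Rightarrow> (real^'n \<Rightarrow> real^'n^'n) \<Rightarrow> (real^'n \<Rightarrow> real^'n^'n) \<Rightarrow>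
   (real^'n \<Rightarrow> 'n \<Rightarrow> 'n \<Rightarrow> 'n \<Rightarrow> real) \<Rightarrow> (real^'n \<Rightarrow> real^'n^'n) \<Rightarrow> ('n, real^'n) form_field" where
  "ym_torsion sh N G \<Gamma> vb =
     yang_mills (*v) (coord_metric sh N G) (connection_form sh N \<Gamma> vb) (torsion_form sh N \<Gamma> vb)"

text \<open>\<open>e_a \<otimes> (-1)^{n+1} S_{\<lambda>\<mu>} G^{a\<lambda>} \<delta>u^\<mu>\<close> with \<open>G^{a\<lambda>} = \<chi>^a_\<alpha> G^{\<alpha>\<lambda>}\<close>\<close>

definition translation_source ::
  "('n::finite \<Rightarrow> nat) \<Rightarrow> (real^'n \<Rightarrow> real^'n^'n) \<Rightarrow> (real^'n \<Rightarrow> real^'n^'n) \<Rightarrow>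
   (real^'n \<Rightarrow> real^'n^'n) \<Rightarrow> (real^'n \<Rightarrow> real^'n^'n) \<Rightarrow> ('n, real^'n) form_field" where
  "translation_source sh N G vb S = one_form (\<lambda>u v. \<chi> a.
     (-1) ^ (CARD('n) + 1) * (\<Sum>l\<in>UNIV. \<Sum>m\<in>UNIV.
       S u $ l $ m * (vb u ** matrix_inv (G u)) $ a $ l * (ncoframe sh N u *v v) $ m))"

definition ym_source ::
  "('n::finite \<Rightarrow> nat) \<Rightarrow> (real^'n \<Rightarrow> real^'n^'n) \<Rightarrow> (real^'n \<Rightarrow> real^'n^'n) \<Rightarrow>
   (real^'n \<Rightarrow> 'n \<Rightarrow> 'n \<Rightarrow> 'n \<Rightarrow> real) \<Rightarrow> (real^'n \<Rightarrow> real^'n^'n) \<Rightarrow> (real^'n \<Rightarrow> real^'n^'n) \<Rightarrow>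
   ('n, (real^'n^'n) \<times> (real^'n)) form_field" where
  "ym_source sh N G \<Gamma> vb E' u vs =
     (ym_linear sh N G \<Gamma> vb u vs,
      ym_torsion sh N G \<Gamma> vb u vs
      + translation_source sh N G vb (\<lambda>w. E' w - (1/2 * g_trace (G w) (E' w)) *\<^sub>R G w) u vs)"

definition shifted_source ::
  "real \<Rightarrow> real \<Rightarrow> (real^'n \<Rightarrow> real^'n^'n) \<Rightarrow> (real^'n \<Rightarrow> real^'n^'n) \<Rightarrow> real^'n \<Rightarrow> real^'n^'n" where
  "shifted_source lam kap G E u = kap *\<^sub>R E u - lam *\<^sub>R G u"

end

theory Submission
  imports Defs
begin

text \<open>
  With values in the affine algebra, the Yang-Mills operator of the Cartan connection splits into the
  linear Yang-Mills operator, that of the torsion, and the bracket of the shifting form \<open>\<chi>\<close> with the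
  dual of the curvature. Since \<open>\<chi> \<and> vol\<close> vanishes, having degree \<open>n + 1\<close>, that bracket is the dual of
  the contraction of the curvature with the frame dual to \<open>\<chi>\<close>. Metricity turns this contraction into the
  Ricci tensor, so the Yang-Mills equations say that the Ricci tensor equals \<open>E' - (1/2) G tr E'\<close> with
  \<open>E' = \<kappa> E - \<lambda> G\<close>. Trace reversal identifies this with the Einstein equations: taking traces, the
  curvature scalar is \<open>- tr E'\<close> if \<open>n = 4\<close> or \<open>tr E' = 0\<close>. The Hodge operator being bijective from
  1-forms to \<open>(n - 1)\<close>-forms, its inverse respects sums and pairs.
\<close>

section \<open>Smooth functions on open sets\<close>

text \<open>The dimension hypothesis comes from traces. With t = tr E' and r the curvature scalar,
  the Einstein equations give r (1 - n/2) = t and the Yang-Mills equations give r = t (1 - n/2).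
  Both can hold only if n = 4 or t = 0. For t = 0 and n = 2 the Einstein equations leave r free,
  while the Yang-Mills equations force r = 0. The linear and torsion components occur verbatim on
  both sides of the Yang-Mills equations and are never evaluated; only their differentiability is
  used, to split the operators on pairs. The comparison takes place in the translation component,
  where the order of indices matters because the Ricci tensor need not be symmetric. The Ricci
  tensor is given in the frames adapted to the N-connection, whereas the Cartan connection lives in
  an orthonormal gauge. Passing between them differentiates the gauge twice, hence the symmetry of
  second derivatives. Metricity is exploited in the gauge, where the metric is a constant
  matrix.\<close>

lemma deriv_at_cong_open:
  assumes W: "open W" "u \<in> W" and eq: "\<And>w. w \<in> W \<Longrightarrow> f w = g w"
  shows "deriv_at f u = deriv_at g u"
proof -
  \<comment> \<open>\<open>frechet_derivative\<close> is a choice among all derivatives; f and g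
    have the same ones at u, so the choices agree even where none exists.\<close>
  have "(f has_derivative D) (at u) \<longleftrightarrow> (g has_derivative D) (at u)" for D
    using has_derivative_transform_within_open[OF _ W] eq by metis
  then show ?thesis by (simp add: frechet_derivative_def)
qed

lemma Ck_on_cong:
  assumes "open W" "\<And>u. u \<in> W \<Longrightarrow> f u = g u"
  shows "Ck_on k W f \<longleftrightarrow> Ck_on k W g"
  using assms(2)
proof (induction k arbitrary: f g)
  case 0
  then show ?case by (simp cong: continuous_on_cong)
next
  case (Suc k)
  have "f differentiable_on W \<longleftrightarrow> g differentiable_on W"
    unfolding differentiable_on_def differentiable_def
    using Suc.prems by (metis (full_types) has_derivative_transform)
  moreover have "Ck_on k W (\<lambda>u. deriv_at f u v) \<longleftrightarrow> Ck_on k W (\<lambda>u. deriv_at g u v)" for v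
    by (rule Suc.IH) (simp add: deriv_at_cong_open[OF \<open>open W\<close> _ Suc.prems])
  ultimately show ?case by simp
qed

lemma smooth_on_cong:
  assumes "open W" "\<And>u. u \<in> W \<Longrightarrow> f u = g u"
  shows "smooth_on W f \<longleftrightarrow> smooth_on W g"
  using Ck_on_cong[OF assms] by (simp add: smooth_on_def)

text \<open>Lets an explicit derivative \<open>D\<close> stand in for the chosen one, so that
  differentiation rules can drive the inductions on the order.\<close>

lemma Ck_on_SucI:
  assumes W: "open W" and D: "\<And>u. u \<in> W \<Longrightarrow> (f has_derivative D u) (at u)"
    and k: "\<And>v. Ck_on k W (\<lambda>u. D u v)"
  shows "Ck_on (Suc k) W f"
proof -
  have "f differentiable_on W"
    using D by (meson differentiable_at_imp_differentiable_on differentiable_def)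
  moreover have "Ck_on k W (\<lambda>u. deriv_at f u v)" for v
  proof -
    have "D u v = deriv_at f u v" if "u \<in> W" for u
      using frechet_derivative_at[OF D[OF that]] by simp
    then show ?thesis
      using k[of v] Ck_on_cong[OF W, of "\<lambda>u. D u v" "\<lambda>u. deriv_at f u v" k] by fast
  qed
  ultimately show ?thesis by simp
qed

lemma Ck_on_Suc_has_derivative:
  assumes "open W" "Ck_on (Suc k) W f" "u \<in> W"
  shows "(f has_derivative deriv_at f u) (at u)"
  using assms frechet_derivative_works
  by (metis Ck_on.simps(2) differentiable_on_eq_differentiable_at)

lemma Ck_on_Suc_imp:
  assumes "Ck_on (Suc k) W f"
  shows "Ck_on k W f"
  using assms
proof (induction k arbitrary: f)
  case 0
  then show ?case by (simp add: differentiable_imp_continuous_on)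
next
  case (Suc k)
  then have "Ck_on k W (\<lambda>u. deriv_at f u v)" for v
    by (intro Suc.IH) simp
  then show ?case using Suc.prems by simp
qed

lemma smooth_on_differentiable:
  assumes "open W" "smooth_on W f" "u \<in> W"
  shows "f differentiable (at u)"
  using assms unfolding smooth_on_def
  by (metis Ck_on.simps(2) differentiable_on_eq_differentiable_at)

lemma smooth_on_has_derivative:
  assumes "open W" "smooth_on W f" "u \<in> W"
  shows "(f has_derivative deriv_at f u) (at u)"
  using smooth_on_differentiable[OF assms] frechet_derivative_works by blast

lemma smooth_on_deriv: "smooth_on W f \<Longrightarrow> smooth_on W (\<lambda>u. deriv_at f u v)"
  unfolding smooth_on_def by (metis Ck_on.simps(2))

lemma smooth_on_subset:
  assumes "smooth_on W f" "W' \<subseteq> W"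
  shows "smooth_on W' f"
proof -
  have "Ck_on k W f \<Longrightarrow> Ck_on k W' f" for k
  proof (induction k arbitrary: f)
    case 0
    then show ?case using assms(2) continuous_on_subset by auto
  next
    case (Suc k)
    then show ?case using assms(2) differentiable_on_subset by auto
  qed
  then show ?thesis using assms(1) by (simp add: smooth_on_def)
qed

section \<open>Closure of smoothness under algebraic operations\<close>

lemma Ck_on_const: "open W \<Longrightarrow> Ck_on k W (\<lambda>u. c)"
proof (induction k arbitrary: c)
  case (Suc k)
  then show ?case by (intro Ck_on_SucI[where D="\<lambda>u v. 0"]) auto
qed simp

lemma smooth_on_const: "open W \<Longrightarrow> smooth_on W (\<lambda>u. c)"
  by (simp add: smooth_on_def Ck_on_const)

lemma Ck_on_add:
  assumes W: "open W" and "Ck_on k W f" "Ck_on k W g"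
  shows "Ck_on k W (\<lambda>u. f u + g u)"
  using assms(2,3)
proof (induction k arbitrary: f g)
  case 0
  then show ?case by (simp add: continuous_on_add)
next
  case (Suc k)
  show ?case
    by (rule Ck_on_SucI[OF W has_derivative_add[OF Ck_on_Suc_has_derivative[OF W Suc.prems(1)]
            Ck_on_Suc_has_derivative[OF W Suc.prems(2)]]])
      (use Suc in \<open>auto intro!: Suc.IH\<close>)
qed

lemma smooth_on_add:
  "open W \<Longrightarrow> smooth_on W f \<Longrightarrow> smooth_on W g \<Longrightarrow> smooth_on W (\<lambda>u. f u + g u)"
  by (simp add: smooth_on_def Ck_on_add)

lemma smooth_on_sum:
  assumes W: "open W" and f: "\<And>i. i \<in> I \<Longrightarrow> smooth_on W (f i)"
  shows "smooth_on W (\<lambda>u. \<Sum>i\<in>I. f i u)"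
  using f by (induction I rule: infinite_finite_induct)
    (auto simp: smooth_on_const[OF W] intro!: smooth_on_add[OF W])

text \<open>The Leibniz rule gives two products in which one factor has lost an order and the other
  is lowered to match it, so the induction hypothesis applies to both.\<close>

lemma Ck_on_bilinear:
  assumes W: "open W" and B: "bounded_bilinear B" and "Ck_on k W f" "Ck_on k W g"
  shows "Ck_on k W (\<lambda>u. B (f u) (g u))"
  using assms(3,4)
proof (induction k arbitrary: f g)
  case 0
  then show ?case by (simp add: bounded_bilinear.continuous_on[OF B])
next
  case (Suc k)
  show ?case
  proof (rule Ck_on_SucI[OF W bounded_bilinear.FDERIV[OF B Ck_on_Suc_has_derivative[OF W Suc.prems(1)]
            Ck_on_Suc_has_derivative[OF W Suc.prems(2)]]])
    show "Ck_on k W (\<lambda>u. B (f u) (deriv_at g u v) + B (deriv_at f u v) (g u))" for v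
      using Suc.prems Ck_on_Suc_imp[OF Suc.prems(1)] Ck_on_Suc_imp[OF Suc.prems(2)]
      by (intro Ck_on_add[OF W] Suc.IH) auto
  qed
qed

lemma smooth_on_bilinear:
  "open W \<Longrightarrow> bounded_bilinear B \<Longrightarrow> smooth_on W f \<Longrightarrow> smooth_on W g \<Longrightarrow> smooth_on W (\<lambda>u. B (f u) (g u))"
  by (simp add: smooth_on_def Ck_on_bilinear)

lemma smooth_on_linear:
  assumes W: "open W" and L: "bounded_linear L" and f: "smooth_on W f"
  shows "smooth_on W (\<lambda>u. L (f u))"
proof -
  have "Ck_on k W f \<Longrightarrow> Ck_on k W (\<lambda>u. L (f u))" for k
  proof (induction k arbitrary: f)
    case 0
    then show ?case by (simp add: bounded_linear.continuous_on[OF L])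
  next
    case (Suc k)
    show ?case
      by (rule Ck_on_SucI[OF W bounded_linear.has_derivative[OF L Ck_on_Suc_has_derivative[OF W Suc.prems]]])
        (use Suc in auto)
  qed
  then show ?thesis using f by (simp add: smooth_on_def)
qed

lemma smooth_on_mult:
  fixes f g :: "real^'n \<Rightarrow> real"
  shows "open W \<Longrightarrow> smooth_on W f \<Longrightarrow> smooth_on W g \<Longrightarrow> smooth_on W (\<lambda>u. f u * g u)"
  by (rule smooth_on_bilinear[OF _ bounded_bilinear_mult])

lemma smooth_on_prod:
  fixes f :: "'i \<Rightarrow> real^'n \<Rightarrow> real"
  assumes W: "open W" and f: "\<And>i. i \<in> I \<Longrightarrow> smooth_on W (f i)"
  shows "smooth_on W (\<lambda>u. \<Prod>i\<in>I. f i u)"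
  using f by (induction I rule: infinite_finite_induct)
    (auto simp: smooth_on_const[OF W] intro!: smooth_on_mult[OF W])

text \<open>The derivative of 1/f is again built from 1/f, so the induction runs over the order for
  this one function, while f is smooth to every order throughout.\<close>

lemma smooth_on_inverse:
  fixes f :: "real^'n \<Rightarrow> real"
  assumes W: "open W" and f: "smooth_on W f" and nz: "\<And>u. u \<in> W \<Longrightarrow> f u \<noteq> 0"
  shows "smooth_on W (\<lambda>u. inverse (f u))"
proof -
  have "Ck_on k W (\<lambda>u. inverse (f u))" for k
  proof (induction k)
    case 0
    have "continuous_on W f" using f unfolding smooth_on_def by (metis Ck_on.simps(1))
    then show ?case using nz by (auto intro: continuous_on_inverse)
  next
    case (Suc k)
    show ?case
    proof (rule Ck_on_SucI[OF W])
      show "((\<lambda>u. inverse (f u)) has_derivative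
          (\<lambda>v. - (inverse (f u) * deriv_at f u v * inverse (f u)))) (at u)" if "u \<in> W" for u
        using Deriv.has_derivative_inverse[OF nz[OF that] smooth_on_has_derivative[OF W f that]] .
      fix v
      have "Ck_on k W (\<lambda>u. deriv_at f u v)" using smooth_on_deriv[OF f] by (simp add: smooth_on_def)
      then have "Ck_on k W (\<lambda>u. inverse (f u) * deriv_at f u v * inverse (f u))"
        by (intro Ck_on_bilinear[OF W bounded_bilinear_mult] Suc)
      from Ck_on_bilinear[OF W bounded_bilinear_mult Ck_on_const[OF W, of k "-1"] this]
      show "Ck_on k W (\<lambda>u. - (inverse (f u) * deriv_at f u v * inverse (f u)))" by simp
    qed
  qed
  then show ?thesis by (simp add: smooth_on_def)
qed

section \<open>Vector and matrix valued maps\<close>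

lemma vec_eq_sum_axis: "x = (\<Sum>i\<in>UNIV. axis i (x $ i))"
  by (simp add: vec_eq_iff axis_def if_distrib sum.delta cong: if_cong)

lemma bounded_linear_axis: "bounded_linear (axis i :: 'a::euclidean_space \<Rightarrow> 'a^'k)"
  unfolding linear_conv_bounded_linear[symmetric]
  by (rule linearI) (auto simp: vec_eq_iff axis_def)

lemma smooth_on_vec_nth: "open W \<Longrightarrow> smooth_on W f \<Longrightarrow> smooth_on W (\<lambda>u. f u $ i)"
  by (rule smooth_on_linear[OF _ bounded_linear_vec_nth])

lemma smooth_on_vecI:
  fixes f :: "real^'n \<Rightarrow> 'a::euclidean_space^'k"
  assumes W: "open W" and f: "\<And>i. smooth_on W (\<lambda>u. f u $ i)"
  shows "smooth_on W f"
proof -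
  have "smooth_on W (\<lambda>u. \<Sum>i\<in>UNIV. axis i (f u $ i))"
    by (intro smooth_on_sum[OF W] smooth_on_linear[OF W bounded_linear_axis f])
  then show ?thesis by (simp add: vec_eq_sum_axis[symmetric])
qed

lemma smooth_on_det:
  fixes A :: "real^'n \<Rightarrow> real^'k^'k"
  assumes W: "open W" and A: "smooth_on W A"
  shows "smooth_on W (\<lambda>u. det (A u))"
  unfolding det_def
  by (intro smooth_on_sum[OF W] smooth_on_mult[OF W] smooth_on_const[OF W] smooth_on_prod[OF W]
      smooth_on_vec_nth[OF W] A)

lemma matrix_inv_left_right:
  fixes A :: "real^'k^'k"
  assumes "invertible A"
  shows "A ** matrix_inv A = mat 1" "matrix_inv A ** A = mat 1"
  using someI_ex[OF assms[unfolded invertible_def]] by (auto simp: matrix_inv_def)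

lemma matrix_inv_unique:
  fixes A B :: "real^'k^'k"
  assumes "A ** B = mat 1"
  shows "matrix_inv A = B"
proof -
  have "invertible A" using assms invertible_right_inverse by blast
  then show ?thesis
    by (metis assms matrix_inv_left_right(2) matrix_mul_assoc matrix_mul_lid matrix_mul_rid)
qed

text \<open>Cramer's rule for column \<open>j\<close> of the inverse reduces smoothness of the
  inverse matrix to that of determinants and reciprocals.\<close>

lemma matrix_inv_nth_cramer:
  fixes A :: "real^'k^'k"
  assumes "invertible A"
  shows "matrix_inv A $ i $ j
    = det (\<chi> a b. if b = i then (axis j 1 :: real^'k) $ a else A $ a $ b) * inverse (det A)"
proof -
  have "A *v (matrix_inv A *v axis j 1) = axis j 1"
    by (simp add: matrix_vector_mul_assoc matrix_inv_left_right[OF assms])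
  then have "(matrix_inv A *v axis j 1) $ i
      = det (\<chi> a b. if b = i then (axis j 1 :: real^'k) $ a else A $ a $ b) / det A"
    using assms cramer[of A "matrix_inv A *v axis j 1" "axis j 1"]
    by (simp add: invertible_det_nz vec_eq_iff[of "matrix_inv A *v axis j 1"])
  then show ?thesis
    by (simp add: matrix_vector_mult_basis column_def divide_inverse)
qed

lemma smooth_on_matrix_inv:
  fixes A :: "real^'n \<Rightarrow> real^'k^'k"
  assumes W: "open W" and A: "smooth_on W A" and inv: "\<And>u. u \<in> W \<Longrightarrow> invertible (A u)"
  shows "smooth_on W (\<lambda>u. matrix_inv (A u))"
proof (rule smooth_on_vecI[OF W], rule smooth_on_vecI[OF W])
  fix i j
  let ?B = "\<lambda>u. \<chi> a b. if b = i then (axis j 1 :: real^'k) $ a else A u $ a $ b"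
  have "smooth_on W (\<lambda>u. if b = i then c else A u $ a $ b)" for a b c
    by (cases "b = i") (auto intro!: smooth_on_const[OF W] smooth_on_vec_nth[OF W] A)
  then have B: "smooth_on W ?B"
    by (intro smooth_on_vecI[OF W]) simp
  have "smooth_on W (\<lambda>u. det (?B u) * inverse (det (A u)))"
    using inv by (intro smooth_on_mult[OF W] smooth_on_inverse[OF W] smooth_on_det[OF W] A B)
      (simp add: invertible_det_nz)
  then show "smooth_on W (\<lambda>u. matrix_inv (A u) $ i $ j)"
    using smooth_on_cong[OF W matrix_inv_nth_cramer[OF inv]] by fastforce
qed

lemma bounded_bilinear_matrix_vector_mult: "bounded_bilinear ((*v) :: real^'a^'b \<Rightarrow> _)"
  unfolding bilinear_conv_bounded_bilinear[symmetric] bilinear_def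
  by (auto intro!: linearI simp: algebra_simps scaleR_matrix_vector_assoc)

lemma bounded_bilinear_matrix_mult: "bounded_bilinear ((**) :: real^'a^'b \<Rightarrow> real^'c^'a \<Rightarrow> _)"
  unfolding bilinear_conv_bounded_bilinear[symmetric] bilinear_def
  by (auto intro!: linearI simp: matrix_add_ldistrib matrix_matrix_mult_def vec_eq_iff sum.distrib
      sum_distrib_left distrib_left distrib_right mult_ac)

lemmas smooth_on_matrix_vector_mult = smooth_on_bilinear[OF _ bounded_bilinear_matrix_vector_mult]
lemmas smooth_on_matrix_mult = smooth_on_bilinear[OF _ bounded_bilinear_matrix_mult]

lemma smooth_on_transpose:
  fixes A :: "real^'n \<Rightarrow> real^'a^'b"
  shows "open W \<Longrightarrow> smooth_on W A \<Longrightarrow> smooth_on W (\<lambda>u. transpose (A u))"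
  by (rule smooth_on_linear[of W transpose])
    (auto simp: linear_conv_bounded_linear[symmetric] vec_eq_iff transpose_def intro!: linearI)

section \<open>Symmetry of second derivatives\<close>

text \<open>The mean value theorem is used twice: along x for the difference of f between two
  opposite edges of the parallelogram, then along y for the derivative in direction x.\<close>

lemma second_difference_mvt:
  fixes f :: "real^'n \<Rightarrow> real"
  assumes f: "smooth_on W f" and W: "open W" and t: "0 < t"
    and in_W: "\<And>a b. \<lbrakk>0 \<le> a; a \<le> t; 0 \<le> b; b \<le> t\<rbrakk> \<Longrightarrow> u + a *\<^sub>R x + b *\<^sub>R y \<in> W"
  obtains a b where "0 < a" "a < t" "0 < b" "b < t"
    "f (u + t *\<^sub>R x + t *\<^sub>R y) - f (u + t *\<^sub>R x) - f (u + t *\<^sub>R y) + f u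
     = t^2 * deriv_at (\<lambda>w. deriv_at f w x) (u + a *\<^sub>R x + b *\<^sub>R y) y"
proof -
  have aff1: "((\<lambda>s. u + s *\<^sub>R x + b *\<^sub>R y) has_derivative (\<lambda>r. r *\<^sub>R x)) (at s within S)" for b s S
    by (auto intro!: derivative_eq_intros)
  have aff2: "((\<lambda>s. u + a *\<^sub>R x + s *\<^sub>R y) has_derivative (\<lambda>r. r *\<^sub>R y)) (at s within S)" for a s S
    by (auto intro!: derivative_eq_intros)
  let ?p = "\<lambda>s. f (u + s *\<^sub>R x + t *\<^sub>R y) - f (u + s *\<^sub>R x + 0 *\<^sub>R y)"
  have dp: "((\<lambda>s. f (u + s *\<^sub>R x + b *\<^sub>R y)) has_derivative
      (\<lambda>r. deriv_at f (u + s *\<^sub>R x + b *\<^sub>R y) (r *\<^sub>R x))) (at s within {0..t})"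
    if "0 \<le> s" "s \<le> t" "0 \<le> b" "b \<le> t" for s b
    by (rule has_derivative_compose[OF aff1 smooth_on_has_derivative[OF W f in_W[OF that]]])
  obtain a where a: "0 < a" "a < t" "?p t - ?p 0 = deriv_at f (u + a *\<^sub>R x + t *\<^sub>R y) ((t - 0) *\<^sub>R x)
      - deriv_at f (u + a *\<^sub>R x + 0 *\<^sub>R y) ((t - 0) *\<^sub>R x)"
    using mvt_simple[OF t has_derivative_diff[OF dp dp], of t 0] t by auto
  let ?q = "\<lambda>s. deriv_at f (u + a *\<^sub>R x + s *\<^sub>R y) x"
  have dq: "(?q has_derivative
      (\<lambda>r. deriv_at (\<lambda>w. deriv_at f w x) (u + a *\<^sub>R x + s *\<^sub>R y) (r *\<^sub>R y))) (at s within {0..t})"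
    if "0 \<le> s" "s \<le> t" for s
    using has_derivative_compose[OF aff2 smooth_on_has_derivative[OF W smooth_on_deriv[OF f] in_W]]
      that a by simp
  obtain b where b: "0 < b" "b < t" "?q t - ?q 0
      = deriv_at (\<lambda>w. deriv_at f w x) (u + a *\<^sub>R x + b *\<^sub>R y) ((t - 0) *\<^sub>R y)"
    using mvt_simple[OF t dq] by auto
  have lin: "linear (deriv_at f w)" "linear (deriv_at (\<lambda>w. deriv_at f w x) w)" if "w \<in> W" for w
    using that smooth_on_has_derivative[OF W] f smooth_on_deriv[OF f] has_derivative_linear by blast+
  have "?p t - ?p 0 = t * (?q t - ?q 0)"
    using a lin(1)[OF in_W[of a t]] lin(1)[OF in_W[of a 0]] t
    by (simp add: linear_scale right_diff_distrib)
  also have "\<dots> = t^2 * deriv_at (\<lambda>w. deriv_at f w x) (u + a *\<^sub>R x + b *\<^sub>R y) y"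
    using a b lin(2)[OF in_W[of a b]] t by (simp add: linear_scale power2_eq_square)
  finally have "f (u + t *\<^sub>R x + t *\<^sub>R y) - f (u + t *\<^sub>R x) - f (u + t *\<^sub>R y) + f u
      = t^2 * deriv_at (\<lambda>w. deriv_at f w x) (u + a *\<^sub>R x + b *\<^sub>R y) y" by simp
  with a(1,2) b(1,2) show ?thesis by (rule that)
qed

text \<open>The second difference over a parallelogram is symmetric in x and y, so the two mixed
  derivatives take equal values at suitable points as close to u as desired; continuity carries the
  equality to u.\<close>

lemma symmetric_second_deriv_real:
  fixes f :: "real^'n \<Rightarrow> real"
  assumes f: "smooth_on W f" and W: "open W" and u: "u \<in> W"
  shows "deriv_at (\<lambda>w. deriv_at f w x) u y = deriv_at (\<lambda>w. deriv_at f w y) u x"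
proof (rule ccontr)
  define P where "P = (\<lambda>w. deriv_at (\<lambda>w. deriv_at f w x) w y)"
  define Q where "Q = (\<lambda>w. deriv_at (\<lambda>w. deriv_at f w y) w x)"
  assume "\<not> ?thesis"
  then have ne: "dist (P u) (Q u) > 0" by (simp add: P_def Q_def)
  have cont: "isCont P u" "isCont Q u"
    unfolding P_def Q_def
    by (intro differentiable_imp_continuous_within smooth_on_differentiable[OF W _ u] smooth_on_deriv f)+
  obtain d1 where d1: "d1 > 0" "\<And>w. dist w u < d1 \<Longrightarrow> dist (P w) (P u) < dist (P u) (Q u) / 2"
    using cont(1) ne unfolding continuous_at_eps_delta by (metis half_gt_zero)
  obtain d2 where d2: "d2 > 0" "\<And>w. dist w u < d2 \<Longrightarrow> dist (Q w) (Q u) < dist (P u) (Q u) / 2"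
    using cont(2) ne unfolding continuous_at_eps_delta by (metis half_gt_zero)
  obtain d3 where d3: "d3 > 0" "ball u d3 \<subseteq> W" using W u open_contains_ball by blast
  define d where "d = min d1 (min d2 d3)"
  \<comment> \<open>Chosen so that the parallelogram with sides t x and t y stays within distance d
    of u; the summand 1 covers x = y = 0.\<close>
  define t where "t = d / (2 * (norm x + norm y + 1))"
  have pos: "norm x + norm y + 1 > 0" by (simp add: add_nonneg_pos)
  have d: "d > 0" using d1 d2 d3 by (simp add: d_def)
  have t: "t > 0" using d pos by (simp add: t_def)
  have tn: "t * (norm x + norm y) < d"
  proof -
    have "t * (norm x + norm y + 1) = d / 2"
      using pos by (simp add: t_def field_simps)
    then show ?thesis using t d by (simp add: algebra_simps)
  qed
  have near: "dist (u + a *\<^sub>R x + b *\<^sub>R y) u < d" if "0 \<le> a" "a \<le> t" "0 \<le> b" "b \<le> t" for a b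
  proof -
    have "norm (a *\<^sub>R x + b *\<^sub>R y) \<le> a * norm x + b * norm y"
      using norm_triangle_ineq[of "a *\<^sub>R x" "b *\<^sub>R y"] that by simp
    also have "\<dots> \<le> t * norm x + t * norm y"
      using that by (intro add_mono mult_right_mono) auto
    finally show ?thesis using tn by (simp add: dist_norm algebra_simps)
  qed
  then have in_W: "u + a *\<^sub>R x + b *\<^sub>R y \<in> W" if "0 \<le> a" "a \<le> t" "0 \<le> b" "b \<le> t" for a b
    using d3 that unfolding d_def by (force simp: dist_commute)
  obtain a b where ab: "0 < a" "a < t" "0 < b" "b < t"
    "f (u + t *\<^sub>R x + t *\<^sub>R y) - f (u + t *\<^sub>R x) - f (u + t *\<^sub>R y) + f u = t^2 * P (u + a *\<^sub>R x + b *\<^sub>R y)"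
    unfolding P_def by (rule second_difference_mvt[OF f W t in_W])
  have in_W': "u + a *\<^sub>R y + b *\<^sub>R x \<in> W" if "0 \<le> a" "a \<le> t" "0 \<le> b" "b \<le> t" for a b
    using in_W[of b a] that by (simp add: algebra_simps)
  obtain a' b' where ab': "0 < a'" "a' < t" "0 < b'" "b' < t"
    "f (u + t *\<^sub>R y + t *\<^sub>R x) - f (u + t *\<^sub>R y) - f (u + t *\<^sub>R x) + f u = t^2 * Q (u + a' *\<^sub>R y + b' *\<^sub>R x)"
    unfolding Q_def by (rule second_difference_mvt[OF f W t in_W'])
  have "P (u + a *\<^sub>R x + b *\<^sub>R y) = Q (u + b' *\<^sub>R x + a' *\<^sub>R y)"
  proof -
    have "t^2 * P (u + a *\<^sub>R x + b *\<^sub>R y) = t^2 * Q (u + b' *\<^sub>R x + a' *\<^sub>R y)"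
      unfolding ab(5)[symmetric] using ab'(5) by (simp add: algebra_simps)
    then show ?thesis using t by simp
  qed
  moreover have "dist (P (u + a *\<^sub>R x + b *\<^sub>R y)) (P u) < dist (P u) (Q u) / 2"
    using ab near[of a b] by (intro d1) (auto simp: d_def)
  moreover have "dist (Q (u + b' *\<^sub>R x + a' *\<^sub>R y)) (Q u) < dist (P u) (Q u) / 2"
    using ab' near[of b' a'] by (intro d2) (auto simp: d_def)
  ultimately show False
    using dist_triangle_half_r[of "P (u + a *\<^sub>R x + b *\<^sub>R y)" "P u" "dist (P u) (Q u)" "Q u"] by simp
qed

lemma deriv_at_linear:
  assumes "bounded_linear L" "f differentiable (at u)"
  shows "deriv_at (\<lambda>w. L (f w)) u v = L (deriv_at f u v)"
proof -
  have "((\<lambda>w. L (f w)) has_derivative (\<lambda>v. L (deriv_at f u v))) (at u)"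
    using bounded_linear.has_derivative[OF assms(1)] assms(2) frechet_derivative_works by blast
  then show ?thesis by (simp add: frechet_derivative_at[symmetric])
qed

lemma symmetric_second_deriv:
  fixes f :: "real^'n \<Rightarrow> 'a::euclidean_space"
  assumes f: "smooth_on W f" and W: "open W" and u: "u \<in> W"
  shows "deriv_at (\<lambda>w. deriv_at f w x) u y = deriv_at (\<lambda>w. deriv_at f w y) u x"
proof (rule euclidean_eqI)
  fix b :: 'a
  let ?L = "\<lambda>a::'a. a \<bullet> b"
  have L: "bounded_linear ?L" by (rule bounded_linear_inner_left)
  note df = deriv_at_linear[OF L smooth_on_differentiable[OF W]]
  have "deriv_at (\<lambda>w. deriv_at f w x) u y \<bullet> b = deriv_at (\<lambda>w. deriv_at (\<lambda>w. f w \<bullet> b) w x) u y" for x y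
  proof -
    have "deriv_at (\<lambda>w. deriv_at f w x \<bullet> b) u = deriv_at (\<lambda>w. deriv_at (\<lambda>w. f w \<bullet> b) w x) u"
      using df[OF f] smooth_on_differentiable[OF W smooth_on_linear[OF W L smooth_on_deriv[OF f]] u]
      by (intro frechet_derivative_transform_within_open[OF _ W u]) auto
    then show ?thesis using df[OF smooth_on_deriv[OF f] u, of x y] by simp
  qed
  then show "deriv_at (\<lambda>w. deriv_at f w x) u y \<bullet> b = deriv_at (\<lambda>w. deriv_at f w y) u x \<bullet> b"
    using symmetric_second_deriv_real[OF smooth_on_linear[OF W L f] W u] by simp
qed

section \<open>Alternating forms\<close>

lemma alt_form_length: "alt_form r f \<Longrightarrow> length vs \<noteq> r \<Longrightarrow> f vs = 0"
  by (simp add: alt_form_def)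

lemma alt_form_linear:
  assumes f: "alt_form r f" and len: "length A + length B + 1 = r"
  shows "linear (\<lambda>v. f (A @ v # B))"
proof -
  have "linear (\<lambda>v. f ((A @ 0 # B)[length A := v]))"
    using f len unfolding alt_form_def by (metis (no_types) add.assoc add.commute less_add_Suc1
        length_append length_Cons plus_1_eq_Suc)
  then show ?thesis by simp
qed

lemma alt_form_repeat:
  assumes f: "alt_form r f"
  shows "f (A @ x # B @ x # C) = 0"
proof (cases "length (A @ x # B @ x # C) = r")
  case True
  let ?vs = "A @ x # B @ x # C"
  have "?vs ! length A = x" "?vs ! Suc (length A + length B) = x"
    by (auto simp: nth_append)
  moreover have "length A < Suc (length A + length B)" "Suc (length A + length B) < r"
    using True by auto
  ultimately show ?thesis using f True unfolding alt_form_def by metis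
qed (simp add: alt_form_length[OF f])

text \<open>Polarisation: alternation is defined by vanishing on repeated vectors, and expanding at
  a repeated x + y gives the sign rule.\<close>

lemma alt_form_swap:
  assumes f: "alt_form r f"
  shows "f (A @ x # y # B) = - f (A @ y # x # B)"
proof (cases "length (A @ x # y # B) = r")
  case True
  have lin1: "linear (\<lambda>v. f (A @ v # w # B))" for w
    using True by (intro alt_form_linear[OF f]) simp
  have lin2: "linear (\<lambda>w. f (A @ v # w # B))" for v
    using alt_form_linear[OF f, of "A @ [v]" B] True by simp
  have "0 = f (A @ (x + y) # (x + y) # B)"
    using alt_form_repeat[OF f, of A "x + y" "[]" B] by simp
  also have "\<dots> = f (A @ x # y # B) + f (A @ y # x # B)"
    using alt_form_repeat[OF f, of A x "[]" B] alt_form_repeat[OF f, of A y "[]" B]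
    by (simp add: linear_add[OF lin1] linear_add[OF lin2])
  finally show ?thesis by (simp add: eq_neg_iff_add_eq_0)
qed (simp add: alt_form_length[OF f])

lemma alt_form_cycle:
  assumes f: "alt_form r f"
  shows "f (A @ B @ v # C) = (-1) ^ length B *\<^sub>R f (A @ v # B @ C)"
proof (induction B arbitrary: A)
  case (Cons b B)
  have "f (A @ (b # B) @ v # C) = (-1) ^ length B *\<^sub>R f ((A @ [b]) @ v # B @ C)"
    using Cons.IH[of "A @ [b]"] by simp
  also have "f ((A @ [b]) @ v # B @ C) = - f (A @ v # b # B @ C)"
    using alt_form_swap[OF f, of A b v] by simp
  finally show ?case by simp
qed simp

text \<open>Only vanishing is transported along a permutation, so no permutation sign has to be
  tracked. The prefix \<open>A\<close> holds the arguments already in place.\<close>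

lemma alt_form_perm_eq_0:
  assumes f: "alt_form r f"
  shows "f (A @ xs) = 0 \<Longrightarrow> mset xs = mset ys \<Longrightarrow> f (A @ ys) = 0"
proof (induction ys arbitrary: A xs)
  case (Cons y ys)
  then have "y \<in> set xs" by (metis list.set_intros(1) set_mset_mset)
  then obtain B C where xs: "xs = B @ y # C" by (meson split_list)
  have "f ((A @ [y]) @ (B @ C)) = 0"
    using Cons.prems(1) alt_form_cycle[OF f, of A B y C] by (simp add: xs)
  then have "f ((A @ [y]) @ ys) = 0"
    by (rule Cons.IH) (use Cons.prems(2) in \<open>simp add: xs\<close>)
  then show ?case by simp
qed simp

definition spanning :: "('n::finite \<Rightarrow> real^'n) \<Rightarrow> bool" where
  "spanning b \<longleftrightarrow> (\<forall>v. \<exists>c. v = (\<Sum>i\<in>UNIV. c i *\<^sub>R b i))"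

lemma spanning_axis: "spanning (\<lambda>i. axis i 1)"
proof -
  have "v = (\<Sum>i\<in>UNIV. (v $ i) *\<^sub>R axis i 1)" for v :: "real^'n"
    by (simp add: vec_eq_iff axis_def if_distrib sum.delta cong: if_cong)
  then show ?thesis unfolding spanning_def by blast
qed

text \<open>Multilinearity reduces the claim to lists of spanning vectors, alternation to distinct
  ones. For \<open>r\<close> above the number of indices there are no such lists, which is how forms
  of too high degree vanish.\<close>

lemma alt_form_eq_0I:
  assumes f: "alt_form r f" and b: "spanning b"
    and zero: "\<And>is. length is = r \<Longrightarrow> distinct is \<Longrightarrow> f (map b is) = 0"
  shows "f vs = 0"
proof (cases "length vs = r")
  case True
  have z: "f (map b is) = 0" if "length is = r" for "is"
  proof (cases "distinct is")
    case False
    then obtain A B C i where "is = A @ [i] @ B @ [i] @ C" using not_distinct_decomp by blast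
    then show ?thesis using alt_form_repeat[OF f, of "map b A" "b i" "map b B" "map b C"] by simp
  qed (use zero that in auto)
  \<comment> \<open>\<open>is\<close> records the arguments already replaced by spanning
    vectors.\<close>
  have "length is + length vs = r \<Longrightarrow> f (map b is @ vs) = 0" for "is"
  proof (induction vs arbitrary: "is")
    case Nil
    then show ?case using z by simp
  next
    case (Cons v vs)
    obtain c where v: "v = (\<Sum>i\<in>UNIV. c i *\<^sub>R b i)" using b unfolding spanning_def by blast
    have lin: "linear (\<lambda>v. f (map b is @ v # vs))"
      using Cons.prems by (intro alt_form_linear[OF f]) simp
    have "f (map b is @ b i # vs) = 0" for i
      using Cons.IH[of "is @ [i]"] Cons.prems by simp
    then show ?case by (simp add: v linear_sum[OF lin] linear_scale[OF lin])
  qed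
  from this[of "[]"] show ?thesis using True by simp
qed (simp add: alt_form_length[OF f])

section \<open>Operations on alternating forms\<close>

lemma alt_form_zero: "alt_form r (\<lambda>vs. 0)"
  by (simp add: alt_form_def linear_zero)

lemma alt_form_scaleR:
  assumes "alt_form r f"
  shows "alt_form r (\<lambda>vs. c *\<^sub>R f vs)"
  using assms unfolding alt_form_def by (auto intro: linear_compose_scale_right)

lemma linear_scaleR_leftI: "linear f \<Longrightarrow> linear (\<lambda>v. f v *\<^sub>R x)"
  by (auto simp: linear_iff scaleR_add_left)

lemma alt_form_scaleR_left:
  assumes "alt_form r f"
  shows "alt_form r (\<lambda>vs. f vs *\<^sub>R x)"
  using assms unfolding alt_form_def by (auto intro: linear_scaleR_leftI)

lemma alt_form_add:
  assumes "alt_form r f" "alt_form r g"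
  shows "alt_form r (\<lambda>vs. f vs + g vs)"
  using assms unfolding alt_form_def by (auto intro: linear_compose_add)

lemma alt_form_diff:
  assumes "alt_form r f" "alt_form r g"
  shows "alt_form r (\<lambda>vs. f vs - g vs)"
  using assms unfolding alt_form_def by (auto intro: linear_compose_sub)

lemma alt_form_sum:
  assumes "\<And>i. i \<in> I \<Longrightarrow> alt_form r (f i)"
  shows "alt_form r (\<lambda>vs. \<Sum>i\<in>I. f i vs)"
  using assms by (induction I rule: infinite_finite_induct) (auto simp: alt_form_zero alt_form_add)

lemma linear_PairI: "linear f \<Longrightarrow> linear g \<Longrightarrow> linear (\<lambda>v. (f v, g v))"
  by (auto simp: linear_iff)

lemma alt_form_Pair:
  assumes "alt_form r f" "alt_form r g"
  shows "alt_form r (\<lambda>vs. (f vs, g vs))"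
  using assms unfolding alt_form_def by (auto intro: linear_PairI simp: zero_prod_def)

lemma alt_form_append:
  assumes f: "alt_form (r + length ws) f"
  shows "alt_form r (\<lambda>vs. f (vs @ ws))"
  unfolding alt_form_def
proof (intro conjI allI impI)
  fix vs :: "(real^'a) list" and k
  assume "length vs = r \<and> k < r"
  then show "linear (\<lambda>v. f (vs[k := v] @ ws))"
    using f[unfolded alt_form_def, THEN conjunct2, THEN conjunct1, rule_format, of "vs @ ws" k]
    by (simp add: list_update_append)
next
  fix vs :: "(real^'a) list" and j k
  assume *: "length vs = r \<and> j < k \<and> k < r \<and> vs ! j = vs ! k"
  then have "(vs @ ws) ! j = (vs @ ws) ! k" by (simp add: nth_append)
  then show "f (vs @ ws) = 0"
    using f[unfolded alt_form_def, THEN conjunct2, THEN conjunct2, rule_format, of "vs @ ws" j k] *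
    by simp
qed (use f in \<open>simp add: alt_form_length\<close>)

lemma alt_form_one_form:
  assumes "linear (A u)"
  shows "alt_form 1 (one_form A u)"
proof -
  have "linear (\<lambda>v. one_form A u (vs[k := v]))" if "length vs = 1" "k < 1" for vs k
    using that assms by (cases vs) (auto simp: one_form_def)
  then show ?thesis by (auto simp: alt_form_def one_form_def)
qed

lemma length_omit: "k < length vs \<Longrightarrow> length (omit k vs) = length vs - 1"
  by (simp add: omit_def)

lemma nth_omit: "k < length vs \<Longrightarrow> i < length vs - 1 \<Longrightarrow> omit k vs ! i = (if i < k then vs ! i else vs ! Suc i)"
  by (auto simp: omit_def nth_append)

lemma omit_update:
  assumes "k < length vs" "j < length vs"
  shows "omit k (vs[j := v]) =
    (if j = k then omit k vs else if j < k then (omit k vs)[j := v] else (omit k vs)[j - 1 := v])"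
  using assms by (intro nth_equalityI) (auto simp: length_omit nth_omit nth_list_update)

lemma omit_append: "k < length vs \<Longrightarrow> omit k (vs @ ws) = omit k vs @ ws"
  by (simp add: omit_def)

lemma omit_length_append: "omit (length vs) (vs @ x # ws) = vs @ ws"
  by (simp add: omit_def)

text \<open>Both the exterior derivative and the product with a 1-form have this shape.\<close>

lemma alt_form_antisymmetrization:
  assumes alt: "\<And>v. alt_form r (M v)" and lin: "\<And>us. linear (\<lambda>v. M v us)"
  shows "alt_form (Suc r) (\<lambda>vs. \<Sum>k<length vs. (-1) ^ k *\<^sub>R M (vs ! k) (omit k vs))"
  unfolding alt_form_def
proof (intro conjI allI impI)
  fix vs :: "(real^'a) list"
  assume "length vs \<noteq> Suc r"
  then show "(\<Sum>k<length vs. (-1) ^ k *\<^sub>R M (vs ! k) (omit k vs)) = 0"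
    by (intro sum.neutral) (auto simp: alt_form_length[OF alt] length_omit)
next
  fix vs :: "(real^'a) list" and j
  assume j: "length vs = Suc r \<and> j < Suc r"
  have "linear (\<lambda>v. M (vs[j := v] ! k) (omit k (vs[j := v])))" if k: "k < length vs" for k
  proof (cases "j = k")
    case True
    then show ?thesis using k lin by (simp add: omit_update)
  next
    case False
    have "linear (\<lambda>v. M (vs ! k) ((omit k vs)[i := v]))" if "i < r" for i
      using alt[unfolded alt_form_def] that j k by (simp add: length_omit)
    then show ?thesis using False j k by (cases "j < k") (auto simp: omit_update)
  qed
  then show "linear (\<lambda>v. \<Sum>k<length (vs[j := v]). (-1) ^ k *\<^sub>R M (vs[j := v] ! k) (omit k (vs[j := v])))"
    by (auto intro!: linear_compose_sum linear_compose_scale_right)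
next
  fix vs :: "(real^'a) list" and i j
  assume ij: "length vs = Suc r \<and> i < j \<and> j < Suc r \<and> vs ! i = vs ! j"
  define A where "A = take i vs"
  define B where "B = take (j - Suc i) (drop (Suc i) vs)"
  define C where "C = drop (Suc j) vs"
  define v where "v = vs ! i"
  have vs: "vs = A @ v # B @ v # C"
  proof -
    have "vs = A @ v # drop (Suc i) vs" unfolding A_def v_def using ij by (intro id_take_nth_drop) simp
    moreover have "drop (Suc i) vs = B @ v # C"
    proof -
      have "j - Suc i < length (drop (Suc i) vs)" using ij by auto
      from id_take_nth_drop[OF this] show ?thesis using ij by (simp add: B_def C_def v_def)
    qed
    ultimately show ?thesis by simp
  qed
  have lenA: "length A = i" and lenB: "j = Suc (i + length B)" using ij by (auto simp: A_def B_def)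
  \<comment> \<open>Removing any other position keeps both copies of the repeated vector, at the
    shifted positions \<open>i'\<close> and \<open>j'\<close>.\<close>
  have "(-1) ^ k *\<^sub>R M (vs ! k) (omit k vs) = 0" if k: "k < length vs" "k \<noteq> i" "k \<noteq> j" for k
  proof -
    define i' where "i' = (if i < k then i else i - 1)"
    define j' where "j' = (if j < k then j else j - 1)"
    have "i' < j'" "j' < r" "omit k vs ! i' = omit k vs ! j'"
      using ij k by (auto simp: i'_def j'_def nth_omit)
    then have "M (vs ! k) (omit k vs) = 0"
      using alt[of "vs ! k", unfolded alt_form_def] ij k length_omit[of k vs] by (metis diff_Suc_1)
    then show ?thesis by simp
  qed
  then have "(\<Sum>k<length vs. (-1) ^ k *\<^sub>R M (vs ! k) (omit k vs))
      = (\<Sum>k\<in>{i, j}. (-1) ^ k *\<^sub>R M (vs ! k) (omit k vs))"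
    using ij by (intro sum.mono_neutral_right) auto
  also have "\<dots> = (-1) ^ i *\<^sub>R M v (A @ B @ v # C) + (-1) ^ j *\<^sub>R M v (A @ v # B @ C)"
  proof -
    have "omit i vs = A @ B @ v # C"
      using omit_length_append[of A v "B @ v # C"] lenA vs by simp
    moreover have "omit j vs = A @ v # B @ C"
      using omit_length_append[of "A @ v # B" v C] lenA lenB vs by simp
    ultimately show ?thesis using ij by (simp add: v_def)
  qed
  \<comment> \<open>Moving \<open>v\<close> across \<open>B\<close> costs one sign for each entry of
    \<open>B\<close>, while the positions i and j differ by one more than that, so the two terms
    cancel.\<close>
  also have "\<dots> = 0"
    using alt_form_cycle[OF alt, of v A B v C] lenB by (simp add: power_add)
  finally show "(\<Sum>k<length vs. (-1) ^ k *\<^sub>R M (vs ! k) (omit k vs)) = 0" .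
qed

section \<open>The Hodge operator\<close>

text \<open>\<open>volume\<close> reads list entries by position and is meaningful only on lists of
  length n; cutting it off makes it an alternating form and absorbs the length test of
  \<open>hodge\<close>.\<close>

definition volume_form :: "real^'n^'n \<Rightarrow> ('n::finite, real) form" where
  "volume_form g vs = (if length vs = CARD('n) then volume g vs else 0)"

lemma alt_form_volume_form: "alt_form CARD('n) (volume_form (g :: real^'n^'n::finite))"
proof -
  let ?e = "to_nat_on (UNIV :: 'n set)"
  have e: "bij_betw ?e UNIV {..<CARD('n)}" by (simp add: to_nat_on_finite)
  have e_inv: "\<exists>i. ?e i = k" if "k < CARD('n)" for k
    using bij_betw_imp_surj_on[OF e] that by (metis imageE lessThan_iff)
  have e_inj: "?e i = ?e j \<longleftrightarrow> i = j" for i j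
    using e by (metis UNIV_I bij_betw_imp_inj_on inj_on_def)
  have e_less: "?e i < CARD('n)" for i using bij_betwE[OF e] by simp
  have "linear (\<lambda>v. volume_form g (vs[k := v]))" if len: "length vs = CARD('n)" and k: "k < CARD('n)" for vs k
  proof -
    obtain i where i: "?e i = k" using e_inv[OF k] by blast
    have "(\<chi> j. vs[k := v] ! ?e j) = (\<chi> j. if j = i then v else vs ! ?e j)" for v
      using len k by (auto simp: vec_eq_iff nth_list_update e_less i[symmetric] e_inj)
    then have vol: "volume_form g (vs[k := v]) = sqrt \<bar>det g\<bar> * det (\<chi> j. if j = i then v else vs ! ?e j)" for v
      using len by (simp add: volume_form_def volume_def)
    show ?thesis
      unfolding vol
      using det_row_add[of i "\<lambda>_. x" "\<lambda>_. y" "\<lambda>j. vs ! ?e j" for x y]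
        det_row_mul[of i c "\<lambda>_. x" "\<lambda>j. vs ! ?e j" for c x, unfolded scalar_mult_eq_scaleR]
      by (intro linearI) (simp_all add: algebra_simps)
  qed
  moreover have "volume_form g vs = 0"
    if len: "length vs = CARD('n)" and jk: "j < k" "k < CARD('n)" "vs ! j = vs ! k" for vs j k
  proof -
    obtain i l where il: "?e i = j" "?e l = k" using e_inv jk by (metis less_trans)
    then have "det (\<chi> i. vs ! ?e i) = 0"
      using jk by (intro det_identical_rows[of i l]) (auto simp: row_def)
    then show ?thesis by (simp add: volume_form_def volume_def)
  qed
  ultimately show ?thesis by (auto simp: alt_form_def volume_form_def)
qed

lemma mset_eq_if_distinct_card:
  fixes xs ys :: "'n::finite list"
  assumes "distinct xs" "length xs = CARD('n)" "distinct ys" "length ys = CARD('n)"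
  shows "mset xs = mset ys"
proof -
  have "set xs = UNIV" "set ys = UNIV"
    using assms by (metis card_subset_eq distinct_card finite_class.finite_UNIV top_greatest)+
  then show ?thesis using assms set_eq_iff_mset_eq_distinct by metis
qed

text \<open>If the value were zero, rearrangement and multilinearity would make the volume form
  vanish identically, yet on the standard basis it is sqrt |det g|.\<close>

lemma volume_form_spanning_nonzero:
  fixes g :: "real^'n^'n::finite"
  assumes g: "invertible g" and b: "spanning b" and js: "distinct js" "length js = CARD('n)"
  shows "volume_form g (map b js) \<noteq> 0"
proof
  assume 0: "volume_form g (map b js) = 0"
  note V = alt_form_volume_form[of g]
  have "volume_form g (map b is) = 0" if "length is = CARD('n)" "distinct is" for "is"
    using alt_form_perm_eq_0[OF V, of "[]" "map b js" "map b is"] 0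
      mset_eq_if_distinct_card[OF js that(2,1)] by simp
  from alt_form_eq_0I[OF V b this] have zero: "volume_form g vs = 0" for vs by simp
  let ?e = "to_nat_on (UNIV :: 'n set)"
  have e: "bij_betw ?e UNIV {..<CARD('n)}" by (simp add: to_nat_on_finite)
  \<comment> \<open>The standard basis in the order of the enumeration used by
    \<open>volume\<close>, so that the matrix becomes the identity.\<close>
  define vs :: "(real^'n) list" where "vs = map (\<lambda>k. axis (inv_into UNIV ?e k) 1) [0..<CARD('n)]"
  have "(\<chi> i. vs ! ?e i) = mat 1"
  proof -
    have "vs ! ?e i = axis i 1" for i
      using bij_betwE[OF e] bij_betw_imp_inj_on[OF e] by (simp add: vs_def inv_into_f_f)
    then show ?thesis by (simp add: vec_eq_iff mat_def axis_def)
  qed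
  then have "volume_form g vs = sqrt \<bar>det g\<bar>"
    by (simp add: volume_form_def volume_def vs_def)
  then show False using zero[of vs] g by (simp add: invertible_det_nz)
qed

lemma hodge_eq_volume_form:
  fixes g :: "real^'n^'n::finite"
  shows "hodge g r f vs = (1 / fact r) *\<^sub>R (\<Sum>is | length is = r.
    volume_form g (vs @ rev (map (\<lambda>i. matrix_inv g *v axis i 1) is)) *\<^sub>R f (map (\<lambda>i. axis i 1) is))"
  by (auto simp: hodge_def volume_form_def intro!: sum.neutral sum.cong)

lemma alt_form_hodge:
  fixes g :: "real^'n^'n::finite" and f :: "('n, 'g::real_vector) form"
  assumes "r + s = CARD('n)"
  shows "alt_form r (hodge g s f)"
proof -
  have "alt_form r (\<lambda>vs. volume_form g (vs @ rev (map (\<lambda>i. matrix_inv g *v axis i 1) is)))"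
    if "length is = s" for "is"
    using alt_form_volume_form[of g] assms that by (intro alt_form_append) simp
  then have "alt_form r (\<lambda>vs. (1 / fact s) *\<^sub>R (\<Sum>is | length is = s.
      volume_form g (vs @ rev (map (\<lambda>i. matrix_inv g *v axis i 1) is)) *\<^sub>R f (map (\<lambda>i. axis i 1) is)))"
    by (intro alt_form_scaleR alt_form_sum alt_form_scaleR_left) auto
  then show ?thesis by (simp add: hodge_eq_volume_form[abs_def])
qed

section \<open>The Hodge operator on 1-forms and 2-forms\<close>

lemma hodge_one:
  fixes g :: "real^'n^'n::finite"
  shows "hodge g 1 f vs
    = (\<Sum>i\<in>UNIV. volume_form g (vs @ [matrix_inv g *v axis i 1]) *\<^sub>R f [axis i 1])"
proof -
  have "{is :: 'n list. length is = 1} = (\<lambda>i. [i]) ` UNIV"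
    by (auto simp: length_Suc_conv)
  then show ?thesis by (simp add: hodge_eq_volume_form sum.reindex inj_on_def)
qed

lemma hodge_two:
  fixes g :: "real^'n^'n::finite"
  shows "hodge g 2 f vs = (1 / 2) *\<^sub>R (\<Sum>i\<in>UNIV. \<Sum>j\<in>UNIV.
    volume_form g (vs @ [matrix_inv g *v axis j 1, matrix_inv g *v axis i 1]) *\<^sub>R f [axis i 1, axis j 1])"
proof -
  have two: "{is :: 'n list. length is = 2} = (\<lambda>p. [fst p, snd p]) ` (UNIV \<times> UNIV)"
    by (auto simp: length_Suc_conv numeral_2_eq_2 image_iff)
  have inj: "inj_on (\<lambda>p. [fst p, snd p]) ((UNIV :: 'n set) \<times> (UNIV :: 'n set))"
    by (auto simp: inj_on_def prod_eq_iff)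
  show ?thesis
    unfolding hodge_eq_volume_form two sum.reindex[OF inj]
    by (simp add: sum.cartesian_product case_prod_beta fact_numeral)
qed

lemma hodge_Pair: "hodge g r (\<lambda>vs. (f vs, h vs)) vs = (hodge g r f vs, hodge g r h vs)"
  by (simp add: hodge_def prod_eq_iff fst_sum snd_sum)

lemma hodge_add: "hodge g r (\<lambda>vs. f vs + h vs) vs = hodge g r f vs + hodge g r h vs"
  by (simp add: hodge_def scaleR_add_right sum.distrib)

lemma spanning_sharp:
  fixes g :: "real^'n^'n::finite"
  assumes "invertible g"
  shows "spanning (\<lambda>i. matrix_inv g *v axis i 1)"
  unfolding spanning_def
proof
  fix v
  obtain c where "g *v v = (\<Sum>i\<in>UNIV. c i *\<^sub>R axis i 1)"
    using spanning_axis unfolding spanning_def by blast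
  then have "matrix_inv g *v (g *v v) = (\<Sum>i\<in>UNIV. c i *\<^sub>R (matrix_inv g *v axis i 1))"
    by (simp add: linear_sum[OF matrix_vector_mul_linear] matrix_vector_mult_scaleR o_def)
  then show "\<exists>c. v = (\<Sum>i\<in>UNIV. c i *\<^sub>R (matrix_inv g *v axis i 1))"
    by (auto simp: matrix_vector_mul_assoc matrix_inv_left_right[OF assms])
qed

text \<open>A raised basis vector with index in \<open>is\<close> would occur twice, so only the
  missing index p survives in the sum. Thus each coefficient of f can be read off from one value of
  its dual, up to a volume factor.\<close>

lemma hodge_one_sharp:
  fixes g :: "real^'n^'n::finite"
  defines "s \<equiv> \<lambda>i. matrix_inv g *v axis i 1"
  assumes "distinct (is @ [p])" "length is + 1 = CARD('n)"
  shows "hodge g 1 f (map s is) = volume_form g (map s (is @ [p])) *\<^sub>R f [axis p 1]"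
proof -
  have "set (is @ [p]) = UNIV"
    using assms(2,3) by (metis card_subset_eq distinct_card finite_class.finite_UNIV length_append_singleton
        Suc_eq_plus1 top_greatest)
  then have "volume_form g (map s is @ [s i]) = 0" if "i \<noteq> p" for i
  proof -
    have "i \<in> set is" using \<open>set (is @ [p]) = UNIV\<close> that by auto
    then obtain A B where "is = A @ i # B" by (meson split_list)
    then show ?thesis
      using alt_form_repeat[OF alt_form_volume_form[of g], of "map s A" "s i" "map s B" "[]"] by simp
  qed
  then have "(\<Sum>i\<in>UNIV. volume_form g (map s is @ [s i]) *\<^sub>R f [axis i 1])
      = (\<Sum>i\<in>{p}. volume_form g (map s is @ [s i]) *\<^sub>R f [axis i 1])"
    by (intro sum.mono_neutral_right) auto
  then have "hodge g 1 f (map s is) = (\<Sum>i\<in>{p}. volume_form g (map s is @ [s i]) *\<^sub>R f [axis i 1])"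
    unfolding hodge_one s_def .
  then show ?thesis by simp
qed

lemma distinct_completion:
  obtains "is" where "distinct (is @ [p :: 'n::finite])" "length is + 1 = CARD('n)"
proof -
  obtain "is" where "set is = UNIV - {p}" "distinct is"
    using finite_distinct_list[of "UNIV - {p}"] by auto
  moreover from this have "length is = CARD('n) - 1"
    by (metis UNIV_I card_Diff_singleton distinct_card finite_class.finite_UNIV)
  ultimately show ?thesis using that[of "is"] zero_less_card_finite[where 'a='n] by simp
qed

lemma inj_on_hodge_one:
  fixes g :: "real^'n^'n::finite"
  assumes g: "invertible g"
  shows "inj_on (hodge g 1) {f :: ('n, 'g::real_vector) form. alt_form 1 f}"
proof (rule inj_onI)
  fix f h :: "('n, 'g) form"
  assume f: "f \<in> {f. alt_form 1 f}" and h: "h \<in> {f. alt_form 1 f}" and eq: "hodge g 1 f = hodge g 1 h"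
  have p: "f [axis p 1] = h [axis p 1]" for p
  proof -
    obtain "is" where "is": "distinct (is @ [p])" "length is + 1 = CARD('n)" by (rule distinct_completion)
    have "volume_form g (map (\<lambda>i. matrix_inv g *v axis i 1) (is @ [p])) \<noteq> 0"
      using "is" by (intro volume_form_spanning_nonzero[OF g spanning_sharp[OF g]]) auto
    then show ?thesis
      using eq hodge_one_sharp[OF "is", of g f] hodge_one_sharp[OF "is", of g h] by simp
  qed
  have "f vs - h vs = 0" for vs
    by (rule alt_form_eq_0I[OF alt_form_diff spanning_axis])
      (use f h p in \<open>auto simp: length_Suc_conv\<close>)
  then show "f = h" by auto
qed

lemma hodge_inv_one: "invertible g \<Longrightarrow> alt_form 1 f \<Longrightarrow> hodge_inv g 1 (hodge g 1 f) = f"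
  unfolding hodge_inv_def by (intro inv_into_f_f inj_on_hodge_one) auto

text \<open>The preimage is found by solving \<open>hodge_one_sharp\<close> for its coefficients. It
  then agrees with X on lists of raised basis vectors, of which one ordering for each missing index
  is enough.\<close>

lemma hodge_one_surj:
  fixes g :: "real^'n^'n::finite" and X :: "('n, 'g::real_vector) form"
  assumes g: "invertible g" and X: "alt_form (CARD('n) - 1) X"
  obtains f where "alt_form 1 f" "X = hodge g 1 f"
proof -
  define s where "s = (\<lambda>i. matrix_inv g *v axis i 1)"
  obtain c :: "'n \<Rightarrow> 'n list" where c: "\<And>p. distinct (c p @ [p]) \<and> length (c p) + 1 = CARD('n)"
    using distinct_completion by metis
  \<comment> \<open>The final \<open>0\<close> is the base point of a constant field: only a form at
    one point is wanted.\<close>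
  define f where "f = one_form (\<lambda>u :: real^'n. \<lambda>v. \<Sum>p\<in>UNIV.
    (v $ p) *\<^sub>R ((1 / volume_form g (map s (c p @ [p]))) *\<^sub>R X (map s (c p)))) 0"
  have f: "alt_form 1 f"
    unfolding f_def
    by (intro alt_form_one_form linear_compose_sum ballI linear_scaleR_leftI) (auto intro: linearI)
  have delta: "(\<Sum>q\<in>UNIV. ((axis p 1 :: real^'n) $ q) *\<^sub>R y q) = y p" for p and y :: "'n \<Rightarrow> 'g"
  proof -
    have "(\<Sum>q\<in>UNIV. ((axis p 1 :: real^'n) $ q) *\<^sub>R y q) = (\<Sum>q\<in>UNIV. if q = p then y q else 0)"
      by (intro sum.cong) (auto simp: axis_def)
    then show ?thesis by simp
  qed
  have f_axis: "f [axis p 1] = (1 / volume_form g (map s (c p @ [p]))) *\<^sub>R X (map s (c p))" for p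
    by (simp only: f_def one_form_def delta list.sel list.size) simp
  have hX: "hodge g 1 f (map s (c p)) = X (map s (c p))" for p
  proof -
    have "volume_form g (map s (c p @ [p])) \<noteq> 0"
      unfolding s_def using c[of p] by (intro volume_form_spanning_nonzero[OF g spanning_sharp[OF g]]) auto
    then show ?thesis using hodge_one_sharp[of "c p" p g f] c[of p] f_axis[of p] by (simp add: s_def)
  qed
  have alt: "alt_form (CARD('n) - 1) (\<lambda>vs. X vs - hodge g 1 f vs)"
    by (intro alt_form_diff X alt_form_hodge) simp
  have "X vs - hodge g 1 f vs = 0" for vs
  proof (rule alt_form_eq_0I[OF alt])
    show "spanning s" unfolding s_def by (rule spanning_sharp[OF g])
    fix js :: "'n list"
    assume js: "length js = CARD('n) - 1" "distinct js"
    then have "set js \<noteq> UNIV"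
      by (metis One_nat_def Suc_pred distinct_card less_irrefl_nat lessI zero_less_card_finite)
    \<comment> \<open>Being n - 1 distinct indices, \<open>js\<close> misses exactly one, so it
      rearranges the chosen list \<open>c p\<close>.\<close>
    then obtain p where p: "p \<notin> set js" by auto
    then have "mset (c p @ [p]) = mset (js @ [p])"
      using js c[of p] by (intro mset_eq_if_distinct_card) auto
    then have "mset (map s (c p)) = mset (map s js)" by simp
    then show "X (map s js) - hodge g 1 f (map s js) = 0"
      using alt_form_perm_eq_0[OF alt, of "[]" "map s (c p)" "map s js"] hX[of p] by simp
  qed
  then show ?thesis using that[OF f] by auto
qed

text \<open>\<open>hodge_inv\<close> is a choice of preimage, so it respects pairs only because
  preimages among 1-forms exist and are unique; the splitting is done on the preimages.\<close>

lemma hodge_inv_one_Pair: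
  fixes g :: "real^'n^'n::finite"
  assumes g: "invertible g" and X: "alt_form (CARD('n) - 1) X" and Y: "alt_form (CARD('n) - 1) Y"
  shows "hodge_inv g 1 (\<lambda>vs. (X vs, Y vs)) = (\<lambda>vs. (hodge_inv g 1 X vs, hodge_inv g 1 Y vs))"
proof -
  obtain a where a: "alt_form 1 a" "X = hodge g 1 a" by (rule hodge_one_surj[OF g X])
  obtain b where b: "alt_form 1 b" "Y = hodge g 1 b" by (rule hodge_one_surj[OF g Y])
  have "(\<lambda>vs. (X vs, Y vs)) = hodge g 1 (\<lambda>vs. (a vs, b vs))"
    by (simp add: a b hodge_Pair fun_eq_iff)
  then show ?thesis using a b by (simp only: hodge_inv_one[OF g] alt_form_Pair)
qed

lemma hodge_inv_one_add:
  fixes g :: "real^'n^'n::finite"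
  assumes g: "invertible g" and X: "alt_form (CARD('n) - 1) X" and Y: "alt_form (CARD('n) - 1) Y"
  shows "hodge_inv g 1 (\<lambda>vs. X vs + Y vs) = (\<lambda>vs. hodge_inv g 1 X vs + hodge_inv g 1 Y vs)"
proof -
  obtain a where a: "alt_form 1 a" "X = hodge g 1 a" by (rule hodge_one_surj[OF g X])
  obtain b where b: "alt_form 1 b" "Y = hodge g 1 b" by (rule hodge_one_surj[OF g Y])
  have "(\<lambda>vs. X vs + Y vs) = hodge g 1 (\<lambda>vs. a vs + b vs)"
    by (simp add: a b hodge_add fun_eq_iff)
  then show ?thesis using a b by (simp only: hodge_inv_one[OF g] alt_form_add)
qed

text \<open>\<open>l \<and> vol\<close> has degree \<open>n + 1\<close>, hence vanishes.\<close>

lemma wedge_volume_form_eq_0: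
  fixes g :: "real^'n^'n::finite" and l :: "real^'n \<Rightarrow> real"
  assumes l: "linear l"
  shows "(\<Sum>k<length ws. (-1) ^ k * (l (ws ! k) * volume_form g (omit k ws))) = 0"
proof -
  have "alt_form (Suc CARD('n))
      (\<lambda>vs. \<Sum>k<length vs. (-1) ^ k *\<^sub>R (l (vs ! k) *\<^sub>R volume_form g (omit k vs)))"
    by (intro alt_form_antisymmetrization alt_form_scaleR alt_form_volume_form linear_scaleR_leftI l)
  then have "(\<Sum>k<length ws. (-1) ^ k *\<^sub>R (l (ws ! k) *\<^sub>R volume_form g (omit k ws))) = 0"
  proof (rule alt_form_eq_0I[OF _ spanning_axis])
    fix "is" :: "'n list"
    assume "length is = Suc CARD('n)" "distinct is"
    then have False
      by (metis card_mono distinct_card finite_class.finite_UNIV not_less_eq_eq order_refl top_greatest)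
    then show "(\<Sum>k<length (map (\<lambda>i. axis i 1 :: real^'n) is). (-1) ^ k *\<^sub>R
      (l (map (\<lambda>i. axis i 1) is ! k) *\<^sub>R volume_form g (omit k (map (\<lambda>i. axis i 1) is)))) = 0" ..
  qed
  then show ?thesis by simp
qed

text \<open>Evaluating \<open>l \<and> vol = 0\<close> on \<open>vs\<close> followed by two raised
  basis vectors trades the sum over \<open>vs\<close> for two terms in which \<open>l\<close> takes
  a raised vector. Antisymmetry of K makes these contribute equally, which cancels the factor 1/2 of
  \<open>hodge_two\<close>.\<close>

lemma wedge_hodge_two:
  fixes g :: "real^'n^'n::finite" and l :: "real^'n \<Rightarrow> real" and K :: "('n, 'g::real_vector) form"
  assumes l: "linear l" and K: "\<And>x y. K [x, y] = - K [y, x]" and len: "length vs + 1 = CARD('n)"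
  shows "(\<Sum>k<length vs. (-1) ^ k *\<^sub>R (l (vs ! k) *\<^sub>R hodge g 2 K (omit k vs)))
    = (-1) ^ CARD('n) *\<^sub>R (\<Sum>i\<in>UNIV. volume_form g (vs @ [matrix_inv g *v axis i 1]) *\<^sub>R
        (\<Sum>j\<in>UNIV. l (matrix_inv g *v axis j 1) *\<^sub>R K [axis i 1, axis j 1]))"
proof -
  define s where "s = (\<lambda>i::'n. matrix_inv g *v axis i 1)"
  define V where "V = (\<lambda>i. volume_form g (vs @ [s i]))"
  define c where "c = (\<lambda>i j. K [axis i 1, axis j 1])"
  have inner: "(\<Sum>k<length vs. (-1) ^ k * (l (vs ! k) * volume_form g (omit k vs @ [s j, s i])))
      = (-1) ^ CARD('n) * (l (s j) * V i - l (s i) * V j)" for i j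
  proof -
    have "0 = (\<Sum>k<length (vs @ [s j, s i]). (-1) ^ k * (l ((vs @ [s j, s i]) ! k)
        * volume_form g (omit k (vs @ [s j, s i]))))"
      using wedge_volume_form_eq_0[OF l, of "vs @ [s j, s i]" g] by simp
    also have "\<dots> = (\<Sum>k<length vs. (-1) ^ k * (l (vs ! k) * volume_form g (omit k vs @ [s j, s i])))
        + (-1) ^ length vs * (l (s j) * V i) - (-1) ^ length vs * (l (s i) * V j)"
      using omit_length_append[of vs "s j" "[s i]"] omit_length_append[of "vs @ [s j]" "s i" "[]"]
      by (simp add: omit_append nth_append V_def)
    \<comment> \<open>\<open>vs\<close> has n - 1 entries, so moving the last two terms to the other
      side gives the sign (-1)^n.\<close>
    finally show ?thesis using len[symmetric] by (simp add: algebra_simps)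
  qed
  have "(\<Sum>k<length vs. (-1) ^ k *\<^sub>R (l (vs ! k) *\<^sub>R hodge g 2 K (omit k vs)))
      = (\<Sum>k<length vs. \<Sum>i\<in>UNIV. \<Sum>j\<in>UNIV. (1 / 2) *\<^sub>R
          (((-1) ^ k * (l (vs ! k) * volume_form g (omit k vs @ [s j, s i]))) *\<^sub>R c i j))"
    by (simp add: hodge_two s_def c_def scaleR_sum_right mult_ac)
  also have "\<dots> = (\<Sum>i\<in>UNIV. \<Sum>j\<in>UNIV. (1 / 2) *\<^sub>R
      ((\<Sum>k<length vs. (-1) ^ k * (l (vs ! k) * volume_form g (omit k vs @ [s j, s i]))) *\<^sub>R c i j))"
    by (simp add: scaleR_sum_right scaleR_sum_left sum.swap[of _ _ "{..<length vs}"])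
  also have "\<dots> = (-1) ^ CARD('n) *\<^sub>R ((1 / 2) *\<^sub>R ((\<Sum>i\<in>UNIV. \<Sum>j\<in>UNIV. (l (s j) * V i) *\<^sub>R c i j)
      - (\<Sum>i\<in>UNIV. \<Sum>j\<in>UNIV. (l (s i) * V j) *\<^sub>R c i j)))"
    by (simp add: inner scaleR_sum_right scaleR_diff_left scaleR_diff_right sum_subtractf
        right_diff_distrib diff_divide_distrib mult_ac)
  also have "(\<Sum>i\<in>UNIV. \<Sum>j\<in>UNIV. (l (s i) * V j) *\<^sub>R c i j)
      = - (\<Sum>i\<in>UNIV. \<Sum>j\<in>UNIV. (l (s j) * V i) *\<^sub>R c i j)"
  proof -
    have c: "c i j = - c j i" for i j unfolding c_def by (rule K)
    have "(\<Sum>i\<in>UNIV. \<Sum>j\<in>UNIV. (l (s i) * V j) *\<^sub>R c i j)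
        = (\<Sum>i\<in>UNIV. \<Sum>j\<in>UNIV. (l (s j) * V i) *\<^sub>R c j i)"
      by (rule sum.swap)
    also have "\<dots> = (\<Sum>i\<in>UNIV. \<Sum>j\<in>UNIV. - ((l (s j) * V i) *\<^sub>R c i j))"
      by (intro sum.cong refl) (subst c, simp)
    finally show ?thesis by (simp add: sum_negf)
  qed
  finally show ?thesis
    by (simp add: V_def s_def c_def scaleR_sum_right mult_ac scaleR_2[symmetric])
qed

section \<open>Calculus of form fields\<close>

lemma deriv_at_Pair:
  assumes "f differentiable (at u)" "g differentiable (at u)"
  shows "deriv_at (\<lambda>w. (f w, g w)) u v = (deriv_at f u v, deriv_at g u v)"
proof -
  have "((\<lambda>w. (f w, g w)) has_derivative (\<lambda>v. (deriv_at f u v, deriv_at g u v))) (at u)"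
    using assms by (intro has_derivative_Pair) (simp_all add: frechet_derivative_works)
  then show ?thesis by (simp add: frechet_derivative_at[symmetric])
qed

lemma deriv_at_const: "deriv_at (\<lambda>w. c) u v = 0"
  using frechet_derivative_at[OF has_derivative_const[of c "at u"]] by metis

lemma linear_deriv_at: "f differentiable (at u) \<Longrightarrow> linear (deriv_at f u)"
  using frechet_derivative_works has_derivative_linear by blast

lemma ext_d_cong:
  assumes W: "open W" "u \<in> W" and eq: "\<And>w vs. w \<in> W \<Longrightarrow> K w vs = K' w vs"
  shows "ext_d K u vs = ext_d K' u vs"
proof -
  have "deriv_at (\<lambda>w. K w us) u = deriv_at (\<lambda>w. K' w us) u" for us
    by (rule deriv_at_cong_open[OF W eq])
  then show ?thesis by (simp add: ext_d_def)
qed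

lemma ext_d_Pair:
  assumes "\<And>vs. (\<lambda>w. K w vs) differentiable (at u)" "\<And>vs. (\<lambda>w. L w vs) differentiable (at u)"
  shows "ext_d (\<lambda>w vs. (K w vs, L w vs)) u vs = (ext_d K u vs, ext_d L u vs)"
  by (simp add: ext_d_def deriv_at_Pair[OF assms] prod_eq_iff fst_sum snd_sum)

text \<open>The alternation rules are linear relations between values of the form that hold at every
  point, so they pass to its derivative.\<close>

lemma alt_form_deriv_at:
  assumes alt: "\<And>w. alt_form r (H w)" and diff: "\<And>vs. (\<lambda>w. H w vs) differentiable (at u)"
  shows "alt_form r (\<lambda>vs. deriv_at (\<lambda>w. H w vs) u v)"
  unfolding alt_form_def
proof (intro conjI allI impI)
  fix vs :: "(real^'b) list" and k
  assume k: "length vs = r \<and> k < r"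
  have lin: "linear (\<lambda>x. H w (vs[k := x]))" for w using alt[of w, unfolded alt_form_def] k by blast
  show "linear (\<lambda>x. deriv_at (\<lambda>w. H w (vs[k := x])) u v)"
  proof (rule linearI)
    fix x y c
    have "((\<lambda>w. H w (vs[k := x]) + H w (vs[k := y])) has_derivative
        (\<lambda>v. deriv_at (\<lambda>w. H w (vs[k := x])) u v + deriv_at (\<lambda>w. H w (vs[k := y])) u v)) (at u)"
      by (intro has_derivative_add) (use diff frechet_derivative_works in blast)+
    from frechet_derivative_at[OF this]
    show "deriv_at (\<lambda>w. H w (vs[k := x + y])) u v
        = deriv_at (\<lambda>w. H w (vs[k := x])) u v + deriv_at (\<lambda>w. H w (vs[k := y])) u v"
      by (simp add: linear_add[OF lin] fun_eq_iff)
    show "deriv_at (\<lambda>w. H w (vs[k := c *\<^sub>R x])) u v = c *\<^sub>R deriv_at (\<lambda>w. H w (vs[k := x])) u v"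
      by (simp add: linear_scale[OF lin] deriv_at_linear[OF bounded_linear_scaleR_right diff])
  qed
next
  fix vs :: "(real^'b) list" and j k
  assume "length vs = r \<and> j < k \<and> k < r \<and> vs ! j = vs ! k"
  then have "H w vs = 0" for w using alt[of w, unfolded alt_form_def] by blast
  then show "deriv_at (\<lambda>w. H w vs) u v = 0" by (simp add: deriv_at_const)
qed (simp add: alt_form_length[OF alt] deriv_at_const)

lemma alt_form_linear_compose:
  assumes "linear L" "alt_form r f"
  shows "alt_form r (\<lambda>vs. L (f vs))"
  using assms linear_compose[of _ L] unfolding alt_form_def by (auto simp: o_def linear_0)

lemma alt_form_ext_d:
  assumes "\<And>w. alt_form r (H w)" "\<And>vs. (\<lambda>w. H w vs) differentiable (at u)"
  shows "alt_form (Suc r) (ext_d H u)"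
proof -
  have "alt_form (Suc r) (\<lambda>vs. \<Sum>k<length vs. (-1) ^ k *\<^sub>R deriv_at (\<lambda>w. H w (omit k vs)) u (vs ! k))"
    by (rule alt_form_antisymmetrization[of r "\<lambda>v vs. deriv_at (\<lambda>w. H w vs) u v"])
      (intro alt_form_deriv_at linear_deriv_at assms)+
  then show ?thesis by (simp add: ext_d_def[abs_def])
qed

lemma alt_form_form_bracket:
  assumes br: "bounded_bilinear br" and om: "linear (\<lambda>v. \<omega> u [v])" and H: "alt_form r (H u)"
  shows "alt_form (Suc r) (form_bracket br \<omega> H u)"
proof -
  have "alt_form (Suc r) (\<lambda>vs. \<Sum>k<length vs. (-1) ^ k *\<^sub>R br (\<omega> u [vs ! k]) (H u (omit k vs)))"
  proof (rule alt_form_antisymmetrization[of r "\<lambda>v vs. br (\<omega> u [v]) (H u vs)"])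
    show "alt_form r (\<lambda>vs. br (\<omega> u [v]) (H u vs))" for v
      by (rule alt_form_linear_compose[OF bounded_linear.linear[OF bounded_bilinear.bounded_linear_right[OF br]] H])
    show "linear (\<lambda>v. br (\<omega> u [v]) (H u vs))" for vs
      using linear_compose[OF om bounded_linear.linear[OF bounded_bilinear.bounded_linear_left[OF br]]]
      by (simp add: o_def)
  qed
  then show ?thesis by (simp add: form_bracket_def[abs_def])
qed

text \<open>In dimension one there are no 2-forms; the truncated degree \<open>n - 2\<close> needs this case apart.\<close>

lemma hodge_two_dim_one: "CARD('n::finite) = 1 \<Longrightarrow> hodge (g :: real^'n^'n) 2 f = (\<lambda>vs. 0)"
  by (simp add: hodge_def fun_eq_iff)

lemma alt_form_ext_d_hodge_two:
  fixes g :: "real^'n \<Rightarrow> real^'n^'n::finite"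
  assumes "\<And>vs. (\<lambda>w. hodge (g w) 2 (K w) vs) differentiable (at u)"
  shows "alt_form (CARD('n) - 1) (ext_d (\<lambda>w. hodge (g w) 2 (K w)) u)"
proof (cases "CARD('n) = 1")
  case True
  then have "ext_d (\<lambda>w. hodge (g w) 2 (K w)) u = (\<lambda>vs. 0)"
    by (simp add: ext_d_def hodge_two_dim_one deriv_at_const fun_eq_iff)
  then show ?thesis by (simp add: alt_form_zero)
next
  case False
  then have "CARD('n) - 1 = Suc (CARD('n) - 2)" "CARD('n) - 2 + 2 = CARD('n)"
    using zero_less_card_finite[where 'a='n] by linarith+
  then show ?thesis using assms by (simp only: alt_form_ext_d alt_form_hodge)
qed

lemma alt_form_form_bracket_hodge_two:
  fixes g :: "real^'n \<Rightarrow> real^'n^'n::finite"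
  assumes "bounded_bilinear br" "linear (\<lambda>v. \<omega> u [v])"
  shows "alt_form (CARD('n) - 1) (form_bracket br \<omega> (\<lambda>w. hodge (g w) 2 (K w)) u)"
proof (cases "CARD('n) = 1")
  case True
  then have "form_bracket br \<omega> (\<lambda>w. hodge (g w) 2 (K w)) u = (\<lambda>vs. 0)"
    by (simp add: form_bracket_def hodge_two_dim_one fun_eq_iff bounded_bilinear.zero_right[OF assms(1)])
  then show ?thesis by (simp add: alt_form_zero)
next
  case False
  then have "CARD('n) - 1 = Suc (CARD('n) - 2)" "CARD('n) - 2 + 2 = CARD('n)"
    using zero_less_card_finite[where 'a='n] by linarith+
  then show ?thesis using assms by (simp only: alt_form_form_bracket alt_form_hodge)
qed

lemma hodge_linear:
  assumes "linear L"
  shows "L (hodge g r f vs) = hodge g r (\<lambda>us. L (f us)) vs"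
  by (simp add: hodge_def linear_0[OF assms] linear_scale[OF assms] linear_sum[OF assms])

definition smooth_form :: "(real^'n) set \<Rightarrow> ('n::finite, 'g::real_normed_vector) form_field \<Rightarrow> bool" where
  "smooth_form W K \<longleftrightarrow> (\<forall>vs. smooth_on W (\<lambda>w. K w vs))"

lemma smooth_form_ext_d: "open W \<Longrightarrow> smooth_form W K \<Longrightarrow> smooth_form W (ext_d K)"
  unfolding smooth_form_def ext_d_def
  by (intro allI smooth_on_sum smooth_on_linear[OF _ bounded_linear_scaleR_right] smooth_on_deriv) auto

lemma smooth_form_form_bracket:
  "open W \<Longrightarrow> bounded_bilinear br \<Longrightarrow> smooth_form W \<omega> \<Longrightarrow> smooth_form W K
    \<Longrightarrow> smooth_form W (form_bracket br \<omega> K)"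
  unfolding smooth_form_def form_bracket_def
  by (intro allI smooth_on_sum smooth_on_linear[OF _ bounded_linear_scaleR_right] smooth_on_bilinear[of W br])
    auto

lemma smooth_form_add:
  "open W \<Longrightarrow> smooth_form W K \<Longrightarrow> smooth_form W L \<Longrightarrow> smooth_form W (\<lambda>w vs. K w vs + L w vs)"
  unfolding smooth_form_def by (auto intro: smooth_on_add)

lemma smooth_form_scaleR: "open W \<Longrightarrow> smooth_form W K \<Longrightarrow> smooth_form W (\<lambda>w vs. c *\<^sub>R K w vs)"
  unfolding smooth_form_def by (auto intro: smooth_on_linear[OF _ bounded_linear_scaleR_right])

lemma smooth_form_differentiable:
  "open W \<Longrightarrow> smooth_form W K \<Longrightarrow> u \<in> W \<Longrightarrow> (\<lambda>w. K w vs) differentiable (at u)"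
  unfolding smooth_form_def by (blast intro: smooth_on_differentiable)

lemma smooth_form_one_form:
  assumes W: "open W" and A: "\<And>v. smooth_on W (\<lambda>w. A w v)"
  shows "smooth_form W (one_form A)"
proof -
  have "smooth_on W (\<lambda>w. one_form A w vs)" for vs
    by (cases "length vs = 1") (simp_all add: one_form_def A smooth_on_const[OF W])
  then show ?thesis by (simp add: smooth_form_def)
qed

section \<open>Differentiability of the Hodge dual\<close>

lemma sqrt_abs_differentiable:
  fixes f :: "real^'n \<Rightarrow> real"
  assumes "f differentiable (at u)" "f u \<noteq> 0"
  shows "(\<lambda>w. sqrt \<bar>f w\<bar>) differentiable (at u)"
proof -
  \<comment> \<open>Writing |x| as the root of x^2 makes the chain rule applicable away from
    zero.\<close>
  have "((\<lambda>w. sqrt (sqrt ((f w)^2))) has_derivative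
      (\<lambda>v. (2 * f u * deriv_at f u v) / (2 * sqrt ((f u)^2)) / (2 * sqrt (sqrt ((f u)^2))))) (at u)"
    using assms by (auto intro!: derivative_eq_intros simp: frechet_derivative_works field_simps
        simp del: real_sqrt_abs)
  then show ?thesis unfolding real_sqrt_abs differentiable_def by blast
qed

text \<open>The codifferential takes just one derivative of the dual. The factor sqrt |det g| is the
  delicate one: it needs det g to be nonzero.\<close>

lemma hodge_differentiable:
  fixes g :: "real^'n \<Rightarrow> real^'n^'n::finite"
  assumes W: "open W" and g: "smooth_on W g" and inv: "\<And>w. w \<in> W \<Longrightarrow> invertible (g w)"
    and K: "smooth_form W K" and u: "u \<in> W"
  shows "(\<lambda>w. hodge (g w) r (K w) vs) differentiable (at u)"
proof (cases "length vs + r = CARD('n)")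
  case True
  let ?e = "to_nat_on (UNIV :: 'n set)"
  have "(\<lambda>w. volume (g w) (vs @ rev (map (\<lambda>i. matrix_inv (g w) *v axis i 1) is))) differentiable (at u)"
    if len: "length is = r" for "is"
  proof -
    define ws where "ws = (\<lambda>w. vs @ rev (map (\<lambda>i. matrix_inv (g w) *v axis i 1) is))"
    have nth: "smooth_on W (\<lambda>w. ws w ! k)" if "k < CARD('n)" for k
    proof (cases "k < length vs")
      case True
      then show ?thesis by (simp add: ws_def nth_append smooth_on_const[OF W])
    next
      case False
      then have "ws w ! k = matrix_inv (g w) *v axis (rev is ! (k - length vs)) 1" for w
        using that len True by (simp add: ws_def nth_append rev_map)
      then show ?thesis
        by (simp only:) (intro smooth_on_matrix_vector_mult smooth_on_matrix_inv W g inv smooth_on_const)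
    qed
    have less: "?e i < CARD('n)" for i
      using bij_betwE[OF to_nat_on_finite[of "UNIV :: 'n set"]] by simp
    have sm: "smooth_on W (\<lambda>w. det (\<chi> i. ws w ! ?e i))"
      by (intro smooth_on_det[OF W] smooth_on_vecI[OF W]) (simp add: nth[OF less] smooth_on_vec_nth[OF W])
    have sq: "(\<lambda>w. sqrt \<bar>det (g w)\<bar>) differentiable (at u)"
      using inv[OF u] smooth_on_differentiable[OF W smooth_on_det[OF W g] u]
      by (intro sqrt_abs_differentiable) (simp_all add: invertible_det_nz)
    show ?thesis
      using differentiable_mult[OF sq smooth_on_differentiable[OF W sm u]]
      by (simp add: volume_def ws_def)
  qed
  then have "(\<lambda>w. (1 / fact r) *\<^sub>R (\<Sum>is | length is = r.
      volume (g w) (vs @ rev (map (\<lambda>i. matrix_inv (g w) *v axis i 1) is)) *\<^sub>R K w (map (\<lambda>i. axis i 1) is)))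
      differentiable (at u)"
    by (intro differentiable_scaleR differentiable_const differentiable_sum ballI
        smooth_form_differentiable[OF W K u]) (auto simp: finite_lists_length_eq[of UNIV, simplified])
  then show ?thesis using True by (simp add: hodge_def)
qed (simp add: hodge_def)

text \<open>A product rule for M when it is known to be differentiable only at each fixed vector: in
  the standard basis the expression becomes a finite sum of ordinary products.\<close>

lemma linear_apply_has_derivative:
  fixes M :: "real^'n \<Rightarrow> real^'k::finite \<Rightarrow> 'b::real_normed_vector"
  assumes lin: "\<And>w. linear (M w)" and M: "\<And>v. (\<lambda>w. M w v) differentiable (at u)"
    and Y: "(Y has_derivative Y') (at u)"
  shows "((\<lambda>w. M w (Y w)) has_derivative (\<lambda>x. deriv_at (\<lambda>w. M w (Y u)) u x + M u (Y' x))) (at u)"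
proof -
  have exp: "M w y = (\<Sum>i\<in>UNIV. (y $ i) *\<^sub>R M w (axis i 1))" for w y
  proof -
    have "M w y = M w (\<Sum>i\<in>UNIV. (y $ i) *\<^sub>R axis i 1)"
      by (simp add: basis_expansion[of y, unfolded scalar_mult_eq_scaleR])
    then show ?thesis by (simp add: linear_sum[OF lin] linear_scale[OF lin])
  qed
  have dM: "((\<lambda>w. M w v) has_derivative deriv_at (\<lambda>w. M w v) u) (at u)" for v
    using M frechet_derivative_works by blast
  have "((\<lambda>w. \<Sum>i\<in>UNIV. (Y w $ i) *\<^sub>R M w (axis i 1)) has_derivative (\<lambda>x. \<Sum>i\<in>UNIV.
      (Y u $ i) *\<^sub>R deriv_at (\<lambda>w. M w (axis i 1)) u x + (Y' x $ i) *\<^sub>R M u (axis i 1))) (at u)"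
    by (intro has_derivative_sum has_derivative_scaleR dM
        bounded_linear.has_derivative[OF bounded_linear_vec_nth Y])
  moreover have "deriv_at (\<lambda>w. M w (Y u)) u x = (\<Sum>i\<in>UNIV. (Y u $ i) *\<^sub>R deriv_at (\<lambda>w. M w (axis i 1)) u x)" for x
  proof -
    have "((\<lambda>w. \<Sum>i\<in>UNIV. (Y u $ i) *\<^sub>R M w (axis i 1)) has_derivative
        (\<lambda>x. \<Sum>i\<in>UNIV. (Y u $ i) *\<^sub>R deriv_at (\<lambda>w. M w (axis i 1)) u x)) (at u)"
      by (intro has_derivative_sum bounded_linear.has_derivative[OF bounded_linear_scaleR_right] dM)
    moreover have "(\<lambda>w. M w (Y u)) = (\<lambda>w. \<Sum>i\<in>UNIV. (Y u $ i) *\<^sub>R M w (axis i 1))"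
      by (intro ext exp)
    ultimately show ?thesis by (simp only: frechet_derivative_at[symmetric])
  qed
  moreover have "M u (Y' x) = (\<Sum>i\<in>UNIV. (Y' x $ i) *\<^sub>R M u (axis i 1))" for x by (rule exp)
  moreover have "(\<lambda>w. M w (Y w)) = (\<lambda>w. \<Sum>i\<in>UNIV. (Y w $ i) *\<^sub>R M w (axis i 1))"
    by (intro ext exp)
  ultimately show ?thesis by (simp only: sum.distrib)
qed

section \<open>Adapted frames and curvature\<close>

lemmas matrix_mult_algebra =
  bounded_bilinear.add_left[OF bounded_bilinear_matrix_mult]
  bounded_bilinear.add_right[OF bounded_bilinear_matrix_mult]
  bounded_bilinear.diff_left[OF bounded_bilinear_matrix_mult]
  bounded_bilinear.diff_right[OF bounded_bilinear_matrix_mult]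
  bounded_bilinear.minus_left[OF bounded_bilinear_matrix_mult]
  bounded_bilinear.minus_right[OF bounded_bilinear_matrix_mult]
  bounded_bilinear.scaleR_left[OF bounded_bilinear_matrix_mult]
  bounded_bilinear.scaleR_right[OF bounded_bilinear_matrix_mult]

lemma column_matrix_mult: "column j (A ** B) = (A :: real^'a^'b) *v column j B"
  by (simp add: column_def vec_eq_iff matrix_matrix_mult_def matrix_vector_mult_def)

lemma column_add: "column j (A + B) = column j A + column j B"
  by (simp add: column_def vec_eq_iff)

lemma column_diff: "column j (A - B) = column j A - column j B"
  by (simp add: column_def vec_eq_iff)

lemma column_nth: "column j A $ i = A $ i $ j"
  by (simp add: column_def)

text \<open>The matrix is unit triangular with respect to the shells: row \<open>a\<close> meets
  only its own diagonal entry and lower shells, so a kernel vector vanishes by induction on the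
  shell.\<close>

lemma invertible_nframe: "invertible (nframe sh N u)"
proof -
  have "x = 0" if x: "nframe sh N u *v x = 0" for x
  proof -
    have "x $ a = 0" for a
    proof (induction a rule: measure_induct_rule[of sh])
      case (less a)
      have "nframe sh N u $ a $ b * x $ b = (if b = a then x $ a else 0)" for b
        using less.IH[of b] by (auto simp: nframe_def)
      then have "(nframe sh N u *v x) $ a = x $ a" by (simp add: matrix_vector_mult_def)
      then show ?case by (simp add: x)
    qed
    then show ?thesis by (simp add: vec_eq_iff)
  qed
  then show ?thesis by (simp add: invertible_left_inverse matrix_left_invertible_ker)
qed

lemma ncoframe_nframe: "ncoframe sh N u ** nframe sh N u = mat 1"
  and nframe_ncoframe: "nframe sh N u ** ncoframe sh N u = mat 1"
  unfolding ncoframe_def by (intro matrix_inv_left_right invertible_nframe)+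

lemma ncoframe_nframe_vector: "ncoframe sh N u *v (nframe sh N u *v x) = x"
  by (simp add: matrix_vector_mul_assoc ncoframe_nframe)

lemma ncoframe_delta: "ncoframe sh N u *v delta sh N \<alpha> u = axis \<alpha> 1"
  by (simp add: delta_def matrix_vector_mult_basis[symmetric] ncoframe_nframe_vector)

text \<open>The connection form A of the adapted frame: on components in that frame, D = d +
  A.\<close>

definition conn_matrix ::
  "('n::finite \<Rightarrow> nat) \<Rightarrow> (real^'n \<Rightarrow> real^'n^'n) \<Rightarrow> (real^'n \<Rightarrow> 'n \<Rightarrow> 'n \<Rightarrow> 'n \<Rightarrow> real) \<Rightarrow>
   real^'n \<Rightarrow> real^'n \<Rightarrow> real^'n^'n" where
  "conn_matrix sh N \<Gamma> u v = (\<chi> \<gamma> \<beta>. \<Sum>\<alpha>\<in>UNIV. \<Gamma> u \<gamma> \<alpha> \<beta> * (ncoframe sh N u *v v) $ \<alpha>)"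

text \<open>The value of dA + A \<and> A on the constant coordinate fields x and y, whose Lie
  bracket vanishes.\<close>

definition conn_curv ::
  "('n::finite \<Rightarrow> nat) \<Rightarrow> (real^'n \<Rightarrow> real^'n^'n) \<Rightarrow> (real^'n \<Rightarrow> 'n \<Rightarrow> 'n \<Rightarrow> 'n \<Rightarrow> real) \<Rightarrow>
   real^'n \<Rightarrow> real^'n \<Rightarrow> real^'n \<Rightarrow> real^'n^'n" where
  "conn_curv sh N \<Gamma> u x y =
     deriv_at (\<lambda>w. conn_matrix sh N \<Gamma> w y) u x - deriv_at (\<lambda>w. conn_matrix sh N \<Gamma> w x) u y
     + conn_matrix sh N \<Gamma> u x ** conn_matrix sh N \<Gamma> u y
     - conn_matrix sh N \<Gamma> u y ** conn_matrix sh N \<Gamma> u x"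

lemma linear_conn_matrix: "linear (conn_matrix sh N \<Gamma> u)"
  by (intro linearI) (simp_all add: conn_matrix_def vec_eq_iff matrix_vector_right_distrib
      matrix_vector_mult_scaleR distrib_left sum.distrib sum_distrib_left mult_ac)

lemma nabla_eq:
  "nabla sh N \<Gamma> Y u v = nframe sh N u *v
    ((\<chi> \<gamma>. deriv_at (\<lambda>w. (ncoframe sh N w *v Y w) $ \<gamma>) u v)
     + conn_matrix sh N \<Gamma> u v *v (ncoframe sh N u *v Y u))"
proof -
  have "(\<Sum>\<alpha>\<in>UNIV. \<Sum>\<beta>\<in>UNIV. \<Gamma> u \<gamma> \<alpha> \<beta> * (ncoframe sh N u *v v) $ \<alpha> * x $ \<beta>)
      = (conn_matrix sh N \<Gamma> u v *v x) $ \<gamma>" for \<gamma> x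
    by (subst sum.swap) (simp add: conn_matrix_def matrix_vector_mult_def[of "\<chi> \<gamma> \<beta>. _ \<gamma> \<beta>"] sum_distrib_right)
  then show ?thesis
    unfolding nabla_def by (intro arg_cong[where f="(*v) _"]) (simp add: vec_eq_iff)
qed

lemma nabla_delta: "nabla sh N \<Gamma> (delta sh N \<beta>) u v = nframe sh N u *v column \<beta> (conn_matrix sh N \<Gamma> u v)"
proof -
  have "(\<chi> \<gamma>. deriv_at (\<lambda>w. (ncoframe sh N w *v delta sh N \<beta> w) $ \<gamma>) u v) = 0"
    by (simp add: ncoframe_delta deriv_at_const vec_eq_iff)
  then show ?thesis by (simp add: nabla_eq ncoframe_delta matrix_vector_mult_basis)
qed

lemma bounded_linear_matrix_nth: "bounded_linear (\<lambda>A :: real^'a^'b. A $ i $ j)"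
  by (intro bounded_linear_compose[OF bounded_linear_vec_nth bounded_linear_vec_nth])

locale local_connection =
  fixes sh :: "'n::finite \<Rightarrow> nat" and N :: "real^'n \<Rightarrow> real^'n^'n"
    and \<Gamma> :: "real^'n \<Rightarrow> 'n \<Rightarrow> 'n \<Rightarrow> 'n \<Rightarrow> real" and W :: "(real^'n) set"
  assumes W: "open W" and nframe_smooth: "smooth_on W (nframe sh N)"
    and \<Gamma>_smooth: "\<And>\<gamma> \<alpha> \<beta>. smooth_on W (\<lambda>u. \<Gamma> u \<gamma> \<alpha> \<beta>)"
begin

abbreviation "F \<equiv> nframe sh N"
abbreviation "P \<equiv> ncoframe sh N"
abbreviation "A \<equiv> conn_matrix sh N \<Gamma>"
abbreviation "\<Theta> \<equiv> conn_curv sh N \<Gamma>"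

lemma ncoframe_smooth: "smooth_on W P"
  unfolding ncoframe_def[abs_def] by (intro smooth_on_matrix_inv W nframe_smooth invertible_nframe)

lemma conn_matrix_smooth: "smooth_on W (\<lambda>w. A w v)"
  unfolding conn_matrix_def
  by (intro smooth_on_vecI[OF W])
    (simp, intro smooth_on_sum[OF W] smooth_on_mult[OF W] \<Gamma>_smooth smooth_on_vec_nth[OF W]
      smooth_on_matrix_vector_mult[OF W] ncoframe_smooth smooth_on_const[OF W])

lemma conn_matrix_differentiable: "u \<in> W \<Longrightarrow> (\<lambda>w. A w v) differentiable (at u)"
  by (rule smooth_on_differentiable[OF W conn_matrix_smooth])

lemma delta_smooth: "smooth_on W (delta sh N \<alpha>)"
  unfolding delta_def[abs_def] matrix_vector_mult_basis[symmetric]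
  by (intro smooth_on_matrix_vector_mult W nframe_smooth smooth_on_const)

lemma linear_deriv_conn_matrix:
  assumes "u \<in> W"
  shows "linear (\<lambda>y. deriv_at (\<lambda>w. A w y) u x)"
proof (rule linearI)
  fix y z c
  have "((\<lambda>w. A w y + A w z) has_derivative
      (\<lambda>x. deriv_at (\<lambda>w. A w y) u x + deriv_at (\<lambda>w. A w z) u x)) (at u)"
    by (intro has_derivative_add) (use conn_matrix_differentiable[OF assms] frechet_derivative_works in blast)+
  from frechet_derivative_at[OF this]
  show "deriv_at (\<lambda>w. A w (y + z)) u x = deriv_at (\<lambda>w. A w y) u x + deriv_at (\<lambda>w. A w z) u x"
    by (simp add: linear_add[OF linear_conn_matrix] fun_eq_iff)
  show "deriv_at (\<lambda>w. A w (c *\<^sub>R y)) u x = c *\<^sub>R deriv_at (\<lambda>w. A w y) u x"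
    by (simp add: linear_scale[OF linear_conn_matrix]
        deriv_at_linear[OF bounded_linear_scaleR_right conn_matrix_differentiable[OF assms]])
qed

lemma conn_curv_antisym: "\<Theta> u x y = - \<Theta> u y x"
  by (simp add: conn_curv_def)

lemma linear_conn_curv_left:
  assumes "u \<in> W"
  shows "linear (\<lambda>x. \<Theta> u x y)"
proof -
  note lin = linear_deriv_at[OF conn_matrix_differentiable[OF assms], of y] linear_conn_matrix[of sh N \<Gamma> u]
    linear_deriv_conn_matrix[OF assms, of y]
  show ?thesis
    by (intro linearI) (simp_all add: conn_curv_def lin[THEN linear_add] lin[THEN linear_scale]
        matrix_mult_algebra algebra_simps)
qed

lemma linear_conn_curv_right: "u \<in> W \<Longrightarrow> linear (\<Theta> u x)"
  using linear_compose_neg[OF linear_conn_curv_left] conn_curv_antisym[of u x] by presburger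

text \<open>The second derivative still contains A applied to the derivative of Y. This nontensorial
  term is kept separate so that the Lie bracket can cancel it in the curvature.\<close>

lemma nabla_nabla_delta:
  assumes u: "u \<in> W" and Y: "Y differentiable (at u)"
  shows "P u *v nabla sh N \<Gamma> (\<lambda>w. nabla sh N \<Gamma> (delta sh N \<beta>) w (Y w)) u x
    = column \<beta> (deriv_at (\<lambda>w. A w (Y u)) u x + A u (deriv_at Y u x) + A u x ** A u (Y u))"
proof -
  have der: "((\<lambda>w. A w (Y w)) has_derivative (\<lambda>x. deriv_at (\<lambda>w. A w (Y u)) u x + A u (deriv_at Y u x))) (at u)"
    using Y by (intro linear_apply_has_derivative linear_conn_matrix conn_matrix_differentiable[OF u])
      (simp add: frechet_derivative_works)
  then have "(\<lambda>w. A w (Y w)) differentiable (at u)" by (auto simp: differentiable_def)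
  then have "deriv_at (\<lambda>w. A w (Y w) $ \<gamma> $ \<beta>) u x = deriv_at (\<lambda>w. A w (Y w)) u x $ \<gamma> $ \<beta>" for \<gamma>
    by (rule deriv_at_linear[OF bounded_linear_matrix_nth])
  then have "(\<chi> \<gamma>. deriv_at (\<lambda>w. column \<beta> (A w (Y w)) $ \<gamma>) u x)
      = column \<beta> (deriv_at (\<lambda>w. A w (Y u)) u x + A u (deriv_at Y u x))"
    by (simp add: vec_eq_iff column_nth frechet_derivative_at[OF der, symmetric])
  then show ?thesis
    unfolding nabla_delta
    by (simp add: nabla_eq[of sh N \<Gamma> "\<lambda>w. F w *v column \<beta> (A w (Y w))"] ncoframe_nframe_vector column_add column_matrix_mult)
qed

text \<open>The adapted frame is in general nonholonomic. The term of the curvature along the Lie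
  bracket removes precisely the derivatives of the frame fields, and dA + A \<and> A
  remains.\<close>

lemma curv_comp_eq:
  assumes u: "u \<in> W"
  shows "curv_comp sh N \<Gamma> u \<beta> \<alpha> \<gamma> \<delta> = \<Theta> u (delta sh N \<delta> u) (delta sh N \<gamma> u) $ \<alpha> $ \<beta>"
proof -
  note diff = smooth_on_differentiable[OF W delta_smooth u]
  have "P u *v curvature sh N \<Gamma> (delta sh N \<delta>) (delta sh N \<gamma>) (delta sh N \<beta>) u
      = column \<beta> (\<Theta> u (delta sh N \<delta> u) (delta sh N \<gamma> u))"
    unfolding curvature_def matrix_vector_mult_diff_distrib nabla_nabla_delta[OF u diff]
    by (simp add: nabla_delta ncoframe_nframe_vector lie_bracket_def linear_diff[OF linear_conn_matrix]
        conn_curv_def column_add column_diff)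
  then show ?thesis by (simp add: curv_comp_def column_nth)
qed

text \<open>The trace pairs the upper index with the first vector argument, while v fills the second
  argument and hence the second Ricci index; the order matters for a nonsymmetric Ricci
  tensor.\<close>

lemma ricci_eq:
  assumes u: "u \<in> W"
  shows "(\<Sum>m\<in>UNIV. ricci sh N \<Gamma> u $ l $ m * (P u *v v) $ m)
    = (\<Sum>\<tau>\<in>UNIV. \<Theta> u (delta sh N \<tau> u) v $ \<tau> $ l)"
proof -
  have v: "v = (\<Sum>m\<in>UNIV. (P u *v v) $ m *\<^sub>R delta sh N m u)"
  proof -
    have "v = F u *v (\<Sum>m\<in>UNIV. (P u *v v) $ m *\<^sub>R axis m 1)"
      by (simp add: basis_expansion[of "P u *v v", unfolded scalar_mult_eq_scaleR]
          matrix_vector_mul_assoc nframe_ncoframe)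
    then show ?thesis
      by (simp add: linear_sum[OF matrix_vector_mul_linear] matrix_vector_mult_scaleR
          matrix_vector_mult_basis delta_def)
  qed
  have "\<Theta> u x v = (\<Sum>m\<in>UNIV. (P u *v v) $ m *\<^sub>R \<Theta> u x (delta sh N m u))" for x
    by (subst v) (simp add: linear_sum[OF linear_conn_curv_right[OF u]] linear_scale[OF linear_conn_curv_right[OF u]])
  then have "(\<Sum>\<tau>\<in>UNIV. \<Theta> u (delta sh N \<tau> u) v $ \<tau> $ l)
      = (\<Sum>\<tau>\<in>UNIV. \<Sum>m\<in>UNIV. (P u *v v) $ m * \<Theta> u (delta sh N \<tau> u) (delta sh N m u) $ \<tau> $ l)"
    by (simp add: sum_component)
  also have "\<dots> = (\<Sum>m\<in>UNIV. ricci sh N \<Gamma> u $ l $ m * (P u *v v) $ m)"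
    by (subst sum.swap) (simp add: ricci_def curv_comp_eq[OF u] sum_distrib_left mult.commute)
  finally show ?thesis ..
qed

end

section \<open>The Cartan connection in a gauge\<close>

locale gauge_region = local_connection sh N \<Gamma> W
  for sh :: "'n::finite \<Rightarrow> nat" and N :: "real^'n \<Rightarrow> real^'n^'n"
    and \<Gamma> :: "real^'n \<Rightarrow> 'n \<Rightarrow> 'n \<Rightarrow> 'n \<Rightarrow> real" and W :: "(real^'n) set" +
  fixes vb :: "real^'n \<Rightarrow> real^'n^'n"
  assumes vb_smooth: "smooth_on W vb" and vb_invertible: "\<And>u. u \<in> W \<Longrightarrow> invertible (vb u)"
begin

text \<open>Column b holds the components, in the adapted frame, of the vector e_b of the frame dual
  to \<chi>.\<close>

definition vb_inv :: "real^'n \<Rightarrow> real^'n^'n" where "vb_inv u = matrix_inv (vb u)"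

text \<open>The usual change of frame h A h^-1 + h d(h^-1) with h = \<open>vb\<close>.\<close>

definition gauge_conn :: "real^'n \<Rightarrow> real^'n \<Rightarrow> real^'n^'n" where
  "gauge_conn u v = vb u ** (deriv_at vb_inv u v + A u v ** vb_inv u)"

text \<open>The value of d\<omega> + \<omega> \<and> \<omega> on constant fields, for \<omega> =
  \<open>gauge_conn\<close>.\<close>

definition gauge_curv :: "real^'n \<Rightarrow> real^'n \<Rightarrow> real^'n \<Rightarrow> real^'n^'n" where
  "gauge_curv u x y = deriv_at (\<lambda>w. gauge_conn w y) u x - deriv_at (\<lambda>w. gauge_conn w x) u y + gauge_conn u x ** gauge_conn u y - gauge_conn u y ** gauge_conn u x"

abbreviation "conn_form \<equiv> connection_form sh N \<Gamma> vb"
abbreviation "shifting \<equiv> shift_form sh N vb"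

lemma vb_inv_smooth: "smooth_on W vb_inv"
  unfolding vb_inv_def[abs_def] by (intro smooth_on_matrix_inv W vb_smooth vb_invertible)

lemma vb_vb_inv: "u \<in> W \<Longrightarrow> vb u ** vb_inv u = mat 1" and vb_inv_vb: "u \<in> W \<Longrightarrow> vb_inv u ** vb u = mat 1"
  unfolding vb_inv_def by (simp_all add: matrix_inv_left_right vb_invertible)

lemma gauge_conn_smooth: "smooth_on W (\<lambda>w. gauge_conn w v)"
  unfolding gauge_conn_def
  by (intro smooth_on_matrix_mult smooth_on_add W vb_smooth smooth_on_deriv vb_inv_smooth conn_matrix_smooth)

lemma linear_gauge_conn:
  assumes "u \<in> W"
  shows "linear (gauge_conn u)"
  unfolding gauge_conn_def
  using linear_deriv_at[OF smooth_on_differentiable[OF W vb_inv_smooth assms]] linear_conn_matrix[of sh N \<Gamma> u]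
  by (intro linearI) (simp_all add: linear_add linear_scale matrix_mult_algebra algebra_simps)

lemma connection_form_eq:
  assumes u: "u \<in> W"
  shows "conn_form u vs = one_form gauge_conn u vs"
proof -
  have "P w *v gauge_frame sh N vb b w = column b (vb_inv w)" for w b
    by (simp add: gauge_frame_def column_matrix_mult ncoframe_nframe_vector vb_inv_def)
  moreover have "deriv_at (\<lambda>w. column b (vb_inv w) $ \<gamma>) u v = deriv_at vb_inv u v $ \<gamma> $ b" for b \<gamma> v
    unfolding column_nth by (rule deriv_at_linear[OF bounded_linear_matrix_nth smooth_on_differentiable[OF W vb_inv_smooth u]])
  ultimately have frame: "P u *v nabla sh N \<Gamma> (gauge_frame sh N vb b) u v
      = column b (deriv_at vb_inv u v + A u v ** vb_inv u)" for b v
    by (simp add: nabla_eq ncoframe_nframe_vector column_add column_matrix_mult)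
      (simp add: column_def)
  have "(\<chi> a b. (vb u *v (P u *v nabla sh N \<Gamma> (gauge_frame sh N vb b) u v)) $ a) = gauge_conn u v" for v
    by (simp only: frame gauge_conn_def column_matrix_mult[symmetric] column_nth vec_lambda_eta)
  then show ?thesis by (simp add: connection_form_def one_form_def)
qed

lemma connection_form_smooth: "smooth_form W conn_form"
proof -
  have "smooth_form W (one_form gauge_conn)" by (intro smooth_form_one_form W gauge_conn_smooth)
  moreover have "smooth_on W (\<lambda>w. conn_form w vs) \<longleftrightarrow> smooth_on W (\<lambda>w. one_form gauge_conn w vs)" for vs
    by (rule smooth_on_cong[OF W connection_form_eq])
  ultimately show ?thesis by (simp add: smooth_form_def)
qed

lemma shift_form_smooth: "smooth_form W shifting"
  unfolding shift_form_def
  by (intro smooth_form_one_form smooth_on_matrix_vector_mult W vb_smooth ncoframe_smooth smooth_on_const)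

lemma bounded_bilinear_gl_bracket: "bounded_bilinear (gl_bracket :: real^'a^'a \<Rightarrow> _)"
  unfolding gl_bracket_def bilinear_conv_bounded_bilinear[symmetric] bilinear_def
  by (auto intro!: linearI simp: matrix_mult_algebra algebra_simps)

lemma curvature_form_linear_smooth: "smooth_form W (curvature_form gl_bracket conn_form)"
  unfolding curvature_form_def[abs_def]
  by (intro smooth_form_add smooth_form_scaleR smooth_form_ext_d smooth_form_form_bracket W
      connection_form_smooth bounded_bilinear_gl_bracket)

lemma torsion_form_smooth: "smooth_form W (torsion_form sh N \<Gamma> vb)"
  unfolding torsion_form_def[abs_def]
  by (intro smooth_form_add smooth_form_ext_d smooth_form_form_bracket W
      connection_form_smooth shift_form_smooth bounded_bilinear_matrix_vector_mult)

lemma omit_pair: "omit 0 [x, y] = [y]" "omit (Suc 0) [x, y] = [x]"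
  by (simp_all add: omit_def)

text \<open>On two vectors the bracket of the form with itself counts the commutator twice, which
  the factor 1/2 undoes.\<close>

lemma curvature_form_eq:
  assumes u: "u \<in> W"
  shows "curvature_form gl_bracket conn_form u [x, y] = gauge_curv u x y"
proof -
  have "ext_d conn_form u [x, y] = ext_d (one_form gauge_conn) u [x, y]"
    by (rule ext_d_cong[OF W u connection_form_eq])
  then show ?thesis
    by (simp add: curvature_form_def form_bracket_def connection_form_eq[OF u] ext_d_def one_form_def
        omit_pair numeral_2_eq_2 lessThan_Suc gl_bracket_def gauge_curv_def scaleR_2[symmetric] algebra_simps)
qed

lemma vb_deriv_vb_inv:
  assumes u: "u \<in> W"
  shows "vb u ** deriv_at vb_inv u x = - (deriv_at vb u x ** vb_inv u)"
proof -
  have dvb: "(vb has_derivative deriv_at vb u) (at u)" and dk: "(vb_inv has_derivative deriv_at vb_inv u) (at u)"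
    by (intro smooth_on_has_derivative[OF W _ u] vb_smooth vb_inv_smooth)+
  have "deriv_at (\<lambda>w. vb w ** vb_inv w) u x = deriv_at (\<lambda>w. mat 1) u x"
    by (rule fun_cong[OF deriv_at_cong_open[OF W u vb_vb_inv]])
  then show ?thesis
    by (simp add: frechet_derivative_at[OF bounded_bilinear.FDERIV[OF bounded_bilinear_matrix_mult dvb dk], symmetric]
        deriv_at_const eq_neg_iff_add_eq_0)
qed

text \<open>Arranged so that what is symmetric in x and y stands out: the second derivative of
  \<open>vb_inv\<close>, and the two mixed terms with A together. Subtracting the same expression
  with x and y exchanged removes them.\<close>

lemma gauge_curv_half:
  assumes u: "u \<in> W"
  shows "deriv_at (\<lambda>w. gauge_conn w y) u x + gauge_conn u x ** gauge_conn u y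
    = vb u ** (deriv_at (\<lambda>w. deriv_at vb_inv w y) u x + deriv_at (\<lambda>w. A w y) u x ** vb_inv u
        + A u y ** deriv_at vb_inv u x + A u x ** deriv_at vb_inv u y + A u x ** A u y ** vb_inv u)"
proof -
  have dvb: "(vb has_derivative deriv_at vb u) (at u)" and dk: "(vb_inv has_derivative deriv_at vb_inv u) (at u)"
    and ddk: "((\<lambda>w. deriv_at vb_inv w y) has_derivative deriv_at (\<lambda>w. deriv_at vb_inv w y) u) (at u)"
    and dA: "((\<lambda>w. A w y) has_derivative deriv_at (\<lambda>w. A w y) u) (at u)"
    by (intro smooth_on_has_derivative[OF W _ u] vb_smooth vb_inv_smooth smooth_on_deriv conn_matrix_smooth)+
  note prod = bounded_bilinear.FDERIV[OF bounded_bilinear_matrix_mult]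
  define h z where "h = vb u" and "z = deriv_at vb_inv u y + A u y ** vb_inv u"
  have dom: "deriv_at (\<lambda>w. gauge_conn w y) u x = h ** (deriv_at (\<lambda>w. deriv_at vb_inv w y) u x
      + (A u y ** deriv_at vb_inv u x + deriv_at (\<lambda>w. A w y) u x ** vb_inv u)) + deriv_at vb u x ** z"
    unfolding gauge_conn_def frechet_derivative_at[OF prod[OF dvb has_derivative_add[OF ddk prod[OF dA dk]]], symmetric]
      h_def z_def ..
  have "h ** deriv_at vb_inv u x = - (deriv_at vb u x ** vb_inv u)"
    unfolding h_def by (rule vb_deriv_vb_inv[OF u])
  then have "gauge_conn u x = (h ** A u x - deriv_at vb u x) ** vb_inv u"
    by (simp add: gauge_conn_def h_def[symmetric] matrix_mult_algebra matrix_mul_assoc)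
  moreover have "gauge_conn u y = h ** z" by (simp add: gauge_conn_def h_def z_def)
  ultimately have "gauge_conn u x ** gauge_conn u y = (h ** A u x - deriv_at vb u x) ** (vb_inv u ** h) ** z"
    by (simp add: matrix_mul_assoc)
  \<comment> \<open>The last term here cancels the derivative of the outer factor \<open>vb\<close>
    in \<open>dom\<close>.\<close>
  then have "gauge_conn u x ** gauge_conn u y = h ** A u x ** z - deriv_at vb u x ** z"
    by (simp add: h_def vb_inv_vb[OF u] matrix_mult_algebra)
  then show ?thesis
    by (simp add: dom z_def h_def[symmetric] matrix_mult_algebra matrix_mul_assoc algebra_simps)
qed

lemma gauge_curv_eq:
  assumes u: "u \<in> W"
  shows "gauge_curv u x y = vb u ** \<Theta> u x y ** vb_inv u"
proof -
  have "gauge_curv u x y = (deriv_at (\<lambda>w. gauge_conn w y) u x + gauge_conn u x ** gauge_conn u y)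
      - (deriv_at (\<lambda>w. gauge_conn w x) u y + gauge_conn u y ** gauge_conn u x)"
    by (simp add: gauge_curv_def)
  \<comment> \<open>Without this symmetry the curvature would not transform by mere
    conjugation.\<close>
  moreover have "deriv_at (\<lambda>w. deriv_at vb_inv w y) u x = deriv_at (\<lambda>w. deriv_at vb_inv w x) u y"
    by (rule symmetric_second_deriv[OF vb_inv_smooth W u])
  ultimately show ?thesis
    by (simp only: gauge_curv_half[OF u] conn_curv_def)
      (simp add: matrix_mult_algebra matrix_mul_assoc)
qed

lemma gauge_curv_antisym: "gauge_curv u x y = - gauge_curv u y x"
  by (simp add: gauge_curv_def)

end

section \<open>The Yang-Mills operator of the Cartan connection\<close>

context gauge_region
begin

abbreviation "cartan \<equiv> cartan_form sh N \<Gamma> vb"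
abbreviation "curv_form \<equiv> curvature_form gl_bracket conn_form"
abbreviation "tors \<equiv> torsion_form sh N \<Gamma> vb"

lemma linear_gauge_curv_right: "u \<in> W \<Longrightarrow> linear (gauge_curv u x)"
  using linear_add[OF linear_conn_curv_right] linear_scale[OF linear_conn_curv_right]
  by (intro linearI) (simp_all add: gauge_curv_eq matrix_mult_algebra)

text \<open>Translations commute, so no term quadratic in \<chi> appears. The mixed terms occur once
  for each order of the factors; this doubling makes the factor 1/2 in the curvature leave \<Omega>
  \<and> \<chi> intact.\<close>

lemma cartan_bracket:
  assumes u: "u \<in> W"
  shows "form_bracket aff_bracket cartan cartan u vs
    = (form_bracket gl_bracket conn_form conn_form u vs, 2 *\<^sub>R form_bracket (*v) conn_form shifting u vs)"
proof (cases "length vs = 2")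
  case True
  then obtain x y where "vs = [x, y]" by (auto simp: numeral_2_eq_2 length_Suc_conv)
  then show ?thesis
    by (simp add: form_bracket_def aff_bracket_def cartan_form_def omit_pair numeral_2_eq_2 lessThan_Suc
        scaleR_2 algebra_simps)
next
  case False
  have "conn_form u (omit j vs) = 0" "shifting u (omit j vs) = 0" if "j < length vs" for j
    using that False length_omit[OF that] by (auto simp: connection_form_def shift_form_def one_form_def)
  then show ?thesis
    by (simp add: form_bracket_def aff_bracket_def gl_bracket_def cartan_form_def zero_prod_def[symmetric])
qed

lemma cartan_curvature:
  assumes u: "u \<in> W"
  shows "curvature_form aff_bracket cartan u = (\<lambda>vs. (curv_form u vs, tors u vs))"
proof
  fix vs
  have "ext_d cartan u vs = (ext_d conn_form u vs, ext_d shifting u vs)"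
    unfolding cartan_form_def[abs_def]
    by (intro ext_d_Pair smooth_form_differentiable[OF W _ u] connection_form_smooth shift_form_smooth)
  then show "curvature_form aff_bracket cartan u vs = (curv_form u vs, tors u vs)"
    by (simp add: curvature_form_def torsion_form_def cartan_bracket[OF u])
qed

end

lemma transpose_add: "transpose (A + B) = transpose A + transpose (B :: real^'a^'b)"
  by (simp add: transpose_def vec_eq_iff)

lemma transpose_diff: "transpose (A - B) = transpose A - transpose (B :: real^'a^'b)"
  by (simp add: transpose_def vec_eq_iff)

locale metric_gauge = gauge_region sh N \<Gamma> W vb
  for sh :: "'n::finite \<Rightarrow> nat" and N :: "real^'n \<Rightarrow> real^'n^'n"
    and \<Gamma> :: "real^'n \<Rightarrow> 'n \<Rightarrow> 'n \<Rightarrow> 'n \<Rightarrow> real" and W :: "(real^'n) set"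
    and vb :: "real^'n \<Rightarrow> real^'n^'n" +
  fixes G :: "real^'n \<Rightarrow> real^'n^'n" and \<eta> :: "'n \<Rightarrow> real"
  assumes G_smooth: "smooth_on W G" and \<eta>: "\<And>a. \<eta> a = 1 \<or> \<eta> a = -1"
    and G_eq: "\<And>u \<alpha> \<beta>. u \<in> W \<Longrightarrow> G u $ \<alpha> $ \<beta> = (\<Sum>a\<in>UNIV. vb u $ a $ \<alpha> * vb u $ a $ \<beta> * \<eta> a)"
    and compatible: "\<And>u v \<alpha> \<beta>. u \<in> W \<Longrightarrow> deriv_at (\<lambda>w. G w $ \<alpha> $ \<beta>) u v
      = (\<Sum>\<gamma>\<in>UNIV. conn_matrix sh N \<Gamma> u v $ \<gamma> $ \<alpha> * G u $ \<gamma> $ \<beta>)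
      + (\<Sum>\<gamma>\<in>UNIV. G u $ \<alpha> $ \<gamma> * conn_matrix sh N \<Gamma> u v $ \<gamma> $ \<beta>)"
begin

section \<open>Metricity in an orthonormal gauge\<close>

definition eta_mat :: "real^'n^'n" where "eta_mat = (\<chi> a b. if a = b then \<eta> a else 0)"

lemma \<eta>_sq: "\<eta> a * \<eta> a = 1"
  using \<eta>[of a] by auto

lemma eta_mat_mult_nth: "(eta_mat ** M) $ a $ b = \<eta> a * M $ a $ b"
  by (simp add: eta_mat_def matrix_matrix_mult_def if_distrib[where f="\<lambda>x. x * y" for y] cong: if_cong)

lemma mult_eta_mat_nth: "(M ** eta_mat) $ a $ b = M $ a $ b * \<eta> b"
  by (simp add: eta_mat_def matrix_matrix_mult_def if_distrib[where f="\<lambda>x. y * x" for y] cong: if_cong)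

lemma eta_mat_eta_mat: "eta_mat ** eta_mat = mat 1"
  by (simp add: vec_eq_iff eta_mat_mult_nth) (simp add: eta_mat_def mat_def \<eta>_sq)

lemma G_matrix: "u \<in> W \<Longrightarrow> G u = transpose (vb u) ** eta_mat ** vb u"
  by (simp add: vec_eq_iff G_eq matrix_matrix_mult_def[of "transpose _ ** eta_mat"] mult_eta_mat_nth)
    (simp add: transpose_def mult_ac)

lemma deriv_G_matrix:
  assumes u: "u \<in> W"
  shows "deriv_at G u v = transpose (A u v) ** G u + G u ** A u v"
proof -
  have "deriv_at G u v $ \<alpha> $ \<beta> = deriv_at (\<lambda>w. G w $ \<alpha> $ \<beta>) u v" for \<alpha> \<beta>
    by (rule deriv_at_linear[OF bounded_linear_matrix_nth smooth_on_differentiable[OF W G_smooth u], symmetric])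
  then show ?thesis
    by (simp add: vec_eq_iff compatible[OF u]) (simp add: matrix_matrix_mult_def transpose_def)
qed

text \<open>\<open>skew M = 0\<close> says that M lies in the Lie algebra of the orthogonal group of
  \<eta>.\<close>

definition skew :: "real^'n^'n \<Rightarrow> real^'n^'n" where
  "skew M = transpose M ** eta_mat + eta_mat ** M"

lemma bounded_linear_skew: "bounded_linear skew"
  unfolding linear_conv_bounded_linear[symmetric]
  by (intro linearI) (simp_all add: skew_def transpose_add transpose_scalar matrix_mult_algebra algebra_simps)

text \<open>In the gauge the metric is the constant matrix \<eta>, so compatibility makes the
  connection matrix orthogonal in the sense of Lie algebras. This follows by differentiating G = h^T
  \<eta> h and comparing with the compatibility equation.\<close>

lemma skew_gauge_conn:
  assumes u: "u \<in> W"
  shows "skew (gauge_conn u v) = 0"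
proof -
  define h where "h = vb u"
  have dh: "(vb has_derivative deriv_at vb u) (at u)"
    by (rule smooth_on_has_derivative[OF W vb_smooth u])
  have dhT: "((\<lambda>w. transpose (vb w)) has_derivative (\<lambda>v. transpose (deriv_at vb u v))) (at u)"
    by (rule bounded_linear.has_derivative[OF _ dh])
      (auto simp: linear_conv_bounded_linear[symmetric] transpose_add transpose_scalar intro!: linearI)
  note mult = bounded_bilinear.FDERIV[OF bounded_bilinear_matrix_mult]
  have "deriv_at G u v = deriv_at (\<lambda>w. transpose (vb w) ** eta_mat ** vb w) u v"
    by (rule fun_cong[OF deriv_at_cong_open[OF W u G_matrix]])
  also have "\<dots> = transpose h ** eta_mat ** deriv_at vb u v + transpose (deriv_at vb u v) ** eta_mat ** h"
    by (simp add: frechet_derivative_at[OF mult[OF mult[OF dhT has_derivative_const] dh], symmetric]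
        h_def bounded_bilinear.zero_right[OF bounded_bilinear_matrix_mult])
  finally have dG: "transpose (A u v) ** G u + G u ** A u v
      = transpose h ** eta_mat ** deriv_at vb u v + transpose (deriv_at vb u v) ** eta_mat ** h"
    by (simp add: deriv_G_matrix[OF u])
  have "gauge_conn u v ** h = h ** deriv_at vb_inv u v ** h + h ** A u v ** (vb_inv u ** h)"
    by (simp add: gauge_conn_def h_def matrix_mult_algebra matrix_mul_assoc)
  also have "h ** deriv_at vb_inv u v ** h = - (deriv_at vb u v ** (vb_inv u ** h))"
    by (simp add: vb_deriv_vb_inv[OF u] h_def matrix_mult_algebra matrix_mul_assoc)
  finally have om_h: "gauge_conn u v ** h = h ** A u v - deriv_at vb u v"
    by (simp add: h_def vb_inv_vb[OF u])
  \<comment> \<open>Between h^T and h the connection matrix enters only through its product with h,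
    which is h A - dh and free of inverses.\<close>
  have "transpose h ** skew (gauge_conn u v) ** h = transpose (gauge_conn u v ** h) ** eta_mat ** h + transpose h ** eta_mat ** (gauge_conn u v ** h)"
    by (simp add: skew_def matrix_mult_algebra matrix_mul_assoc matrix_transpose_mul)
  also have "\<dots> = (transpose (A u v) ** G u + G u ** A u v)
      - (transpose h ** eta_mat ** deriv_at vb u v + transpose (deriv_at vb u v) ** eta_mat ** h)"
    by (simp add: om_h G_matrix[OF u] h_def[symmetric] matrix_mult_algebra matrix_mul_assoc
        transpose_diff matrix_transpose_mul)
  finally have "transpose h ** skew (gauge_conn u v) ** h = 0" by (simp add: dG)
  then have "transpose (h ** vb_inv u) ** skew (gauge_conn u v) ** (h ** vb_inv u) = 0"
    by (simp add: matrix_transpose_mul matrix_mul_assoc[symmetric])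
      (simp add: matrix_mul_assoc bounded_bilinear.zero_left[OF bounded_bilinear_matrix_mult]
        bounded_bilinear.zero_right[OF bounded_bilinear_matrix_mult])
  then show ?thesis by (simp add: h_def vb_vb_inv[OF u])
qed

text \<open>Skewness passes to derivatives because \<open>skew\<close> is linear with constant
  coefficients. A product need not be skew, but both orders of the product have the same
  \<open>skew\<close>, so the commutator is.\<close>

lemma skew_gauge_curv:
  assumes u: "u \<in> W"
  shows "skew (gauge_curv u x y) = 0"
proof -
  have "skew (deriv_at (\<lambda>w. gauge_conn w y) u x) = 0" for x y
  proof -
    have "skew (deriv_at (\<lambda>w. gauge_conn w y) u x) = deriv_at (\<lambda>w. skew (gauge_conn w y)) u x"
      by (rule deriv_at_linear[OF bounded_linear_skew smooth_on_differentiable[OF W gauge_conn_smooth u], symmetric])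
    also have "\<dots> = deriv_at (\<lambda>w. 0) u x"
      by (rule fun_cong[OF deriv_at_cong_open[OF W u skew_gauge_conn]])
    finally show ?thesis by (simp add: deriv_at_const)
  qed
  moreover have "skew (gauge_conn u x ** gauge_conn u y) = skew (gauge_conn u y ** gauge_conn u x)"
  proof -
    have sk: "transpose (gauge_conn u x) ** eta_mat = - (eta_mat ** gauge_conn u x)" for x
      using skew_gauge_conn[OF u, of x] by (simp add: skew_def eq_neg_iff_add_eq_0)
    have "transpose (gauge_conn u x ** gauge_conn u y) ** eta_mat = eta_mat ** gauge_conn u y ** gauge_conn u x" for x y
    proof -
      have "transpose (gauge_conn u x ** gauge_conn u y) ** eta_mat = transpose (gauge_conn u y) ** (transpose (gauge_conn u x) ** eta_mat)"
        by (simp add: matrix_transpose_mul matrix_mul_assoc)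
      also have "\<dots> = - ((transpose (gauge_conn u y) ** eta_mat) ** gauge_conn u x)"
        by (simp add: sk[of x] matrix_mult_algebra matrix_mul_assoc)
      finally show ?thesis by (simp add: sk[of y] matrix_mult_algebra)
    qed
    then show ?thesis by (simp add: skew_def matrix_mul_assoc add.commute)
  qed
  ultimately show ?thesis
    using bounded_linear.linear[OF bounded_linear_skew]
    by (simp add: gauge_curv_def linear_add linear_diff)
qed

text \<open>Skewness exchanges the frame indices with one sign, antisymmetry exchanges the vectors
  with another, and the two signs cancel.\<close>

lemma gauge_curv_skew_nth:
  assumes u: "u \<in> W"
  shows "\<eta> b * gauge_curv u x y $ a $ b = \<eta> a * gauge_curv u y x $ b $ a"
proof -
  have "(transpose (gauge_curv u x y) ** eta_mat + eta_mat ** gauge_curv u x y) $ a $ b = 0"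
    using skew_gauge_curv[OF u, of x y] by (simp add: skew_def)
  then have "gauge_curv u x y $ b $ a * \<eta> b + \<eta> a * gauge_curv u x y $ a $ b = 0"
    by (simp add: mult_eta_mat_nth eta_mat_mult_nth transpose_def)
  moreover have "gauge_curv u x y $ b $ a = - gauge_curv u y x $ b $ a"
    using gauge_curv_antisym[of u x y] by simp
  ultimately show ?thesis using \<eta>[of a] \<eta>[of b] by auto
qed

abbreviation "g_coord \<equiv> coord_metric sh N G"

lemma matrix_inv_G: "u \<in> W \<Longrightarrow> matrix_inv (G u) = vb_inv u ** eta_mat ** transpose (vb_inv u)"
proof (rule matrix_inv_unique)
  assume u: "u \<in> W"
  have "G u ** (vb_inv u ** eta_mat ** transpose (vb_inv u)) = transpose (vb u) ** eta_mat ** (vb u ** vb_inv u) ** eta_mat ** transpose (vb_inv u)"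
    by (simp add: G_matrix[OF u] matrix_mul_assoc)
  also have "\<dots> = transpose (vb u) ** (eta_mat ** eta_mat) ** transpose (vb_inv u)"
    by (simp add: vb_vb_inv[OF u] matrix_mul_assoc)
  also have "\<dots> = transpose (vb_inv u ** vb u)" by (simp add: eta_mat_eta_mat matrix_transpose_mul)
  finally show "G u ** (vb_inv u ** eta_mat ** transpose (vb_inv u)) = mat 1" by (simp add: vb_inv_vb[OF u])
qed

lemma vb_matrix_inv_G: "u \<in> W \<Longrightarrow> vb u ** matrix_inv (G u) = eta_mat ** transpose (vb_inv u)"
  by (simp add: matrix_inv_G matrix_mul_assoc vb_vb_inv)

lemma invertible_G:
  assumes u: "u \<in> W"
  shows "invertible (G u)"
proof -
  have "invertible eta_mat" using eta_mat_eta_mat invertible_right_inverse by blast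
  then show ?thesis
    unfolding G_matrix[OF u] by (intro invertible_mult transpose_invertible vb_invertible[OF u])
qed

lemma coord_metric_inverse:
  assumes u: "u \<in> W"
  shows "g_coord u ** (F u ** matrix_inv (G u) ** transpose (F u)) = mat 1"
proof -
  have "g_coord u ** (F u ** matrix_inv (G u) ** transpose (F u))
      = transpose (P u) ** G u ** (P u ** F u) ** matrix_inv (G u) ** transpose (F u)"
    by (simp add: coord_metric_def matrix_mul_assoc)
  also have "\<dots> = transpose (P u) ** (G u ** matrix_inv (G u)) ** transpose (F u)"
    by (simp add: ncoframe_nframe matrix_mul_assoc)
  also have "\<dots> = transpose (F u ** P u)"
    by (simp add: matrix_inv_left_right[OF invertible_G[OF u]] matrix_transpose_mul)
  finally show ?thesis by (simp add: nframe_ncoframe)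
qed

lemma invertible_coord_metric: "u \<in> W \<Longrightarrow> invertible (g_coord u)"
  using coord_metric_inverse invertible_right_inverse by blast

lemma coord_metric_smooth: "smooth_on W g_coord"
  unfolding coord_metric_def[abs_def]
  by (intro smooth_on_matrix_mult smooth_on_transpose W ncoframe_smooth G_smooth)

text \<open>The gauge frame is orthonormal, so raising the index of \<chi>^b gives the frame vector
  e_b up to the sign \<open>\<eta> b\<close>.\<close>

lemma shift_sharp:
  assumes u: "u \<in> W"
  shows "(vb u *v (P u *v (matrix_inv (g_coord u) *v axis j 1))) $ b = \<eta> b * (F u ** vb_inv u) $ j $ b"
proof -
  have "vb u ** (P u ** matrix_inv (g_coord u))
      = vb u ** (P u ** F u) ** matrix_inv (G u) ** transpose (F u)"
    by (simp add: matrix_inv_unique[OF coord_metric_inverse[OF u]] matrix_mul_assoc)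
  also have "\<dots> = eta_mat ** transpose (F u ** vb_inv u)"
    by (simp add: ncoframe_nframe vb_matrix_inv_G[OF u] matrix_transpose_mul matrix_mul_assoc)
  finally have eq: "vb u ** (P u ** matrix_inv (g_coord u)) = eta_mat ** transpose (F u ** vb_inv u)" .
  have "vb u *v (P u *v (matrix_inv (g_coord u) *v axis j 1)) = column j (eta_mat ** transpose (F u ** vb_inv u))"
    unfolding eq[symmetric] matrix_vector_mult_basis[symmetric] by (simp only: matrix_vector_mul_assoc)
  then show ?thesis by (simp only: column_nth eta_mat_mult_nth) (simp add: transpose_def)
qed

lemma sum_scaleR_column: "(\<Sum>b\<in>UNIV. M $ b $ \<tau> *\<^sub>R column b X) = column \<tau> (X ** (M :: real^'a^'b))"
  by (simp add: vec_eq_iff column_def matrix_matrix_mult_def sum_component mult.commute)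

text \<open>Metricity enters by exchanging the two frame indices of the curvature.\<close>

lemma curvature_contraction:
  assumes u: "u \<in> W"
  shows "(\<Sum>b\<in>UNIV. \<Sum>j\<in>UNIV. (vb u *v (P u *v (matrix_inv (g_coord u) *v axis j 1))) $ b * gauge_curv u v (axis j 1) $ a $ b)
    = (\<Sum>l\<in>UNIV. \<Sum>m\<in>UNIV. ricci sh N \<Gamma> u $ l $ m * (vb u ** matrix_inv (G u)) $ a $ l * (P u *v v) $ m)"
proof -
  define e where "e = (\<lambda>b. column b (F u ** vb_inv u))"
  \<comment> \<open>Summing over j contracts with the raised \<chi>^b and puts \<open>e b\<close>
    into the second slot; metricity then moves it to the first slot and exchanges a and b.\<close>
  have "(\<Sum>j\<in>UNIV. (vb u *v (P u *v (matrix_inv (g_coord u) *v axis j 1))) $ b * gauge_curv u v (axis j 1) $ a $ b)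
      = \<eta> a * gauge_curv u (e b) v $ b $ a" for b
  proof -
    have "e b = (\<Sum>j\<in>UNIV. (F u ** vb_inv u) $ j $ b *\<^sub>R axis j 1)"
      using basis_expansion[of "e b"] by (simp add: scalar_mult_eq_scaleR e_def column_nth)
    then have "gauge_curv u v (e b) = (\<Sum>j\<in>UNIV. (F u ** vb_inv u) $ j $ b *\<^sub>R gauge_curv u v (axis j 1))"
      by (simp add: linear_sum[OF linear_gauge_curv_right[OF u]] linear_scale[OF linear_gauge_curv_right[OF u]])
    then have "(\<Sum>j\<in>UNIV. (vb u *v (P u *v (matrix_inv (g_coord u) *v axis j 1))) $ b * gauge_curv u v (axis j 1) $ a $ b)
        = \<eta> b * gauge_curv u v (e b) $ a $ b"
      by (simp add: shift_sharp[OF u] sum_component sum_distrib_left mult_ac)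
    then show ?thesis by (simp add: gauge_curv_skew_nth[OF u])
  qed
  moreover have "gauge_curv u (e b) v $ b $ a = (\<Sum>\<tau>\<in>UNIV. vb u $ b $ \<tau> * (\<Theta> u (e b) v ** vb_inv u) $ \<tau> $ a)" for b
    unfolding gauge_curv_eq[OF u] matrix_mul_assoc[symmetric]
    by (simp only: matrix_matrix_mult_def[of "vb u"] vec_lambda_beta)
  ultimately have "(\<Sum>b\<in>UNIV. \<Sum>j\<in>UNIV. (vb u *v (P u *v (matrix_inv (g_coord u) *v axis j 1))) $ b * gauge_curv u v (axis j 1) $ a $ b)
      = (\<Sum>b\<in>UNIV. \<eta> a * (\<Sum>\<tau>\<in>UNIV. vb u $ b $ \<tau> * (\<Theta> u (e b) v ** vb_inv u) $ \<tau> $ a))"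
    by simp
  also have "\<dots> = \<eta> a * (\<Sum>\<tau>\<in>UNIV. \<Sum>b\<in>UNIV. vb u $ b $ \<tau> * (\<Theta> u (e b) v ** vb_inv u) $ \<tau> $ a)"
    by (subst sum.swap) (simp add: sum_distrib_left)
  \<comment> \<open>A trace does not depend on the frame: the entries of \<open>vb\<close>
    reassemble the vectors \<open>e b\<close> into the adapted frame.\<close>
  also have "\<dots> = \<eta> a * (\<Sum>\<tau>\<in>UNIV. (\<Theta> u (delta sh N \<tau> u) v ** vb_inv u) $ \<tau> $ a)"
  proof -
    have lin: "linear (\<lambda>x. \<Theta> u x v ** vb_inv u)"
      using linear_add[OF linear_conn_curv_left[OF u]] linear_scale[OF linear_conn_curv_left[OF u]]
      by (intro linearI) (simp_all add: matrix_mult_algebra)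
    have "delta sh N \<tau> u = (\<Sum>b\<in>UNIV. vb u $ b $ \<tau> *\<^sub>R e b)" for \<tau>
      unfolding e_def sum_scaleR_column by (simp add: matrix_mul_assoc[symmetric] vb_inv_vb[OF u] delta_def)
    then have "\<Theta> u (delta sh N \<tau> u) v ** vb_inv u = (\<Sum>b\<in>UNIV. vb u $ b $ \<tau> *\<^sub>R (\<Theta> u (e b) v ** vb_inv u))" for \<tau>
      by (simp add: linear_sum[OF lin] linear_scale[OF lin])
    then show ?thesis by (simp add: sum_component)
  qed
  also have "\<dots> = (\<Sum>l\<in>UNIV. \<eta> a * vb_inv u $ l $ a * (\<Sum>\<tau>\<in>UNIV. \<Theta> u (delta sh N \<tau> u) v $ \<tau> $ l))"
    unfolding matrix_matrix_mult_def[of _ "vb_inv u"]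
    by (simp add: sum_distrib_left mult_ac) (rule sum.swap)
  \<comment> \<open>Here \<open>\<eta> a * vb_inv u $ l $ a\<close> is the mixed component G^{a
    l}.\<close>
  also have "\<dots> = (\<Sum>l\<in>UNIV. \<Sum>m\<in>UNIV. ricci sh N \<Gamma> u $ l $ m * (vb u ** matrix_inv (G u)) $ a $ l * (P u *v v) $ m)"
    by (simp add: ricci_eq[OF u, symmetric] vb_matrix_inv_G[OF u] eta_mat_mult_nth transpose_def sum_distrib_left mult_ac)
  finally show ?thesis .
qed

abbreviation "ricci_source \<equiv> translation_source sh N G vb (ricci sh N \<Gamma>)"

lemma linear_shift_nth: "linear (\<lambda>v. (vb u *v (P u *v v)) $ b)"
  by (intro linearI) (simp_all add: matrix_vector_right_distrib matrix_vector_mult_scaleR)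

text \<open>The left side is the part of the Cartan bracket that involves \<chi>; its minus sign is
  that of the second term in \<open>aff_bracket\<close>. This is the formula for (Ri) before the
  inverse Hodge operator is applied.\<close>

lemma translation_bracket:
  assumes u: "u \<in> W"
  shows "- (\<Sum>j<length vs. (-1) ^ j *\<^sub>R (hodge (g_coord u) 2 (curv_form u) (omit j vs) *v shifting u [vs ! j]))
    = hodge (g_coord u) 1 (ricci_source u) vs"
proof (cases "length vs + 1 = CARD('n)")
  case False
  then have "hodge (g_coord u) 2 (curv_form u) (omit j vs) = 0" if "j < length vs" for j
    using that length_omit[OF that] by (simp add: hodge_def)
  then show ?thesis using False by (simp add: hodge_def)
next
  case True
  let ?s = "\<lambda>j. matrix_inv (g_coord u) *v axis j 1"
  let ?l = "\<lambda>b v. (vb u *v (P u *v v)) $ b"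
  let ?V = "\<lambda>i. volume_form (g_coord u) (vs @ [?s i])"
  have "(\<Sum>j<length vs. (-1) ^ j *\<^sub>R (hodge (g_coord u) 2 (curv_form u) (omit j vs) *v shifting u [vs ! j])) $ a
      = (\<Sum>b\<in>UNIV. \<Sum>j<length vs. (-1) ^ j *\<^sub>R (?l b (vs ! j) *\<^sub>R hodge (g_coord u) 2 (\<lambda>us. curv_form u us $ a $ b) (omit j vs)))"
    for a
  proof -
    have "hodge (g_coord u) 2 (curv_form u) us $ a $ b = hodge (g_coord u) 2 (\<lambda>us. curv_form u us $ a $ b) us" for us b
      by (rule hodge_linear[OF bounded_linear.linear[OF bounded_linear_matrix_nth]])
    then show ?thesis
      by (subst sum.swap) (simp add: sum_component matrix_vector_mult_def[of "hodge _ _ _ _"] shift_form_def one_form_def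
          sum_distrib_left mult_ac)
  qed
  also have "\<dots> a = (\<Sum>b\<in>UNIV. (-1) ^ CARD('n) *\<^sub>R (\<Sum>i\<in>UNIV. ?V i *\<^sub>R
      (\<Sum>j\<in>UNIV. ?l b (?s j) *\<^sub>R gauge_curv u (axis i 1) (axis j 1) $ a $ b)))" for a
  proof (intro sum.cong refl)
    fix b
    have K: "curv_form u [x, y] $ a $ b = - curv_form u [y, x] $ a $ b" for x y
      unfolding curvature_form_eq[OF u] by (subst gauge_curv_antisym) simp
    show "(\<Sum>j<length vs. (-1) ^ j *\<^sub>R (?l b (vs ! j) *\<^sub>R hodge (g_coord u) 2 (\<lambda>us. curv_form u us $ a $ b) (omit j vs)))
        = (-1) ^ CARD('n) *\<^sub>R (\<Sum>i\<in>UNIV. ?V i *\<^sub>R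
            (\<Sum>j\<in>UNIV. ?l b (?s j) *\<^sub>R gauge_curv u (axis i 1) (axis j 1) $ a $ b))"
      using wedge_hodge_two[OF linear_shift_nth _ True, of "\<lambda>us. curv_form u us $ a $ b" u b "g_coord u"] K
      unfolding curvature_form_eq[OF u] by blast
  qed
  \<comment> \<open>The sign (-1)^(n+1) of the source is the (-1)^n of the wedge identity times the
    minus sign of the bracket.\<close>
  also have "\<dots> a = - (\<Sum>i\<in>UNIV. ?V i * ricci_source u [axis i 1] $ a)" for a
  proof -
    have "ricci_source u [v] $ a = (-1) ^ (CARD('n) + 1) *
        (\<Sum>b\<in>UNIV. \<Sum>j\<in>UNIV. ?l b (?s j) * gauge_curv u v (axis j 1) $ a $ b)" for v
      by (simp add: translation_source_def one_form_def curvature_contraction[OF u])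
    moreover have "(\<Sum>b\<in>UNIV. c *\<^sub>R (\<Sum>i\<in>UNIV. x i *\<^sub>R y i b)) = - (\<Sum>i\<in>UNIV. x i * (- c * (\<Sum>b\<in>UNIV. y i b)))"
      for c :: real and x :: "'n \<Rightarrow> real" and y :: "'n \<Rightarrow> 'n \<Rightarrow> real"
      by (simp add: sum_distrib_left sum_negf mult_ac) (rule sum.swap)
    ultimately show ?thesis by simp
  qed
  finally show ?thesis
    unfolding hodge_one by (simp add: vec_eq_iff sum_component)
qed

lemma alt_form_translation_source: "alt_form 1 (translation_source sh N G vb S u)"
  unfolding translation_source_def
  by (intro alt_form_one_form linearI)
    (simp_all add: vec_eq_iff matrix_vector_right_distrib matrix_vector_mult_scaleR distrib_left
      sum.distrib sum_distrib_left mult_ac)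

text \<open>The only coupling between the components is the bracket of \<chi> with the dual of the
  linear curvature. Being itself the dual of a 1-form, this extra term is recovered exactly by the
  inverse Hodge operator.\<close>

lemma ym_cartan_eq:
  assumes u: "u \<in> W"
  shows "ym_cartan sh N G \<Gamma> vb u
    = (\<lambda>vs. (ym_linear sh N G \<Gamma> vb u vs, ym_torsion sh N G \<Gamma> vb u vs + ricci_source u vs))"
proof -
  define HK where "HK = (\<lambda>w. hodge (g_coord w) 2 (curv_form w))"
  define HT where "HT = (\<lambda>w. hodge (g_coord w) 2 (tors w))"
  define H where "H = (\<lambda>w. hodge (g_coord w) 2 (curvature_form aff_bracket cartan w))"
  note g = invertible_coord_metric[OF u]
  \<comment> \<open>Known on \<open>W\<close> only; as \<open>W\<close> is open, this suffices for
    the exterior derivative at u.\<close>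
  have H: "H w vs = (HK w vs, HT w vs)" if "w \<in> W" for w vs
    by (simp add: H_def HK_def HT_def cartan_curvature[OF that] hodge_Pair)
  have HK_diff: "(\<lambda>w. HK w vs) differentiable (at u)" for vs
    unfolding HK_def
    by (rule hodge_differentiable[OF W coord_metric_smooth invertible_coord_metric curvature_form_linear_smooth u])
  have HT_diff: "(\<lambda>w. HT w vs) differentiable (at u)" for vs
    unfolding HT_def
    by (rule hodge_differentiable[OF W coord_metric_smooth invertible_coord_metric torsion_form_smooth u])
  have dH: "ext_d H u = (\<lambda>vs. (ext_d HK u vs, ext_d HT u vs))"
    using ext_d_cong[OF W u H] ext_d_Pair[OF HK_diff HT_diff] by auto
  have alt_dK: "alt_form (CARD('n) - 1) (ext_d HK u)" and alt_dT: "alt_form (CARD('n) - 1) (ext_d HT u)"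
    unfolding HK_def HT_def
    by (rule alt_form_ext_d_hodge_two[OF HK_diff[unfolded HK_def]],
        rule alt_form_ext_d_hodge_two[OF HT_diff[unfolded HT_def]])
  have lin_cf: "linear (\<lambda>v. conn_form u [v])"
    using linear_gauge_conn[OF u] by (simp add: connection_form_eq[OF u] one_form_def)
  have alt_bK: "alt_form (CARD('n) - 1) (form_bracket gl_bracket conn_form HK u)"
    and alt_bT: "alt_form (CARD('n) - 1) (form_bracket (*v) conn_form HT u)"
    unfolding HK_def HT_def
    by (intro alt_form_form_bracket_hodge_two bounded_bilinear_gl_bracket bounded_bilinear_matrix_vector_mult lin_cf)+
  have alt_ric: "alt_form (CARD('n) - 1) (hodge (g_coord u) 1 (ricci_source u))"
    by (intro alt_form_hodge) simp
  have bH: "form_bracket aff_bracket cartan H u = (\<lambda>vs. (form_bracket gl_bracket conn_form HK u vs,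
      form_bracket (*v) conn_form HT u vs + hodge (g_coord u) 1 (ricci_source u) vs))"
  proof
    fix vs
    have "form_bracket aff_bracket cartan H u vs = (form_bracket gl_bracket conn_form HK u vs,
        form_bracket (*v) conn_form HT u vs - (\<Sum>j<length vs. (-1) ^ j *\<^sub>R (HK u (omit j vs) *v shifting u [vs ! j])))"
      by (simp add: form_bracket_def H[OF u] aff_bracket_def cartan_form_def prod_eq_iff fst_sum snd_sum
          scaleR_diff_right sum_subtractf)
    then show "form_bracket aff_bracket cartan H u vs = (form_bracket gl_bracket conn_form HK u vs,
        form_bracket (*v) conn_form HT u vs + hodge (g_coord u) 1 (ricci_source u) vs)"
      using translation_bracket[OF u, of vs] by (simp add: HK_def)
  qed
  have "hodge_inv (g_coord u) 1 (ext_d H u) = (\<lambda>vs. (hodge_inv (g_coord u) 1 (ext_d HK u) vs, hodge_inv (g_coord u) 1 (ext_d HT u) vs))"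
    unfolding dH by (rule hodge_inv_one_Pair[OF g alt_dK alt_dT])
  moreover have "hodge_inv (g_coord u) 1 (form_bracket aff_bracket cartan H u)
      = (\<lambda>vs. (hodge_inv (g_coord u) 1 (form_bracket gl_bracket conn_form HK u) vs,
          hodge_inv (g_coord u) 1 (form_bracket (*v) conn_form HT u) vs + ricci_source u vs))"
    unfolding bH hodge_inv_one_Pair[OF g alt_bK alt_form_add[OF alt_bT alt_ric]]
      hodge_inv_one_add[OF g alt_bT alt_ric] hodge_inv_one[OF g alt_form_translation_source] ..
  ultimately show ?thesis
    by (simp add: fun_eq_iff ym_cartan_def ym_linear_def ym_torsion_def yang_mills_def codiff_def
        H_def HK_def HT_def add.assoc)
qed

text \<open>Tested on the adapted frame, the form gives up to sign the entries of M S, where M =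
  \<chi> G^-1 is invertible, so S can be recovered.\<close>

lemma translation_source_inject:
  assumes u: "u \<in> W" and eq: "translation_source sh N G vb S u = translation_source sh N G vb S' u"
  shows "S u = S' u"
proof -
  define M where "M = vb u ** matrix_inv (G u)"
  have M: "invertible M"
    unfolding M_def using matrix_inv_left_right[OF invertible_G[OF u]]
    by (intro invertible_mult vb_invertible[OF u]) (auto simp: invertible_def)
  have nth: "translation_source sh N G vb S u [delta sh N m u] $ a = (-1) ^ (CARD('n) + 1) * (M ** S u) $ a $ m" for S a m
  proof -
    have "(\<Sum>j\<in>UNIV. S u $ l $ j * M $ a $ l * (axis m 1 :: real^'n) $ j) = M $ a $ l * S u $ l $ m" for l
    proof -
      have "(\<Sum>j\<in>UNIV. S u $ l $ j * M $ a $ l * (axis m 1 :: real^'n) $ j)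
          = (\<Sum>j\<in>UNIV. if j = m then M $ a $ l * S u $ l $ m else 0)"
        by (intro sum.cong) (auto simp: axis_def)
      then show ?thesis by simp
    qed
    then show ?thesis
      by (simp add: translation_source_def one_form_def ncoframe_delta M_def[symmetric])
        (simp add: matrix_matrix_mult_def)
  qed
  have "(M ** S u) $ a $ m = (M ** S' u) $ a $ m" for a m
    using nth[of S m a] nth[of S' m a] by (simp add: eq)
  then have "M ** S u = M ** S' u" by (simp add: vec_eq_iff)
  then have "matrix_inv M ** M ** S u = matrix_inv M ** M ** S' u"
    by (simp add: matrix_mul_assoc[symmetric])
  then show ?thesis by (simp add: matrix_inv_left_right[OF M])
qed

lemma ym_equation_iff:
  assumes u: "u \<in> W"
  shows "ym_cartan sh N G \<Gamma> vb u = ym_source sh N G \<Gamma> vb E' u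
    \<longleftrightarrow> ricci sh N \<Gamma> u = E' u - (1/2 * g_trace (G u) (E' u)) *\<^sub>R G u"
    (is "_ \<longleftrightarrow> _ = ?S u")
proof
  assume "ym_cartan sh N G \<Gamma> vb u = ym_source sh N G \<Gamma> vb E' u"
  then have "ricci_source u = translation_source sh N G vb (\<lambda>w. E' w - (1/2 * g_trace (G w) (E' w)) *\<^sub>R G w) u"
    by (simp add: ym_cartan_eq[OF u] ym_source_def fun_eq_iff)
  from translation_source_inject[OF u this]
  show "ricci sh N \<Gamma> u = E' u - (1/2 * g_trace (G u) (E' u)) *\<^sub>R G u" .
next
  assume "ricci sh N \<Gamma> u = E' u - (1/2 * g_trace (G u) (E' u)) *\<^sub>R G u"
  then have "ricci_source u = translation_source sh N G vb (\<lambda>w. E' w - (1/2 * g_trace (G w) (E' w)) *\<^sub>R G w) u"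
    by (simp add: translation_source_def one_form_def fun_eq_iff)
  then show "ym_cartan sh N G \<Gamma> vb u = ym_source sh N G \<Gamma> vb E' u"
    by (simp add: ym_cartan_eq[OF u] ym_source_def fun_eq_iff)
qed

end

section \<open>The Einstein equations\<close>

lemma g_trace_diff: "g_trace G (A - B) = g_trace G A - g_trace G B"
  by (simp add: g_trace_def right_diff_distrib sum_subtractf)

lemma g_trace_scaleR: "g_trace G (c *\<^sub>R A) = c * g_trace G A"
  by (simp add: g_trace_def sum_distrib_left mult_ac)

lemma g_trace_self:
  fixes G :: "real^'n^'n::finite"
  assumes "transpose G = G" "invertible G"
  shows "g_trace G G = CARD('n)"
proof -
  have "G $ \<alpha> $ \<beta> = G $ \<beta> $ \<alpha>" for \<alpha> \<beta>
  proof -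
    have "transpose G $ \<alpha> $ \<beta> = G $ \<alpha> $ \<beta>" by (simp only: assms(1))
    then show ?thesis by (simp add: transpose_def)
  qed
  then have "g_trace G G = (\<Sum>\<alpha>\<in>UNIV. (matrix_inv G ** G) $ \<alpha> $ \<alpha>)"
    by (simp add: g_trace_def matrix_matrix_mult_def)
  then show ?thesis by (simp add: matrix_inv_left_right[OF assms(2)] mat_def)
qed

text \<open>Each equation turns into the other once tr R = - tr E' is known. For n = 4 the factor 1
  - n/2 is -1; otherwise tr E' = 0, and n \<noteq> 2 allows division by that factor.\<close>

lemma trace_reversal_iff:
  fixes R G E' :: "real^'n^'n::finite"
  assumes G: "transpose G = G" "invertible G"
    and dim: "CARD('n) = 4 \<or> (CARD('n) \<noteq> 2 \<and> g_trace G E' = 0)"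
  shows "R - (1/2 * g_trace G R) *\<^sub>R G = E' \<longleftrightarrow> R = E' - (1/2 * g_trace G E') *\<^sub>R G"
proof
  assume eq: "R - (1/2 * g_trace G R) *\<^sub>R G = E'"
  then have tr: "g_trace G E' = g_trace G R - 1/2 * g_trace G R * CARD('n)"
    by (auto simp: g_trace_diff g_trace_scaleR g_trace_self[OF G])
  have "g_trace G R = - g_trace G E'"
  proof (cases "CARD('n) = 4")
    case False
    then have n: "CARD('n) \<noteq> 2" and E': "g_trace G E' = 0" using dim by auto
    then have "g_trace G R * (real CARD('n) - 2) = 0" using tr by (simp add: algebra_simps)
    then show ?thesis using n E' by simp
  qed (simp add: tr)
  then show "R = E' - (1/2 * g_trace G E') *\<^sub>R G" using eq by (simp add: algebra_simps)
next
  assume eq: "R = E' - (1/2 * g_trace G E') *\<^sub>R G"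
  then have tr: "g_trace G R = g_trace G E' - 1/2 * g_trace G E' * CARD('n)"
    by (auto simp: g_trace_diff g_trace_scaleR g_trace_self[OF G])
  have trR: "g_trace G R = - g_trace G E'" using dim by (auto simp: tr)
  show "R - (1/2 * g_trace G R) *\<^sub>R G = E'" unfolding trR using eq by (simp add: algebra_simps)
qed

section \<open>From the bundle to its charts and regions\<close>

context anisotropic_space
begin

lemma chart_connection: "c \<in> C \<Longrightarrow> local_connection sh (N c) (\<Gamma> c) (chart_image pr V \<phi> c)"
  by (intro local_connection.intro image_open N_smooth \<Gamma>_smooth)

text \<open>Compatibility is assumed for smooth vector fields; testing it on the adapted frame
  fields, whose components in that frame are constant, gives the component form.\<close>

lemma metric_compatible:
  assumes c: "c \<in> C" and u: "u \<in> chart_image pr V \<phi> c"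
  shows "deriv_at (\<lambda>w. G c w $ \<alpha> $ \<beta>) u v
    = (\<Sum>\<gamma>\<in>UNIV. conn_matrix sh (N c) (\<Gamma> c) u v $ \<gamma> $ \<alpha> * G c u $ \<gamma> $ \<beta>)
    + (\<Sum>\<gamma>\<in>UNIV. G c u $ \<alpha> $ \<gamma> * conn_matrix sh (N c) (\<Gamma> c) u v $ \<gamma> $ \<beta>)"
proof -
  note smooth = local_connection.delta_smooth[OF chart_connection[OF c]]
  have form: "metric_form sh (N c) (G c) w (nframe sh (N c) w *v x) (nframe sh (N c) w *v y)
      = x \<bullet> (G c w *v y)" for w x y
    by (simp add: metric_form_def ncoframe_nframe_vector)
  have delta: "delta sh (N c) \<alpha> w = nframe sh (N c) w *v axis \<alpha> 1" for \<alpha> w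
    by (simp add: delta_def matrix_vector_mult_basis)
  have axis: "axis \<alpha> 1 \<bullet> x = x $ \<alpha>" for \<alpha> and x :: "real^'n"
    by (simp add: inner_axis')
  have columns: "column \<alpha> M \<bullet> column \<beta> M' = (\<Sum>\<gamma>\<in>UNIV. M $ \<gamma> $ \<alpha> * M' $ \<gamma> $ \<beta>)"
    "(M *v column \<beta> M') $ \<alpha> = (\<Sum>\<gamma>\<in>UNIV. M $ \<alpha> $ \<gamma> * M' $ \<gamma> $ \<beta>)" for M M' :: "real^'n^'n" and \<alpha> \<beta>
    by (simp_all add: inner_vec_def column_nth matrix_vector_mult_def)
  have "deriv_at (\<lambda>w. metric_form sh (N c) (G c) w (delta sh (N c) \<alpha> w) (delta sh (N c) \<beta> w)) u v
      = metric_form sh (N c) (G c) u (nabla sh (N c) (\<Gamma> c) (delta sh (N c) \<alpha>) u v) (delta sh (N c) \<beta> u)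
      + metric_form sh (N c) (G c) u (delta sh (N c) \<alpha> u) (nabla sh (N c) (\<Gamma> c) (delta sh (N c) \<beta>) u v)"
    by (rule \<Gamma>_compatible[OF c smooth smooth u])
  then show ?thesis
    unfolding nabla_delta unfolding delta form
    by (simp only: axis columns matrix_vector_mult_basis column_nth)
qed

lemma metric_gauge:
  assumes c: "c \<in> C" and gauge: "local_gauge sh (G c) U \<eta> vb" and sub: "U \<subseteq> chart_image pr V \<phi> c"
  shows "metric_gauge sh (N c) (\<Gamma> c) U vb (G c) \<eta>"
proof -
  have gd: "open U" "smooth_on U vb" "\<And>a. \<eta> a = 1 \<or> \<eta> a = -1"
    "\<And>u \<alpha> \<beta>. u \<in> U \<Longrightarrow> G c u $ \<alpha> $ \<beta> = (\<Sum>a\<in>UNIV. vb u $ a $ \<alpha> * vb u $ a $ \<beta> * \<eta> a)"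
    using gauge unfolding local_gauge_def by blast+
  \<comment> \<open>Nonsingularity of the gauge comes from the metric: \<open>det (vb u)\<close> is
    a factor of the nonzero \<open>det (G c u)\<close>.\<close>
  have inv: "invertible (vb u)" if u: "u \<in> U" for u
  proof -
    have "G c u = transpose (\<chi> a \<alpha>. vb u $ a $ \<alpha> * \<eta> a) ** vb u"
      by (simp add: vec_eq_iff gd(4)[OF u] matrix_matrix_mult_def transpose_def mult_ac)
    then have "det (vb u) \<noteq> 0"
      using G_metric[OF c] sub u by (force simp: invertible_det_nz det_mul)
    then show ?thesis by (simp add: invertible_det_nz)
  qed
  have G: "smooth_on (chart_image pr V \<phi> c) (G c)" using G_tensor c unfolding d_tensor_def by blast
  show ?thesis
    using gd inv sub metric_compatible[OF c]
    by unfold_locales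
      (auto intro: smooth_on_subset[OF N_smooth[OF c]] smooth_on_subset[OF \<Gamma>_smooth[OF c]] smooth_on_subset[OF G])
qed

end

theorem mainTheorem3:
  fixes sh :: "'n::finite \<Rightarrow> nat" and z :: nat
    and pr :: "'e::{t2_space,second_countable_topology} \<Rightarrow> 'm::{t2_space,second_countable_topology}"
    and C :: "'c set" and V :: "'c \<Rightarrow> 'm set" and \<phi> :: "'c \<Rightarrow> 'e \<Rightarrow> real^'n"
    and N G E :: "'c \<Rightarrow> real^'n \<Rightarrow> real^'n^'n"
    and \<Gamma> :: "'c \<Rightarrow> real^'n \<Rightarrow> 'n \<Rightarrow> 'n \<Rightarrow> 'n \<Rightarrow> real"
    and lam kap :: real
    and \<U> :: "'r set" and ch :: "'r \<Rightarrow> 'c" and W :: "'r \<Rightarrow> (real^'n) set"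
    and \<eta> :: "'r \<Rightarrow> 'n \<Rightarrow> real" and vb :: "'r \<Rightarrow> real^'n \<Rightarrow> real^'n^'n"
  assumes space: "anisotropic_space sh z pr C V \<phi> N G \<Gamma>"
    and energy: "d_tensor sh pr C V \<phi> N E"
    and gauges: "\<And>r. r \<in> \<U> \<Longrightarrow> ch r \<in> C \<and> local_gauge sh (G (ch r)) (W r) (\<eta> r) (vb r)"
    and regions: "\<And>c. c \<in> C \<Longrightarrow> (\<Union>r \<in> {r \<in> \<U>. ch r = c}. W r) = chart_image pr V \<phi> c"
    and dimension: "CARD('n) = 4 \<or>
      (CARD('n) \<noteq> 2 \<and> (\<forall>c\<in>C. \<forall>u\<in>chart_image pr V \<phi> c.
         g_trace (G c u) (shifted_source lam kap (G c) (E c) u) = 0))"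
  shows "(\<forall>c\<in>C. \<forall>u\<in>chart_image pr V \<phi> c. \<forall>\<alpha> \<beta>.
            ricci sh (N c) (\<Gamma> c) u $ \<alpha> $ \<beta>
            - 1/2 * scalar_curvature sh (N c) (G c) (\<Gamma> c) u * G c u $ \<alpha> $ \<beta>
            + lam * G c u $ \<alpha> $ \<beta> = kap * E c u $ \<alpha> $ \<beta>)
     \<longleftrightarrow>
         (\<forall>r\<in>\<U>. \<forall>u\<in>W r.
            ym_cartan sh (N (ch r)) (G (ch r)) (\<Gamma> (ch r)) (vb r) u
            = ym_source sh (N (ch r)) (G (ch r)) (\<Gamma> (ch r)) (vb r)
                (shifted_source lam kap (G (ch r)) (E (ch r))) u)"
proof -
  interpret anisotropic_space sh z pr C V \<phi> N G \<Gamma> by (rule space)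
  let ?E' = "\<lambda>c. shifted_source lam kap (G c) (E c)"
  let ?ym = "\<lambda>c u. ricci sh (N c) (\<Gamma> c) u = ?E' c u - (1/2 * g_trace (G c u) (?E' c u)) *\<^sub>R G c u"
  have einstein: "(\<forall>\<alpha> \<beta>. ricci sh (N c) (\<Gamma> c) u $ \<alpha> $ \<beta>
      - 1/2 * scalar_curvature sh (N c) (G c) (\<Gamma> c) u * G c u $ \<alpha> $ \<beta>
      + lam * G c u $ \<alpha> $ \<beta> = kap * E c u $ \<alpha> $ \<beta>) \<longleftrightarrow> ?ym c u"
    if c: "c \<in> C" and u: "u \<in> chart_image pr V \<phi> c" for c u
  proof -
    \<comment> \<open>With the \<lambda> term moved into the source, the Einstein equations take the
      form required for trace reversal.\<close>
    have "?ym c u \<longleftrightarrow> ricci sh (N c) (\<Gamma> c) u - (1/2 * g_trace (G c u) (ricci sh (N c) (\<Gamma> c) u)) *\<^sub>R G c u = ?E' c u"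
      using G_metric[OF c u] dimension c u by (intro trace_reversal_iff[symmetric]) auto
    then show ?thesis
      by (auto simp: vec_eq_iff shifted_source_def scalar_curvature_def algebra_simps)
  qed
  have sub: "W r \<subseteq> chart_image pr V \<phi> (ch r)" if "r \<in> \<U>" for r
    using regions[of "ch r"] gauges[OF that] that by blast
  have yang_mills: "ym_cartan sh (N (ch r)) (G (ch r)) (\<Gamma> (ch r)) (vb r) u
      = ym_source sh (N (ch r)) (G (ch r)) (\<Gamma> (ch r)) (vb r) (?E' (ch r)) u \<longleftrightarrow> ?ym (ch r) u"
    if "r \<in> \<U>" "u \<in> W r" for r u
    using gauges[OF that(1)] sub[OF that(1)] that(2)
    by (intro metric_gauge.ym_equation_iff[OF metric_gauge]) auto
  \<comment> \<open>Both systems have become the same pointwise condition, free of the gauge, and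
    the regions of a chart cover exactly its image.\<close>
  have "(\<forall>c\<in>C. \<forall>u\<in>chart_image pr V \<phi> c. ?ym c u) \<longleftrightarrow> (\<forall>r\<in>\<U>. \<forall>u\<in>W r. ?ym (ch r) u)"
  proof
    assume "\<forall>c\<in>C. \<forall>u\<in>chart_image pr V \<phi> c. ?ym c u"
    then show "\<forall>r\<in>\<U>. \<forall>u\<in>W r. ?ym (ch r) u" using gauges sub by blast
  next
    assume *: "\<forall>r\<in>\<U>. \<forall>u\<in>W r. ?ym (ch r) u"
    show "\<forall>c\<in>C. \<forall>u\<in>chart_image pr V \<phi> c. ?ym c u"
    proof (intro ballI)
      fix c u assume "c \<in> C" "u \<in> chart_image pr V \<phi> c"
      then obtain r where "r \<in> \<U>" "ch r = c" "u \<in> W r" using regions[of c] by blast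
      then show "?ym c u" using * by blast
    qed
  qed
  then show ?thesis by (simp only: einstein yang_mills cong: ball_cong)
qed

end
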